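(* Assume that the eigenvalues of $\mathcal{L}$ satisfy $\alpha<\lambda_1\le\lambda_2\le\dots$, $\lambda_j\to+\infty$, for some $\alpha>0$, and that $\sum_{j=1}^{+\infty}\mu_j<+\infty$. Let the initial data $y_0\in L^2(D)$ be deterministic. For $s\in(0,+\infty)$ let $y(s)=\sum_{j=1}^{+\infty}y_j(\cdot,s)e_j$ be the solution of the state equation. Then $$\partial_s y(s)=\sum_{j=1}^{+\infty}\partial_s y_j(\cdot,s)\,e_j\qquad\text{and}\qquad \partial_{ss}^2y(s)=\sum_{j=1}^{+\infty}\partial_{ss}y_j(\cdot,s)\,e_j$$ are functions in $L^2\big(\Omega,L^2(D\times[0,T])\big)$. Moreover, for a fixed $s\in(0,+\infty)$, the random variables $\omega\mapsto\|\partial_sy(s,\omega)\|_{L^2(D\times[0,T])}$ and $\omega\mapsto\|\partial_{ss}y(s,\omega)\|_{L^2(D\times[0,T])}$ are almost surely finite.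
   Context: $D\subset\mathbb{R}$ is a bounded open domain, $T>0$, and $\langle\cdot,\cdot\rangle$ is the scalar product of $L^2(D)$. $\mathcal{L}:D(\mathcal{L})\subset L^2(D)\to L^2(D)$ is a densely defined, linear, self-adjoint, positive operator with compact inverse; $\{e_j\}_{j\in\mathbb{N}}$ is an orthonormal basis of $L^2(D)$ of eigenfunctions, $\mathcal{L}e_j=\lambda_je_j$, and $\mathcal{L}^sv=\sum_j\lambda_j^s\langle v,e_j\rangle e_j$ for $s>0$. $(\Omega,\mathcal{F},\mathbb{P})$ is a probability space with a normal filtration $\mathcal{F}_t$, and $W$ is an adapted $L^2(D)$-valued $Q$-Wiener process, with $Q$ linear, bounded, self-adjoint, positive semidefinite, diagonal in the same basis: $Qe_j=\mu_je_j$; $W(x,t)=\sum_j\sqrt{\mu_j}\,e_j(x)B_j(t)$ with $\{B_j\}$ i.i.d. standard real Brownian motions. The state equation is $dy(t)+\mathcal{L}^sy(t)\,dt=dW(t)$ in $D\times[0,T]$, $y(\cdot,0)=y_0$. Its solution is the $L^2(D)$-valued process $$y(s)(x,t)=\sum_{j=1}^{+\infty}y_j(t,s)e_j(x),\qquad y_j(t,s)=\langle y_0,e_j\rangle e^{-\lambda_j^st}+\sqrt{\mu_j}\int_0^te^{-\lambda_j^s(t-\tau)}\,dB_j(\tau).$$ $\partial_s$ and $\partial^2_{ss}$ denote first and second derivatives with respect to the fractional parameter $s$. *)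

theory Defs
  imports "HOL-Probability.Probability"
begin

section \<open>Square-integrable functions\<close>

text \<open>
  Elements of $L^2(M)$ are represented by functions, and equality in $L^2(M)$ is equality almost
  everywhere. The norm takes values in $[0,\infty]$, so that it is meaningful for functions that are
  not square integrable.
\<close>

definition ennreal_sqrt :: "ennreal \<Rightarrow> ennreal" where
  "ennreal_sqrt x = (if x = \<top> then \<top> else ennreal (sqrt (enn2real x)))"

definition L2_norm :: "'a measure \<Rightarrow> ('a \<Rightarrow> real) \<Rightarrow> ennreal" where
  "L2_norm M f = ennreal_sqrt (\<integral>\<^sup>+ x. ennreal ((f x)\<^sup>2) \<partial>M)"

definition L2 :: "'a measure \<Rightarrow> ('a \<Rightarrow> real) set" where
  "L2 M = {f \<in> borel_measurable M. L2_norm M f < \<top>}"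

definition L2_inner :: "'a measure \<Rightarrow> ('a \<Rightarrow> real) \<Rightarrow> ('a \<Rightarrow> real) \<Rightarrow> real" where
  "L2_inner M f g = (\<integral> x. f x * g x \<partial>M)"

definition L2_tendsto ::
    "'a measure \<Rightarrow> ('i \<Rightarrow> 'a \<Rightarrow> real) \<Rightarrow> ('a \<Rightarrow> real) \<Rightarrow> 'i filter \<Rightarrow> bool" where
  "L2_tendsto M f g G \<longleftrightarrow>
     (\<forall>\<^sub>F i in G. f i \<in> L2 M) \<and> g \<in> L2 M \<and>
     ((\<lambda>i. L2_norm M (\<lambda>x. f i x - g x)) \<longlongrightarrow> 0) G"

definition orthonormal_basis_L2 :: "'a measure \<Rightarrow> (nat \<Rightarrow> 'a \<Rightarrow> real) \<Rightarrow> bool" where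
  "orthonormal_basis_L2 M e \<longleftrightarrow>
     (\<forall>j. e j \<in> L2 M) \<and>
     (\<forall>i j. L2_inner M (e i) (e j) = (if i = j then 1 else 0)) \<and>
     (\<forall>v\<in>L2 M. L2_tendsto M (\<lambda>n x. \<Sum>j<n. L2_inner M v (e j) * e j x) v sequentially)"


section \<open>Operators on L2\<close>

text \<open>
  An operator is given by its domain \<open>A\<close> and a map \<open>L\<close>; both have to respect
  almost-everywhere equality.
\<close>

definition linear_operator_L2 ::
    "'a measure \<Rightarrow> ('a \<Rightarrow> real) set \<Rightarrow> (('a \<Rightarrow> real) \<Rightarrow> ('a \<Rightarrow> real)) \<Rightarrow> bool" where
  "linear_operator_L2 M A L \<longleftrightarrow>
     A \<subseteq> L2 M \<and> (\<forall>f\<in>A. L f \<in> L2 M) \<and>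
     (\<forall>f\<in>A. \<forall>g\<in>L2 M. (AE x in M. f x = g x) \<longrightarrow> g \<in> A \<and> (AE x in M. L f x = L g x)) \<and>
     (\<forall>f\<in>A. \<forall>g\<in>A. \<forall>a b. (\<lambda>x. a * f x + b * g x) \<in> A \<and>
        (AE x in M. L (\<lambda>x. a * f x + b * g x) x = a * L f x + b * L g x))"

definition densely_defined_L2 :: "'a measure \<Rightarrow> ('a \<Rightarrow> real) set \<Rightarrow> bool" where
  "densely_defined_L2 M A \<longleftrightarrow>
     (\<forall>f\<in>L2 M. \<exists>g. (\<forall>n. g n \<in> A) \<and> L2_tendsto M g f sequentially)"

text \<open>
  The condition on \<open>g\<close> and \<open>h\<close> on the left says that \<open>g\<close> is in the domain of the adjoint and is
  mapped to \<open>h\<close> by it; so the graphs of the operator and of its adjoint coincide, domains included.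
\<close>

definition self_adjoint_L2 ::
    "'a measure \<Rightarrow> ('a \<Rightarrow> real) set \<Rightarrow> (('a \<Rightarrow> real) \<Rightarrow> ('a \<Rightarrow> real)) \<Rightarrow> bool" where
  "self_adjoint_L2 M A L \<longleftrightarrow>
     (\<forall>g\<in>L2 M. \<forall>h\<in>L2 M.
        (\<forall>f\<in>A. L2_inner M (L f) g = L2_inner M f h) \<longleftrightarrow> (g \<in> A \<and> (AE x in M. L g x = h x)))"

definition positive_L2 ::
    "'a measure \<Rightarrow> ('a \<Rightarrow> real) set \<Rightarrow> (('a \<Rightarrow> real) \<Rightarrow> ('a \<Rightarrow> real)) \<Rightarrow> bool" where
  "positive_L2 M A L \<longleftrightarrow> (\<forall>f\<in>A. \<not> (AE x in M. f x = 0) \<longrightarrow> 0 < L2_inner M (L f) f)"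

definition positive_semidefinite_L2 ::
    "'a measure \<Rightarrow> (('a \<Rightarrow> real) \<Rightarrow> ('a \<Rightarrow> real)) \<Rightarrow> bool" where
  "positive_semidefinite_L2 M Q \<longleftrightarrow> (\<forall>f\<in>L2 M. 0 \<le> L2_inner M (Q f) f)"

definition bounded_operator_L2 ::
    "'a measure \<Rightarrow> (('a \<Rightarrow> real) \<Rightarrow> ('a \<Rightarrow> real)) \<Rightarrow> bool" where
  "bounded_operator_L2 M Q \<longleftrightarrow>
     linear_operator_L2 M (L2 M) Q \<and> (\<exists>C::real. \<forall>f\<in>L2 M. L2_norm M (Q f) \<le> ennreal C * L2_norm M f)"

definition compact_operator_L2 ::
    "'a measure \<Rightarrow> (('a \<Rightarrow> real) \<Rightarrow> ('a \<Rightarrow> real)) \<Rightarrow> bool" where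
  "compact_operator_L2 M K \<longleftrightarrow>
     linear_operator_L2 M (L2 M) K \<and>
     (\<forall>(f :: nat \<Rightarrow> 'a \<Rightarrow> real) C :: real. (\<forall>n. f n \<in> L2 M \<and> L2_norm M (f n) \<le> ennreal C) \<longrightarrow>
        (\<exists>r g. strict_mono r \<and> L2_tendsto M (\<lambda>n. K (f (r n))) g sequentially))"

definition has_compact_inverse_L2 ::
    "'a measure \<Rightarrow> ('a \<Rightarrow> real) set \<Rightarrow> (('a \<Rightarrow> real) \<Rightarrow> ('a \<Rightarrow> real)) \<Rightarrow> bool" where
  "has_compact_inverse_L2 M A L \<longleftrightarrow>
     (\<exists>K. compact_operator_L2 M K \<and>
        (\<forall>g\<in>L2 M. K g \<in> A \<and> (AE x in M. L (K g) x = g x)) \<and>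
        (\<forall>f\<in>A. AE x in M. K (L f) x = f x))"


section \<open>Random variables with values in L2\<close>

text \<open>
  Strong measurability of an $L^2(M)$-valued map on a probability space, and the Bochner space
  $L^2(P; L^2(M))$. As the elements of $L^2(M)$ are represented by functions, an element of the
  Bochner space is represented by a function of two variables.
\<close>

definition strongly_measurable_L2 ::
    "'w measure \<Rightarrow> 'a measure \<Rightarrow> ('w \<Rightarrow> 'a \<Rightarrow> real) \<Rightarrow> bool" where
  "strongly_measurable_L2 P M X \<longleftrightarrow>
     (\<exists>S. (\<forall>n::nat. simple_function P (S n) \<and> (\<forall>\<omega>\<in>space P. S n \<omega> \<in> L2 M)) \<and>
          (AE \<omega> in P. L2_tendsto M (\<lambda>n. S n \<omega>) (X \<omega>) sequentially))"

definition bochner_L2_norm :: "'w measure \<Rightarrow> 'a measure \<Rightarrow> ('w \<Rightarrow> 'a \<Rightarrow> real) \<Rightarrow> ennreal" where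
  "bochner_L2_norm P M X = ennreal_sqrt (\<integral>\<^sup>+ \<omega>. (L2_norm M (X \<omega>))\<^sup>2 \<partial>P)"

definition bochner_L2 :: "'w measure \<Rightarrow> 'a measure \<Rightarrow> ('w \<Rightarrow> 'a \<Rightarrow> real) set" where
  "bochner_L2 P M = {X. strongly_measurable_L2 P M X \<and> bochner_L2_norm P M X < \<top>}"

definition bochner_L2_tendsto ::
    "'w measure \<Rightarrow> 'a measure \<Rightarrow> ('i \<Rightarrow> 'w \<Rightarrow> 'a \<Rightarrow> real) \<Rightarrow> ('w \<Rightarrow> 'a \<Rightarrow> real) \<Rightarrow> 'i filter \<Rightarrow> bool" where
  "bochner_L2_tendsto P M X Z G \<longleftrightarrow>
     (\<forall>\<^sub>F i in G. X i \<in> bochner_L2 P M) \<and> Z \<in> bochner_L2 P M \<and>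
     ((\<lambda>i. bochner_L2_norm P M (\<lambda>\<omega> x. X i \<omega> x - Z \<omega> x)) \<longlongrightarrow> 0) G"

definition has_bochner_L2_derivative ::
    "'w measure \<Rightarrow> 'a measure \<Rightarrow> (real \<Rightarrow> 'w \<Rightarrow> 'a \<Rightarrow> real) \<Rightarrow> ('w \<Rightarrow> 'a \<Rightarrow> real) \<Rightarrow> real \<Rightarrow> bool" where
  "has_bochner_L2_derivative P M u u' s \<longleftrightarrow>
     bochner_L2_tendsto P M (\<lambda>h \<omega> x. (u (s + h) \<omega> x - u s \<omega> x) / h) u' (at 0)"


section \<open>Brownian motion and the Wiener integral\<close>

definition standard_brownian_motion :: "'w measure \<Rightarrow> (real \<Rightarrow> 'w \<Rightarrow> real) \<Rightarrow> bool" where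
  "standard_brownian_motion P B \<longleftrightarrow>
     (\<forall>t\<ge>0. B t \<in> borel_measurable P) \<and>
     (AE \<omega> in P. B 0 \<omega> = 0) \<and>
     (AE \<omega> in P. continuous_on {0..} (\<lambda>t. B t \<omega>)) \<and>
     (\<forall>r t. 0 \<le> r \<and> r < t \<longrightarrow>
        distributed P lborel (\<lambda>\<omega>. B t \<omega> - B r \<omega>) (normal_density 0 (sqrt (t - r)))) \<and>
     (\<forall>(\<tau> :: nat \<Rightarrow> real) n. 0 \<le> \<tau> 0 \<and> strict_mono \<tau> \<longrightarrow>
        prob_space.indep_vars P (\<lambda>_. borel) (\<lambda>i \<omega>. B (\<tau> (Suc i)) \<omega> - B (\<tau> i) \<omega>) {..<n})"

text \<open>
  Integral over $[0,t]$ of a deterministic step function, and its extension to square-integrable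
  deterministic integrands by approximation. The integral is determined up to almost sure equality.
\<close>

definition elementary_wiener_integral ::
    "(real \<Rightarrow> 'w \<Rightarrow> real) \<Rightarrow> real \<Rightarrow> (real \<Rightarrow> real) \<Rightarrow> ('w \<Rightarrow> real) \<Rightarrow> bool" where
  "elementary_wiener_integral B t f X \<longleftrightarrow>
     (\<exists>(n::nat) (\<tau> :: nat \<Rightarrow> real) (c :: nat \<Rightarrow> real).
        \<tau> 0 = 0 \<and> \<tau> n = t \<and> (\<forall>i<n. \<tau> i \<le> \<tau> (Suc i)) \<and>
        f = (\<lambda>r. \<Sum>i<n. c i * indicator {\<tau> i<..\<tau> (Suc i)} r) \<and>
        X = (\<lambda>\<omega>. \<Sum>i<n. c i * (B (\<tau> (Suc i)) \<omega> - B (\<tau> i) \<omega>)))"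

definition has_wiener_integral ::
    "'w measure \<Rightarrow> (real \<Rightarrow> 'w \<Rightarrow> real) \<Rightarrow> real \<Rightarrow> (real \<Rightarrow> real) \<Rightarrow> ('w \<Rightarrow> real) \<Rightarrow> bool" where
  "has_wiener_integral P B t f X \<longleftrightarrow>
     (\<exists>f' X'. (\<forall>k::nat. elementary_wiener_integral B t (f' k) (X' k)) \<and>
        L2_tendsto (restrict_space lborel {0..t}) f' f sequentially \<and>
        L2_tendsto P X' X sequentially)"


section \<open>The stochastic evolution equation\<close>

abbreviation space_measure :: "real set \<Rightarrow> real measure" where
  "space_measure D \<equiv> restrict_space lborel D"

abbreviation space_time_measure :: "real set \<Rightarrow> real \<Rightarrow> (real \<times> real) measure" where
  "space_time_measure D T \<equiv> restrict_space lborel D \<Otimes>\<^sub>M restrict_space lborel {0..T}"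

definition normal_filtration :: "'w measure \<Rightarrow> (real \<Rightarrow> 'w measure) \<Rightarrow> bool" where
  "normal_filtration P F \<longleftrightarrow>
     filtration (space P) F \<and> (\<forall>t. subalgebra P (F t)) \<and> null_sets P \<subseteq> sets (F 0) \<and>
     (\<forall>t\<ge>0. sets (F t) = (\<Inter>u\<in>{t<..}. sets (F u)))"

text \<open>
  A $Q$-Wiener process in $L^2(D)$ whose covariance operator is diagonal in the basis \<open>e\<close> with
  eigenvalues \<open>mu\<close>, driven by the independent Brownian motions \<open>B j\<close>.
\<close>

definition Q_wiener_process ::
    "'w measure \<Rightarrow> (real \<Rightarrow> 'w measure) \<Rightarrow> 'a measure \<Rightarrow> (nat \<Rightarrow> 'a \<Rightarrow> real) \<Rightarrow> (nat \<Rightarrow> real) \<Rightarrow>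
     (nat \<Rightarrow> real \<Rightarrow> 'w \<Rightarrow> real) \<Rightarrow> (real \<Rightarrow> 'w \<Rightarrow> 'a \<Rightarrow> real) \<Rightarrow> bool" where
  "Q_wiener_process P F M e mu B W \<longleftrightarrow>
     (\<forall>j. standard_brownian_motion P (B j)) \<and>
     prob_space.indep_vars P (\<lambda>_. \<Pi>\<^sub>M t\<in>{0..}. borel) (\<lambda>j \<omega>. \<lambda>t\<in>{0..}. B j t \<omega>) UNIV \<and>
     (\<forall>t\<ge>0. AE \<omega> in P.
        L2_tendsto M (\<lambda>n x. \<Sum>j<n. sqrt (mu j) * e j x * B j t \<omega>) (W t \<omega>) sequentially) \<and>
     (\<forall>t\<ge>0. strongly_measurable_L2 (restr_to_subalg P (F t)) M (W t)) \<and>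
     (AE \<omega> in P. \<forall>t\<ge>0. L2_tendsto M (\<lambda>r. W r \<omega>) (W t \<omega>) (at t within {0..}))"

text \<open>
  The indices \<open>j\<close> start at 0 rather than at 1. The operator \<open>L\<close> has domain \<open>A\<close>.
\<close>

locale stochastic_setting = prob_space P
  for P :: "'w measure" +
  fixes D :: "real set" and T :: real
    and A :: "(real \<Rightarrow> real) set" and L :: "(real \<Rightarrow> real) \<Rightarrow> (real \<Rightarrow> real)"
    and e :: "nat \<Rightarrow> real \<Rightarrow> real" and lam :: "nat \<Rightarrow> real"
    and Q :: "(real \<Rightarrow> real) \<Rightarrow> (real \<Rightarrow> real)" and mu :: "nat \<Rightarrow> real"
    and F :: "real \<Rightarrow> 'w measure" and B :: "nat \<Rightarrow> real \<Rightarrow> 'w \<Rightarrow> real"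
    and W :: "real \<Rightarrow> 'w \<Rightarrow> real \<Rightarrow> real"
  assumes D: "open D" "bounded D"
    and T: "0 < T"
    and L_linear: "linear_operator_L2 (space_measure D) A L"
    and L_dense: "densely_defined_L2 (space_measure D) A"
    and L_self_adjoint: "self_adjoint_L2 (space_measure D) A L"
    and L_positive: "positive_L2 (space_measure D) A L"
    and L_compact_inverse: "has_compact_inverse_L2 (space_measure D) A L"
    and e_basis: "orthonormal_basis_L2 (space_measure D) e"
    and e_eigenfunction: "\<And>j. e j \<in> A" "\<And>j. AE x in space_measure D. L (e j) x = lam j * e j x"
    and Q_bounded: "bounded_operator_L2 (space_measure D) Q"
    and Q_self_adjoint: "self_adjoint_L2 (space_measure D) (L2 (space_measure D)) Q"
    and Q_positive: "positive_semidefinite_L2 (space_measure D) Q"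
    and Q_diagonal: "\<And>j. AE x in space_measure D. Q (e j) x = mu j * e j x"
    and F_normal: "normal_filtration P F"
    and W_wiener: "Q_wiener_process P F (space_measure D) e mu B W"

text \<open>
  \<open>Yj j t s\<close> is (any version of) the $j$-th coefficient
  $\langle y_0,e_j\rangle e^{-\lambda_j^s t} + \sqrt{\mu_j}\int_0^t e^{-\lambda_j^s(t-\tau)}\,dB_j(\tau)$
  of the solution.
\<close>

definition solution_coefficients ::
    "'w measure \<Rightarrow> real set \<Rightarrow> real \<Rightarrow> (nat \<Rightarrow> real \<Rightarrow> real) \<Rightarrow> (nat \<Rightarrow> real) \<Rightarrow> (nat \<Rightarrow> real) \<Rightarrow>
     (nat \<Rightarrow> real \<Rightarrow> 'w \<Rightarrow> real) \<Rightarrow> (real \<Rightarrow> real) \<Rightarrow> (nat \<Rightarrow> real \<Rightarrow> real \<Rightarrow> 'w \<Rightarrow> real) \<Rightarrow> bool" where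
  "solution_coefficients P D T e lam mu B y0 Yj \<longleftrightarrow>
     (\<forall>j. \<forall>t\<in>{0..T}. \<forall>s>0. \<exists>I.
        has_wiener_integral P (B j) t (\<lambda>\<tau>. exp (- (lam j powr s) * (t - \<tau>))) I \<and>
        Yj j t s = (\<lambda>\<omega>. L2_inner (space_measure D) y0 (e j) * exp (- (lam j powr s) * t)
                       + sqrt (mu j) * I \<omega>))"

text \<open>
  \<open>y s \<omega> (x, t)\<close> is a measurable representative of the $L^2(D)$-valued process
  $t \mapsto \sum_j y_j(t,s)\,e_j$.
\<close>

definition solution_series ::
    "'w measure \<Rightarrow> real set \<Rightarrow> real \<Rightarrow> (nat \<Rightarrow> real \<Rightarrow> real) \<Rightarrow>
     (nat \<Rightarrow> real \<Rightarrow> real \<Rightarrow> 'w \<Rightarrow> real) \<Rightarrow> (real \<Rightarrow> 'w \<Rightarrow> real \<times> real \<Rightarrow> real) \<Rightarrow> bool" where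
  "solution_series P D T e Yj y \<longleftrightarrow>
     (\<forall>s>0. (\<lambda>(\<omega>, z). y s \<omega> z) \<in> borel_measurable (P \<Otimes>\<^sub>M space_time_measure D T) \<and>
        (\<forall>t\<in>{0..T}. AE \<omega> in P.
           L2_tendsto (space_measure D) (\<lambda>n x. \<Sum>j<n. Yj j t s \<omega> * e j x)
             (\<lambda>x. y s \<omega> (x, t)) sequentially))"

text \<open>
  The stochastic integral fixes $y_j(t,s)$ only up to a null set depending on $t$ and $s$, so
  derivatives in $s$ at fixed $\omega$ refer to a modification \<open>Z\<close> of the coefficients
  that is twice differentiable in $s$. Two such modifications are, for each $t$, almost
  surely equal for all $s$ at once, and so are their derivatives.
\<close>

definition coefficient_derivatives ::
    "'w measure \<Rightarrow> real \<Rightarrow> (nat \<Rightarrow> real \<Rightarrow> real \<Rightarrow> 'w \<Rightarrow> real) \<Rightarrow>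
     (nat \<Rightarrow> real \<Rightarrow> real \<Rightarrow> 'w \<Rightarrow> real) \<Rightarrow> (nat \<Rightarrow> real \<Rightarrow> real \<Rightarrow> 'w \<Rightarrow> real) \<Rightarrow> bool" where
  "coefficient_derivatives P T Yj dYj ddYj \<longleftrightarrow>
     (\<exists>Z. \<forall>j. \<forall>t\<in>{0..T}. \<forall>s>0.
        (AE \<omega> in P. Z j t s \<omega> = Yj j t s \<omega>) \<and>
        (\<forall>\<omega>\<in>space P.
           ((\<lambda>r. Z j t r \<omega>) has_real_derivative dYj j t s \<omega>) (at s) \<and>
           ((\<lambda>r. dYj j t r \<omega>) has_real_derivative ddYj j t s \<omega>) (at s)))"

end

theory Submission
  imports Defs "HOL-Computational_Algebra.Polynomial"
begin

text \<open>
  Write $k_s(r) = e^{-\lambda_j^s r}$. Integration by parts turns the stochastic convolution into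
  $k_s(0) B_j(t) + \int_0^t k_s'(t - r) B_j(r)\,dr$, which is smooth in $s$ for every path. Its
  $s$-derivatives are the same expressions for the kernels $\partial_s^n k_s$, and their second
  moments are bounded by $2 \int_0^t |\partial_s^n k_s|^2$ (Fatou's lemma along Riemann sums and the
  isometry for step functions). As $|\partial_s^n k_s(r)|^2 \le M r^{-1/2}$ uniformly in
  $\lambda_j \ge \alpha$ and locally uniformly in $s$, the squared norms of the $j$-th terms are
  dominated by a multiple of $\langle y_0, e_j \rangle^2 + \mu_j T$, so all three series converge; the
  same bound for $\partial_s^{n+2} k_s$ makes the errors of the difference quotients of order
  $h^2$ in squared norm. Throughout, $(a + b)^2 \le 2 a^2 + 2 b^2$ replaces the triangle inequality.
\<close>

section \<open>Square integrals\<close>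

text \<open>The Wiener integral is fixed only up to a null set for each \<open>t\<close> and
  \<open>s\<close>, so as it stands it cannot be differentiated in \<open>s\<close> at a fixed
  outcome. Integration by parts removes this obstacle: for each \<open>j\<close> the only outcomes
  to discard are those whose path is discontinuous or does not start at 0, and they depend on
  neither \<open>t\<close> nor \<open>s\<close>.

  The weight r^(-1/2) answers a second obstacle. At a fixed value of x = lambda^s r where p_n does
  not vanish, the squared n-th derivative is of order (ln lambda)^(2n), so for n >= 1 there is no
  bound uniform in lambda. Multiplication by x^(1/2) is harmless next to the exponential decay and
  gains lambda^(-s/2), which beats every power of the logarithm; the price r^(-1/2) is still
  integrable on [0,T]. Eigenvalues below 1 have negative logarithms, and alpha > 0 keeps these in a
  bounded range.

  Finally, the solution is given slice by slice in time, almost surely, whereas its derivatives are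
  taken in the Bochner space. Both are compared as functions on the product of probability, space
  and time.\<close>

definition sqnorm :: "'a measure \<Rightarrow> ('a \<Rightarrow> real) \<Rightarrow> ennreal" where
  "sqnorm M f = (\<integral>\<^sup>+ x. ennreal ((f x)\<^sup>2) \<partial>M)"

lemma ennreal_sqrt_less_top_iff: "ennreal_sqrt x < \<top> \<longleftrightarrow> x < \<top>"
  by (simp add: ennreal_sqrt_def less_top)

lemma ennreal_sqrt_power2: "(ennreal_sqrt x)\<^sup>2 = x"
  by (cases x) (simp_all add: ennreal_sqrt_def ennreal_power top_power_ennreal)

lemma borel_measurable_ennreal_sqrt [measurable]: "ennreal_sqrt \<in> borel_measurable borel"
  unfolding ennreal_sqrt_def[abs_def] by measurable

lemma L2_norm_eq_sqnorm: "L2_norm M f = ennreal_sqrt (sqnorm M f)"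
  by (simp add: L2_norm_def sqnorm_def)

lemma L2_iff_sqnorm: "f \<in> L2 M \<longleftrightarrow> f \<in> borel_measurable M \<and> sqnorm M f < \<top>"
  by (simp add: L2_def L2_norm_eq_sqnorm ennreal_sqrt_less_top_iff)

lemma ennreal_sqrt_tendsto_0_iff:
  "((\<lambda>i. ennreal_sqrt (f i)) \<longlongrightarrow> 0) G \<longleftrightarrow> (f \<longlongrightarrow> 0) G"
proof
  assume lim: "(f \<longlongrightarrow> 0) G"
  then have ev: "\<forall>\<^sub>F i in G. f i < 1"
    by (rule order_tendstoD) simp
  have "((\<lambda>i. enn2real (f i)) \<longlongrightarrow> 0) G"
    using tendsto_enn2real[of f 0 G] lim by simp
  then have "((\<lambda>i. sqrt (enn2real (f i))) \<longlongrightarrow> sqrt 0) G"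
    by (rule tendsto_real_sqrt)
  then have "((\<lambda>i. ennreal (sqrt (enn2real (f i)))) \<longlongrightarrow> ennreal (sqrt 0)) G"
    by (rule tendsto_ennrealI)
  moreover have "\<forall>\<^sub>F i in G. ennreal (sqrt (enn2real (f i))) = ennreal_sqrt (f i)"
    using ev by eventually_elim (auto simp: ennreal_sqrt_def)
  ultimately show "((\<lambda>i. ennreal_sqrt (f i)) \<longlongrightarrow> 0) G"
    by (simp add: tendsto_cong)
next
  assume lim: "((\<lambda>i. ennreal_sqrt (f i)) \<longlongrightarrow> 0) G"
  then have ev: "\<forall>\<^sub>F i in G. ennreal_sqrt (f i) < 1"
    by (rule order_tendstoD) simp
  show "(f \<longlongrightarrow> 0) G"
  proof (rule tendsto_sandwich[OF _ _ tendsto_const lim])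
    show "\<forall>\<^sub>F i in G. f i \<le> ennreal_sqrt (f i)"
      using ev
    proof eventually_elim
      case (elim i)
      have "(ennreal_sqrt (f i))\<^sup>2 \<le> ennreal_sqrt (f i) * 1"
        unfolding power2_eq_square using elim by (intro mult_left_mono) auto
      then show ?case
        by (simp add: ennreal_sqrt_power2)
    qed
  qed simp
qed

lemma L2_tendsto_iff_sqnorm:
  "L2_tendsto M f g G \<longleftrightarrow>
    (\<forall>\<^sub>F i in G. f i \<in> L2 M) \<and> g \<in> L2 M \<and> ((\<lambda>i. sqnorm M (\<lambda>x. f i x - g x)) \<longlongrightarrow> 0) G"
  by (simp add: L2_tendsto_def L2_norm_eq_sqnorm ennreal_sqrt_tendsto_0_iff)

lemma ennreal_power2_add_le:
  "ennreal ((a + b)\<^sup>2) \<le> 2 * ennreal (a\<^sup>2) + 2 * ennreal (b\<^sup>2)"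
proof -
  have "(a + b)\<^sup>2 \<le> 2 * a\<^sup>2 + 2 * b\<^sup>2"
    using zero_le_power2[of "a - b"] by (simp add: power2_eq_square algebra_simps)
  then have "ennreal ((a + b)\<^sup>2) \<le> ennreal (2 * a\<^sup>2 + 2 * b\<^sup>2)"
    by (rule ennreal_leI)
  also have "\<dots> = 2 * ennreal (a\<^sup>2) + 2 * ennreal (b\<^sup>2)"
    by (simp add: ennreal_mult)
  finally show ?thesis .
qed

lemma sqnorm_cong: "(\<And>x. x \<in> space M \<Longrightarrow> f x = g x) \<Longrightarrow> sqnorm M f = sqnorm M g"
  by (simp add: sqnorm_def cong: nn_integral_cong)

lemma sqnorm_add_le:
  assumes [measurable]: "f \<in> borel_measurable M" "g \<in> borel_measurable M"
  shows "sqnorm M (\<lambda>x. f x + g x) \<le> 2 * sqnorm M f + 2 * sqnorm M g"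
proof -
  have "sqnorm M (\<lambda>x. f x + g x) \<le> (\<integral>\<^sup>+ x. 2 * ennreal ((f x)\<^sup>2) + 2 * ennreal ((g x)\<^sup>2) \<partial>M)"
    unfolding sqnorm_def by (intro nn_integral_mono ennreal_power2_add_le)
  also have "\<dots> = 2 * sqnorm M f + 2 * sqnorm M g"
    unfolding sqnorm_def by (simp add: nn_integral_add nn_integral_cmult)
  finally show ?thesis .
qed

lemma sqnorm_cmult:
  assumes [measurable]: "f \<in> borel_measurable M"
  shows "sqnorm M (\<lambda>x. c * f x) = ennreal (c\<^sup>2) * sqnorm M f"
  unfolding sqnorm_def by (simp add: power_mult_distrib ennreal_mult nn_integral_cmult)

lemma sqnorm_minus_commute: "sqnorm M (\<lambda>x. f x - g x) = sqnorm M (\<lambda>x. g x - f x)"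
  by (simp add: sqnorm_def power2_commute)

lemma sqnorm_diff_triangle_le:
  assumes "f \<in> borel_measurable M" "g \<in> borel_measurable M" "h \<in> borel_measurable M"
  shows "sqnorm M (\<lambda>x. f x - h x) \<le> 2 * sqnorm M (\<lambda>x. f x - g x) + 2 * sqnorm M (\<lambda>x. g x - h x)"
  using sqnorm_add_le[of "\<lambda>x. f x - g x" M "\<lambda>x. g x - h x"] assms by simp

lemma sqnorm_le_diff:
  assumes "f \<in> borel_measurable M" "g \<in> borel_measurable M"
  shows "sqnorm M f \<le> 2 * sqnorm M (\<lambda>x. f x - g x) + 2 * sqnorm M g"
  using sqnorm_add_le[of "\<lambda>x. f x - g x" M "g"] assms by simp

lemma two_mult_less_top: "(x::ennreal) < \<top> \<Longrightarrow> 2 * x < \<top>"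
  by (simp add: ennreal_mult_less_top)

lemma L2_add: "f \<in> L2 M \<Longrightarrow> g \<in> L2 M \<Longrightarrow> (\<lambda>x. f x + g x) \<in> L2 M"
  using sqnorm_add_le[of f M g]
  by (auto simp: L2_iff_sqnorm intro: le_less_trans intro!: two_mult_less_top)

lemma L2_cmult: "f \<in> L2 M \<Longrightarrow> (\<lambda>x. c * f x) \<in> L2 M"
  by (auto simp: L2_iff_sqnorm sqnorm_cmult ennreal_mult_less_top)

lemma L2_zero: "(\<lambda>x. 0) \<in> L2 M"
  by (simp add: L2_iff_sqnorm sqnorm_def)

lemma L2_diff: "f \<in> L2 M \<Longrightarrow> g \<in> L2 M \<Longrightarrow> (\<lambda>x. f x - g x) \<in> L2 M"
  using L2_add[of f M "\<lambda>x. -1 * g x"] L2_cmult[of g M "-1"] by simp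

lemma L2_sum: "(\<And>i. i \<in> I \<Longrightarrow> f i \<in> L2 M) \<Longrightarrow> (\<lambda>x. \<Sum>i\<in>I. f i x) \<in> L2 M"
  by (induction I rule: infinite_finite_induct) (auto intro: L2_zero L2_add)

lemma L2_integrable_power2: "f \<in> L2 M \<Longrightarrow> integrable M (\<lambda>x. (f x)\<^sup>2)"
  unfolding L2_iff_sqnorm sqnorm_def by (intro integrableI_nonneg) auto

lemma L2_integrable_mult:
  assumes "f \<in> L2 M" "g \<in> L2 M"
  shows "integrable M (\<lambda>x. f x * g x)"
proof (rule Bochner_Integration.integrable_bound)
  show "integrable M (\<lambda>x. (f x)\<^sup>2 + (g x)\<^sup>2)"
    using assms by (intro Bochner_Integration.integrable_add L2_integrable_power2)
  show "(\<lambda>x. f x * g x) \<in> borel_measurable M"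
    using assms by (auto simp: L2_iff_sqnorm)
  have "\<bar>a * b\<bar> \<le> \<bar>a\<^sup>2 + b\<^sup>2\<bar>" for a b :: real
  proof -
    have "\<bar>a * b\<bar> \<le> (\<bar>a\<bar>\<^sup>2 + \<bar>b\<bar>\<^sup>2) / 2"
      unfolding abs_mult using sum_squares_bound[of "\<bar>a\<bar>" "\<bar>b\<bar>"] by simp
    then show ?thesis
      by simp
  qed
  then show "AE x in M. norm (f x * g x) \<le> norm ((f x)\<^sup>2 + (g x)\<^sup>2)"
    by simp
qed

lemma sqnorm_eq_integral: "f \<in> L2 M \<Longrightarrow> sqnorm M f = ennreal (\<integral>x. (f x)\<^sup>2 \<partial>M)"
  unfolding sqnorm_def by (intro nn_integral_eq_integral L2_integrable_power2) auto

section \<open>Fatou bounds, completeness and dominated convergence for square integrals\<close>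

lemma nn_integral_LIMSEQ_le:
  fixes u :: "nat \<Rightarrow> 'a \<Rightarrow> ennreal"
  assumes [measurable]: "\<And>i. u i \<in> borel_measurable M"
    and lim: "AE x in M. (\<lambda>i. u i x) \<longlonglongrightarrow> v x"
    and bound: "\<forall>\<^sub>F i in sequentially. (\<integral>\<^sup>+ x. u i x \<partial>M) \<le> c"
  shows "(\<integral>\<^sup>+ x. v x \<partial>M) \<le> c"
proof -
  have "(\<integral>\<^sup>+ x. v x \<partial>M) = (\<integral>\<^sup>+ x. liminf (\<lambda>i. u i x) \<partial>M)"
    using lim by (intro nn_integral_cong_AE) (auto simp: lim_imp_Liminf)
  also have "\<dots> \<le> liminf (\<lambda>i. \<integral>\<^sup>+ x. u i x \<partial>M)"
    by (rule nn_integral_liminf) simp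
  also have "\<dots> \<le> limsup (\<lambda>i. \<integral>\<^sup>+ x. u i x \<partial>M)"
    by (rule Liminf_le_Limsup) simp
  also have "\<dots> \<le> c"
    using bound by (rule Limsup_bounded)
  finally show ?thesis .
qed

lemma sqnorm_LIMSEQ_le:
  assumes [measurable]: "\<And>i. u i \<in> borel_measurable M"
    and lim: "AE x in M. (\<lambda>i. u i x) \<longlonglongrightarrow> v x"
    and bound: "\<forall>\<^sub>F i in sequentially. sqnorm M (u i) \<le> c"
  shows "sqnorm M v \<le> c"
  unfolding sqnorm_def
proof (rule nn_integral_LIMSEQ_le)
  show "AE x in M. (\<lambda>i. ennreal ((u i x)\<^sup>2)) \<longlonglongrightarrow> ennreal ((v x)\<^sup>2)"
    using lim by eventually_elim (intro tendsto_intros)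
  show "\<forall>\<^sub>F i in sequentially. (\<integral>\<^sup>+ x. ennreal ((u i x)\<^sup>2) \<partial>M) \<le> c"
    using bound by (simp add: sqnorm_def)
qed simp

lemma suminf_geometric_ennreal_less_top:
  assumes "0 \<le> q" "q < (1::real)"
  shows "(\<Sum>k. ennreal (q ^ k)) < \<top>"
  using assms summable_geometric[of q] by (simp add: suminf_ennreal_eq[OF _ summable_sums])

lemma tendsto_0_ennrealI:
  fixes f :: "'i \<Rightarrow> ennreal"
  assumes "\<And>\<epsilon>::real. 0 < \<epsilon> \<Longrightarrow> \<forall>\<^sub>F i in G. f i \<le> ennreal \<epsilon>"
  shows "(f \<longlongrightarrow> 0) G"
proof (rule order_tendstoI)
  fix a :: ennreal assume "0 < a"
  then obtain \<epsilon> where \<epsilon>: "0 < \<epsilon>" "ennreal \<epsilon> < a"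
    using dense[of 0 a] by (metis ennreal_cases ennreal_less_zero_iff infinity_ennreal_def not_less_iff_gr_or_eq top.not_eq_extremum order.strict_trans)
  show "\<forall>\<^sub>F i in G. f i < a"
    using assms[OF \<epsilon>(1)] by eventually_elim (use \<epsilon>(2) in auto)
qed simp

text \<open>The Riesz-Fischer argument with squared distances: along a subsequence whose consecutive
  squared distances are at most 4^(-k), the series of 2^k * (d k)^2 has a finite integral. At almost
  every point it is bounded by some \<open>C\<close>, so |d k| <= sqrt C * 2^(-k/2) and the
  increments are summable.\<close>

lemma sqnorm_complete:
  fixes u :: "nat \<Rightarrow> 'a \<Rightarrow> real"
  assumes [measurable]: "\<And>n. u n \<in> borel_measurable M"
    and cauchy: "\<And>\<epsilon>::real. 0 < \<epsilon> \<Longrightarrow>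
      \<exists>n0. \<forall>m\<ge>n0. \<forall>n\<ge>n0. sqnorm M (\<lambda>x. u m x - u n x) \<le> ennreal \<epsilon>"
  obtains g where "g \<in> borel_measurable M" "(\<lambda>n. sqnorm M (\<lambda>x. u n x - g x)) \<longlonglongrightarrow> 0"
proof -
  have "\<exists>n0. \<forall>m\<ge>n0. \<forall>n\<ge>n0. sqnorm M (\<lambda>x. u m x - u n x) \<le> ennreal ((1/4) ^ k)" for k
    by (rule cauchy) simp
  then obtain K where K:
    "sqnorm M (\<lambda>x. u m x - u n x) \<le> ennreal ((1/4) ^ k)" if "m \<ge> K k" "n \<ge> K k" for k m n
    by metis
  \<comment> \<open>Summing the thresholds makes \<open>r k\<close> and \<open>r (Suc k)\<close>
    both exceed \<open>K k\<close>; the summand \<open>k\<close> forces \<open>r\<close> to tend to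
    infinity.\<close>
  define r where "r k = k + (\<Sum>i\<le>k. K i)" for k
  have r_ge: "r k \<ge> K k" "r k \<ge> k" "r (Suc k) \<ge> K k" for k
  proof -
    have "K k \<le> (\<Sum>i\<le>k. K i)"
      by (rule member_le_sum) auto
    then show "r k \<ge> K k" "r k \<ge> k" "r (Suc k) \<ge> K k"
      by (auto simp: r_def)
  qed
  define d where "d k x = u (r (Suc k)) x - u (r k) x" for k x
  have [measurable]: "d k \<in> borel_measurable M" for k
    unfolding d_def[abs_def] by measurable
  have "(\<integral>\<^sup>+ x. (\<Sum>k. ennreal (2 ^ k) * ennreal ((d k x)\<^sup>2)) \<partial>M) = (\<Sum>k. ennreal (2 ^ k) * sqnorm M (d k))"
    by (simp add: nn_integral_suminf nn_integral_cmult sqnorm_def)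
  also have "\<dots> \<le> (\<Sum>k. ennreal ((1/2) ^ k))"
  proof (intro suminf_le summableI)
    fix k
    have "ennreal (2 ^ k) * sqnorm M (d k) \<le> ennreal (2 ^ k) * ennreal ((1/4) ^ k)"
      unfolding d_def by (intro mult_left_mono K r_ge) simp
    also have "\<dots> = ennreal ((1/2) ^ k)"
      by (simp add: ennreal_mult[symmetric] power_mult_distrib[symmetric])
    finally show "ennreal (2 ^ k) * sqnorm M (d k) \<le> ennreal ((1/2) ^ k)" .
  qed
  also have "\<dots> < \<top>"
    by (rule suminf_geometric_ennreal_less_top) auto
  finally have fin: "(\<integral>\<^sup>+ x. (\<Sum>k. ennreal (2 ^ k) * ennreal ((d k x)\<^sup>2)) \<partial>M) \<noteq> \<infinity>"
    by simp
  have "AE x in M. (\<Sum>k. ennreal (2 ^ k) * ennreal ((d k x)\<^sup>2)) \<noteq> \<infinity>"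
    by (rule nn_integral_noteq_infinite[OF _ fin]) measurable
  then have conv: "AE x in M. convergent (\<lambda>k. u (r k) x)"
  proof eventually_elim
    case (elim x)
    define C where "C = enn2real (\<Sum>k. ennreal (2 ^ k) * ennreal ((d k x)\<^sup>2))"
    have bound: "\<bar>d k x\<bar> \<le> sqrt C * sqrt (1/2) ^ k" for k
    proof -
      have "ennreal (2 ^ k * (d k x)\<^sup>2) \<le> (\<Sum>k. ennreal (2 ^ k) * ennreal ((d k x)\<^sup>2))"
        using sum_le_suminf[of "\<lambda>k. ennreal (2 ^ k) * ennreal ((d k x)\<^sup>2)" "{k}"]
        by (simp add: ennreal_mult summableI)
      also have "\<dots> = ennreal C"
        using elim by (simp add: C_def less_top)
      finally have "2 ^ k * (d k x)\<^sup>2 \<le> C"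
        by (simp add: C_def)
      then have "(d k x)\<^sup>2 \<le> C * (1/2) ^ k"
        by (simp add: field_simps power_divide)
      then have "sqrt ((d k x)\<^sup>2) \<le> sqrt (C * (1/2) ^ k)"
        by (rule real_sqrt_le_mono)
      also have "sqrt (C * (1/2) ^ k) = sqrt C * sqrt (1/2) ^ k"
        by (simp only: real_sqrt_mult real_sqrt_power)
      finally show ?thesis
        by (simp only: real_sqrt_abs)
    qed
    have "sqrt (1/2) < sqrt 1"
      by (rule real_sqrt_less_mono) simp
    then have "summable (\<lambda>k. sqrt C * sqrt (1/2) ^ k)"
      by (intro summable_mult summable_geometric) simp
    then have "summable (\<lambda>k. d k x)"
      by (rule summable_comparison_test[rotated]) (use bound in auto)
    then have "convergent (\<lambda>n. u (r 0) x + (\<Sum>k<n. d k x))"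
      by (intro convergent_add convergent_const) (simp add: summable_iff_convergent)
    moreover have "u (r 0) x + (\<Sum>k<n. d k x) = u (r n) x" for n
      by (induction n) (simp_all add: d_def)
    ultimately show ?case
      by simp
  qed
  \<comment> \<open>Where the subsequence diverges, \<open>lim\<close> has an unspecified value;
    this happens only on a null set.\<close>
  define g where "g x = lim (\<lambda>k. u (r k) x)" for x
  have g_meas [measurable]: "g \<in> borel_measurable M"
    unfolding g_def[abs_def] by measurable
  have lim: "AE x in M. (\<lambda>k. u (r k) x) \<longlonglongrightarrow> g x"
    using conv by eventually_elim (simp add: g_def convergent_LIMSEQ_iff)
  have "(\<lambda>n. sqnorm M (\<lambda>x. u n x - g x)) \<longlonglongrightarrow> 0"
  proof (rule tendsto_0_ennrealI)
    fix \<epsilon> :: real assume "0 < \<epsilon>"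
    then obtain n0 where n0: "\<forall>m\<ge>n0. \<forall>n\<ge>n0. sqnorm M (\<lambda>x. u m x - u n x) \<le> ennreal \<epsilon>"
      using cauchy by blast
    show "\<forall>\<^sub>F n in sequentially. sqnorm M (\<lambda>x. u n x - g x) \<le> ennreal \<epsilon>"
      using eventually_ge_at_top[of n0]
    proof eventually_elim
      case (elim n)
      \<comment> \<open>Fatou in the index of the subsequence, with \<open>n\<close> fixed, carries
        the Cauchy bound over to the limit.\<close>
      show ?case
      proof (rule sqnorm_LIMSEQ_le)
        show "AE x in M. (\<lambda>k. u n x - u (r k) x) \<longlonglongrightarrow> u n x - g x"
          using lim by eventually_elim (intro tendsto_intros)
        show "\<forall>\<^sub>F k in sequentially. sqnorm M (\<lambda>x. u n x - u (r k) x) \<le> ennreal \<epsilon>"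
          using eventually_ge_at_top[of n0]
          by eventually_elim (use n0 elim r_ge in \<open>meson order.trans\<close>)
      qed simp
    qed
  qed
  with g_meas that show thesis by blast
qed

lemma sqnorm_dominated_convergence:
  assumes [measurable]: "\<And>n. u n \<in> borel_measurable M" "f \<in> borel_measurable M"
    and "w \<in> L2 M"
    and bound: "\<And>n. AE x in M. \<bar>u n x - f x\<bar> \<le> w x"
    and lim: "AE x in M. (\<lambda>n. u n x) \<longlonglongrightarrow> f x"
  shows "(\<lambda>n. sqnorm M (\<lambda>x. u n x - f x)) \<longlonglongrightarrow> 0"
proof -
  have [measurable]: "w \<in> borel_measurable M" and fin: "sqnorm M w < \<top>"
    using \<open>w \<in> L2 M\<close> by (auto simp: L2_iff_sqnorm)
  have "(\<lambda>n. \<integral>\<^sup>+ x. ennreal ((u n x - f x)\<^sup>2) \<partial>M) \<longlonglongrightarrow> (\<integral>\<^sup>+ x. 0 \<partial>M)"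
  proof (rule nn_integral_dominated_convergence)
    show "(\<integral>\<^sup>+ x. ennreal ((w x)\<^sup>2) \<partial>M) < \<infinity>"
      using fin by (simp add: sqnorm_def)
    show "AE x in M. ennreal ((u n x - f x)\<^sup>2) \<le> ennreal ((w x)\<^sup>2)" for n
      using bound[of n]
    proof eventually_elim
      case (elim x)
      then have "\<bar>u n x - f x\<bar>\<^sup>2 \<le> (w x)\<^sup>2"
        by (intro power_mono) auto
      then show ?case
        by (simp add: ennreal_leI)
    qed
    show "AE x in M. (\<lambda>n. ennreal ((u n x - f x)\<^sup>2)) \<longlonglongrightarrow> 0"
      using lim
    proof eventually_elim
      case (elim x)
      then have "(\<lambda>n. ennreal ((u n x - f x)\<^sup>2)) \<longlonglongrightarrow> ennreal ((f x - f x)\<^sup>2)"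
        by (intro tendsto_intros)
      then show ?case
        by simp
    qed
  qed simp_all
  then show ?thesis
    by (simp add: sqnorm_def)
qed

section \<open>Strong measurability of jointly measurable functions\<close>

text \<open>A value of \<open>S\<close> is a whole function on the second factor. Joint
  measurability is recorded so that \<open>S\<close> can be compared with functions on the product
  measure.\<close>

definition simple_L2 :: "'w measure \<Rightarrow> 'a measure \<Rightarrow> ('w \<Rightarrow> 'a \<Rightarrow> real) \<Rightarrow> bool" where
  "simple_L2 P M S \<longleftrightarrow> simple_function P S \<and> (\<forall>\<omega>\<in>space P. S \<omega> \<in> L2 M) \<and>
     (\<lambda>z. S (fst z) (snd z)) \<in> borel_measurable (P \<Otimes>\<^sub>M M)"

text \<open>Approximation in the norm of the product is stable under sums and limits, hence open to
  a monotone class argument. The convergence at almost every outcome that strong measurability asks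
  for is recovered in \<open>bochner_L2I\<close>.\<close>

definition simple_approximable :: "'w measure \<Rightarrow> 'a measure \<Rightarrow> ('w \<times> 'a \<Rightarrow> real) \<Rightarrow> bool" where
  "simple_approximable P M f \<longleftrightarrow> f \<in> borel_measurable (P \<Otimes>\<^sub>M M) \<and>
     (\<forall>\<epsilon>>0::real. \<exists>S. simple_L2 P M S \<and>
        sqnorm (P \<Otimes>\<^sub>M M) (\<lambda>z. f z - S (fst z) (snd z)) \<le> ennreal \<epsilon>)"

lemma simple_approximable_limit:
  assumes [measurable]: "f \<in> borel_measurable (P \<Otimes>\<^sub>M M)"
    and approx: "\<And>n. simple_approximable P M (g n)"
    and lim: "(\<lambda>n. sqnorm (P \<Otimes>\<^sub>M M) (\<lambda>z. g n z - f z)) \<longlonglongrightarrow> 0"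
  shows "simple_approximable P M f"
  unfolding simple_approximable_def
proof (intro conjI allI impI)
  fix \<epsilon> :: real assume "0 < \<epsilon>"
  \<comment> \<open>Two errors of size epsilon / 4 add up to epsilon, because the substitute for the
    triangle inequality doubles both.\<close>
  have "\<forall>\<^sub>F n in sequentially. sqnorm (P \<Otimes>\<^sub>M M) (\<lambda>z. g n z - f z) < ennreal (\<epsilon> / 4)"
    using lim by (rule order_tendstoD) (use \<open>0 < \<epsilon>\<close> in simp)
  then obtain n where n: "sqnorm (P \<Otimes>\<^sub>M M) (\<lambda>z. g n z - f z) < ennreal (\<epsilon> / 4)"
    by (auto simp: eventually_sequentially)
  from approx[of n] \<open>0 < \<epsilon>\<close> obtain S where S: "simple_L2 P M S"
    "sqnorm (P \<Otimes>\<^sub>M M) (\<lambda>z. g n z - S (fst z) (snd z)) \<le> ennreal (\<epsilon> / 4)"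
    unfolding simple_approximable_def by (meson divide_pos_pos zero_less_numeral)
  have "sqnorm (P \<Otimes>\<^sub>M M) (\<lambda>z. f z - S (fst z) (snd z)) \<le> 2 * sqnorm (P \<Otimes>\<^sub>M M) (\<lambda>z. f z - g n z) +
      2 * sqnorm (P \<Otimes>\<^sub>M M) (\<lambda>z. g n z - S (fst z) (snd z))"
    using approx[of n] S(1)
    by (intro sqnorm_diff_triangle_le) (auto simp: simple_approximable_def simple_L2_def)
  also have "\<dots> \<le> 2 * ennreal (\<epsilon> / 4) + 2 * ennreal (\<epsilon> / 4)"
    using n S(2) by (intro add_mono mult_left_mono) (auto simp: sqnorm_minus_commute[of _ f])
  also have "\<dots> = ennreal \<epsilon>"
    using \<open>0 < \<epsilon>\<close> by (simp add: mult_2 ennreal_plus[symmetric] del: ennreal_plus)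
  finally show "\<exists>S. simple_L2 P M S \<and> sqnorm (P \<Otimes>\<^sub>M M) (\<lambda>z. f z - S (fst z) (snd z)) \<le> ennreal \<epsilon>"
    using S(1) by blast
qed simp

lemma simple_L2_simple_approximable:
  assumes "simple_L2 P M S"
  shows "simple_approximable P M (\<lambda>z. S (fst z) (snd z))"
  unfolding simple_approximable_def
  using assms by (auto simp: simple_L2_def sqnorm_def intro!: exI[of _ S])

lemma simple_approximable_add:
  assumes f: "simple_approximable P M f" and g: "simple_approximable P M g"
  shows "simple_approximable P M (\<lambda>z. f z + g z)"
  unfolding simple_approximable_def
proof (intro conjI allI impI)
  fix \<epsilon> :: real assume "0 < \<epsilon>"
  then have pos: "0 < \<epsilon> / 4"
    by simp
  obtain S where S: "simple_L2 P M S" "sqnorm (P \<Otimes>\<^sub>M M) (\<lambda>z. f z - S (fst z) (snd z)) \<le> ennreal (\<epsilon> / 4)"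
    using f pos unfolding simple_approximable_def by blast
  obtain R where R: "simple_L2 P M R" "sqnorm (P \<Otimes>\<^sub>M M) (\<lambda>z. g z - R (fst z) (snd z)) \<le> ennreal (\<epsilon> / 4)"
    using g pos unfolding simple_approximable_def by blast
  have "sqnorm (P \<Otimes>\<^sub>M M) (\<lambda>z. (f z - S (fst z) (snd z)) + (g z - R (fst z) (snd z)))
      \<le> 2 * sqnorm (P \<Otimes>\<^sub>M M) (\<lambda>z. f z - S (fst z) (snd z)) + 2 * sqnorm (P \<Otimes>\<^sub>M M) (\<lambda>z. g z - R (fst z) (snd z))"
    using f g S(1) R(1)
    by (intro sqnorm_add_le borel_measurable_diff) (auto simp: simple_approximable_def simple_L2_def)
  also have "\<dots> \<le> 2 * ennreal (\<epsilon> / 4) + 2 * ennreal (\<epsilon> / 4)"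
    by (intro add_mono mult_left_mono S R) auto
  also have "\<dots> = ennreal \<epsilon>"
    using \<open>0 < \<epsilon>\<close> by (simp add: mult_2 ennreal_plus[symmetric] del: ennreal_plus)
  finally have "sqnorm (P \<Otimes>\<^sub>M M) (\<lambda>z. f z + g z - (\<lambda>\<omega> x. S \<omega> x + R \<omega> x) (fst z) (snd z)) \<le> ennreal \<epsilon>"
    by (simp add: algebra_simps)
  moreover have "simple_L2 P M (\<lambda>\<omega> x. S \<omega> x + R \<omega> x)"
    using S(1) R(1) by (auto simp: simple_L2_def intro: L2_add simple_function_compose2[where h = "\<lambda>f g x. f x + g x"])
  ultimately show "\<exists>S. simple_L2 P M S \<and> sqnorm (P \<Otimes>\<^sub>M M) (\<lambda>z. f z + g z - S (fst z) (snd z)) \<le> ennreal \<epsilon>"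
    by blast
qed (use f g in \<open>auto simp: simple_approximable_def\<close>)

lemma simple_approximable_cmult:
  assumes f: "simple_approximable P M f"
  shows "simple_approximable P M (\<lambda>z. c * f z)"
  unfolding simple_approximable_def
proof (intro conjI allI impI)
  fix \<epsilon> :: real assume "0 < \<epsilon>"
  \<comment> \<open>The added 1 keeps the denominator positive when \<open>c\<close> is 0.\<close>
  then have pos: "0 < \<epsilon> / (c\<^sup>2 + 1)"
    by (simp add: add_nonneg_pos)
  then obtain S where S: "simple_L2 P M S"
      "sqnorm (P \<Otimes>\<^sub>M M) (\<lambda>z. f z - S (fst z) (snd z)) \<le> ennreal (\<epsilon> / (c\<^sup>2 + 1))"
    using f unfolding simple_approximable_def by blast
  have "sqnorm (P \<Otimes>\<^sub>M M) (\<lambda>z. c * (f z - S (fst z) (snd z)))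
      = ennreal (c\<^sup>2) * sqnorm (P \<Otimes>\<^sub>M M) (\<lambda>z. f z - S (fst z) (snd z))"
    using f S(1) by (intro sqnorm_cmult borel_measurable_diff) (auto simp: simple_approximable_def simple_L2_def)
  also have "\<dots> \<le> ennreal (c\<^sup>2) * ennreal (\<epsilon> / (c\<^sup>2 + 1))"
    by (intro mult_left_mono S) auto
  also have "\<dots> = ennreal (c\<^sup>2 * (\<epsilon> / (c\<^sup>2 + 1)))"
    using pos by (intro ennreal_mult[symmetric]) auto
  also have "\<dots> \<le> ennreal \<epsilon>"
    using \<open>0 < \<epsilon>\<close> by (intro ennreal_leI) (simp add: pos_divide_le_eq add_nonneg_pos distrib_left)
  finally have "sqnorm (P \<Otimes>\<^sub>M M) (\<lambda>z. c * f z - (\<lambda>\<omega> x. c * S \<omega> x) (fst z) (snd z)) \<le> ennreal \<epsilon>"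
    by (simp add: algebra_simps)
  moreover have "simple_L2 P M (\<lambda>\<omega> x. c * S \<omega> x)"
    using S(1) by (auto simp: simple_L2_def intro: L2_cmult simple_function_compose1[where g = "\<lambda>h x. c * h x"])
  ultimately show "\<exists>S. simple_L2 P M S \<and> sqnorm (P \<Otimes>\<^sub>M M) (\<lambda>z. c * f z - S (fst z) (snd z)) \<le> ennreal \<epsilon>"
    by blast
qed (use f in \<open>auto simp: simple_approximable_def\<close>)

lemma simple_approximable_zero: "simple_approximable P M (\<lambda>z. 0)"
  using simple_L2_simple_approximable[of P M "\<lambda>\<omega> x. 0"]
  by (simp add: simple_L2_def L2_zero)

lemma simple_approximable_sum:
  "(\<And>i. i \<in> I \<Longrightarrow> simple_approximable P M (f i)) \<Longrightarrow> simple_approximable P M (\<lambda>z. \<Sum>i\<in>I. f i z)"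
proof (induction I rule: infinite_finite_induct)
  case (insert i I)
  then have "simple_approximable P M (\<lambda>z. f i z + (\<Sum>i\<in>I. f i z))"
    by (intro simple_approximable_add) simp_all
  then show ?case
    using insert by simp
qed (simp_all add: simple_approximable_zero)

lemma simple_approximable_cong:
  assumes "simple_approximable P M f" "\<And>z. z \<in> space (P \<Otimes>\<^sub>M M) \<Longrightarrow> f z = g z"
  shows "simple_approximable P M g"
proof -
  have "sqnorm (P \<Otimes>\<^sub>M M) (\<lambda>z. g z - S (fst z) (snd z)) = sqnorm (P \<Otimes>\<^sub>M M) (\<lambda>z. f z - S (fst z) (snd z))" for S
    by (rule sqnorm_cong) (simp add: assms(2))
  then show ?thesis
    using assms(1) measurable_cong[of "P \<Otimes>\<^sub>M M" f g borel] assms(2)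
    by (simp add: simple_approximable_def)
qed

text \<open>A Dynkin system argument: the indicator of a rectangle is itself simple, complements are
  handled by linearity, and countable disjoint unions by dominated convergence. Both measures being
  finite, the constant 1 is a square-integrable majorant.\<close>

lemma simple_approximable_indicator:
  fixes P :: "'w measure" and M :: "'a measure"
  assumes "finite_measure P" "finite_measure M" and C: "C \<in> sets (P \<Otimes>\<^sub>M M)"
  shows "simple_approximable P M (indicator C)"
proof -
  interpret P: finite_measure P by fact
  interpret M: finite_measure M by fact
  interpret PM: pair_sigma_finite P M ..
  have finPM: "finite_measure (P \<Otimes>\<^sub>M M)"
    by (rule finite_measure_pair_measure) fact+
  have const_L2: "(\<lambda>z. 1) \<in> L2 (P \<Otimes>\<^sub>M M)"
    using finite_measure.emeasure_finite[OF finPM]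
    by (simp add: L2_iff_sqnorm sqnorm_def less_top)
  have rect: "simple_approximable P M (indicator (a \<times> b))" if [measurable]: "a \<in> sets P" "b \<in> sets M" for a b
  proof -
    define S :: "'w \<Rightarrow> 'a \<Rightarrow> real" where "S \<omega> x = indicator a \<omega> * indicator b x" for \<omega> x
    have "S \<omega> \<in> L2 M" for \<omega>
    proof -
      have "sqnorm M (indicator b) = (\<integral>\<^sup>+ x. indicator b x \<partial>M)"
        unfolding sqnorm_def by (rule nn_integral_cong) (simp add: indicator_def)
      then have "(indicator b :: 'a \<Rightarrow> real) \<in> L2 M"
        by (simp add: L2_iff_sqnorm less_top[symmetric])
      then show ?thesis
        unfolding S_def[abs_def] by (rule L2_cmult)
    qed
    moreover have "simple_function P S"
      unfolding S_def[abs_def]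
      by (rule simple_function_compose1[where g = "\<lambda>c x. c * indicator b x" and f = "indicator a"]) simp
    moreover have "(\<lambda>z. S (fst z) (snd z)) \<in> borel_measurable (P \<Otimes>\<^sub>M M)"
      unfolding S_def by measurable
    ultimately have "simple_approximable P M (\<lambda>z. S (fst z) (snd z))"
      by (intro simple_L2_simple_approximable) (simp add: simple_L2_def)
    also have "(\<lambda>z. S (fst z) (snd z)) = indicator (a \<times> b)"
      by (auto simp: S_def indicator_def)
    finally show ?thesis .
  qed
  have "C \<in> sigma_sets (space P \<times> space M) {a \<times> b | a b. a \<in> sets P \<and> b \<in> sets M}"
    using C by (simp add: sets_pair_measure)
  from Int_stable_pair_measure_generator pair_measure_closed this show ?thesis
  proof (induction rule: sigma_sets_induct_disjoint)
    case (basic C)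
    then show ?case
      using rect by auto
  next
    case empty
    then show ?case
      using simple_approximable_zero by simp
  next
    case (compl C)
    have "simple_approximable P M (\<lambda>z. indicator (space P \<times> space M) z + (-1) * indicator C z)"
      by (intro simple_approximable_add simple_approximable_cmult rect compl) auto
    moreover have "C \<subseteq> space P \<times> space M"
      using compl(1) by (rule sigma_sets_into_sp[rotated]) (rule pair_measure_closed)
    ultimately show ?case
      by (elim simple_approximable_cong) (auto simp: indicator_def)
  next
    case (union C)
    have sets_C [measurable]: "C i \<in> sets (P \<Otimes>\<^sub>M M)" for i
      using union(2) by (auto simp: sets_pair_measure)
    define u where "u n z = (\<Sum>i<n. indicator (C i) z :: real)" for n z
    have sums: "(\<lambda>i. indicator (C i) z :: real) sums indicator (\<Union>i. C i) z" for z
      using union(1) by (intro indicator_sums) (auto simp: disjoint_family_on_def)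
    have "simple_approximable P M (u n)" for n
      unfolding u_def[abs_def] by (intro simple_approximable_sum union)
    moreover have "(\<lambda>n. sqnorm (P \<Otimes>\<^sub>M M) (\<lambda>z. u n z - indicator (\<Union>i. C i) z)) \<longlonglongrightarrow> 0"
    proof (rule sqnorm_dominated_convergence[OF _ _ const_L2])
      show "u n \<in> borel_measurable (P \<Otimes>\<^sub>M M)" for n
        unfolding u_def[abs_def] by measurable
      show "AE z in P \<Otimes>\<^sub>M M. (\<lambda>n. u n z) \<longlonglongrightarrow> indicator (\<Union>i. C i) z"
        using sums by (simp add: u_def sums_def)
      have "\<bar>u n z - indicator (\<Union>i. C i) z\<bar> \<le> 1" for n z
      proof -
        have "u n z \<le> indicator (\<Union>i. C i) z"
          unfolding u_def sums_unique[OF sums]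
          by (intro sum_le_suminf sums_summable[OF sums]) auto
        moreover have "0 \<le> u n z"
          by (simp add: u_def sum_nonneg)
        moreover have "indicator (\<Union>i. C i) z \<le> (1::real)"
          by (simp add: indicator_def)
        ultimately show ?thesis
          by linarith
      qed
      then show "AE z in P \<Otimes>\<^sub>M M. \<bar>u n z - indicator (\<Union>i. C i) z\<bar> \<le> 1" for n
        by simp
    qed measurable
    ultimately show ?case
      by (rule simple_approximable_limit[rotated]) measurable
  qed
qed

lemma L2_simple_approximable:
  fixes P :: "'w measure" and M :: "'a measure"
  assumes "finite_measure P" "finite_measure M" and f: "f \<in> L2 (P \<Otimes>\<^sub>M M)"
  shows "simple_approximable P M f"
proof -
  let ?N = "P \<Otimes>\<^sub>M M"
  have [measurable]: "f \<in> borel_measurable ?N"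
    using f by (simp add: L2_iff_sqnorm)
  obtain s where s: "\<And>i. simple_function ?N (s i)"
      "\<And>z. z \<in> space ?N \<Longrightarrow> (\<lambda>i. s i z) \<longlonglongrightarrow> f z"
      "\<And>i z. z \<in> space ?N \<Longrightarrow> norm (s i z) \<le> 2 * norm (f z)"
    using borel_measurable_implies_sequence_metric[of f ?N 0] unfolding norm_conv_dist[symmetric] by fastforce
  have meas [measurable]: "s i \<in> borel_measurable ?N" for i
    using s(1) by (rule borel_measurable_simple_function)
  have "simple_approximable P M (s i)" for i
  proof (rule simple_approximable_cong)
    show "simple_approximable P M (\<lambda>z. \<Sum>y\<in>s i ` space ?N. y * indicator (s i -` {y} \<inter> space ?N) z)"
      by (intro simple_approximable_sum simple_approximable_cmult simple_approximable_indicator assms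
          measurable_sets[OF meas]) simp
    fix z assume z: "z \<in> space ?N"
    have "(\<Sum>y\<in>s i ` space ?N. y * indicator (s i -` {y} \<inter> space ?N) z) = (\<Sum>y\<in>s i ` space ?N. if y = s i z then y else 0)"
      using z by (intro sum.cong) (auto simp: indicator_def)
    also have "\<dots> = s i z"
      using z s(1)[of i] by (simp add: simple_function_def)
    finally show "(\<Sum>y\<in>s i ` space ?N. y * indicator (s i -` {y} \<inter> space ?N) z) = s i z" .
  qed
  moreover have "(\<lambda>n. sqnorm ?N (\<lambda>z. s n z - f z)) \<longlonglongrightarrow> 0"
  proof (rule sqnorm_dominated_convergence)
    \<comment> \<open>The approximants satisfy |s n| <= 2 |f|, hence |s n - f| <= 3 |f|.\<close>
    have "(\<lambda>z. 3 * f z) \<in> L2 ?N"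
      by (rule L2_cmult[OF f])
    then show "(\<lambda>z. \<bar>3 * f z\<bar>) \<in> L2 ?N"
      by (simp add: L2_iff_sqnorm sqnorm_def)
    have "\<bar>s n z - f z\<bar> \<le> \<bar>3 * f z\<bar>" if "z \<in> space ?N" for n z
      using s(3)[OF that, of n] by simp
    then show "AE z in ?N. \<bar>s n z - f z\<bar> \<le> \<bar>3 * f z\<bar>" for n
      by (intro AE_I2)
    show "AE z in ?N. (\<lambda>n. s n z) \<longlonglongrightarrow> f z"
      using s(2) by (intro AE_I2)
  qed simp_all
  ultimately show ?thesis
    by (rule simple_approximable_limit[rotated]) measurable
qed

section \<open>From square integrability on the product to the Bochner space\<close>

lemma sqnorm_pair_measure:
  assumes "sigma_finite_measure M" and [measurable]: "f \<in> borel_measurable (P \<Otimes>\<^sub>M M)"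
  shows "(\<integral>\<^sup>+ \<omega>. sqnorm M (\<lambda>x. f (\<omega>, x)) \<partial>P) = sqnorm (P \<Otimes>\<^sub>M M) f"
  unfolding sqnorm_def using sigma_finite_measure.nn_integral_fst[OF assms(1), of "\<lambda>z. ennreal ((f z)\<^sup>2)" P]
  by simp

lemma bochner_L2_norm_eq_sqnorm:
  assumes "sigma_finite_measure M" "(\<lambda>z. X (fst z) (snd z)) \<in> borel_measurable (P \<Otimes>\<^sub>M M)"
  shows "bochner_L2_norm P M X = ennreal_sqrt (sqnorm (P \<Otimes>\<^sub>M M) (\<lambda>z. X (fst z) (snd z)))"
  using sqnorm_pair_measure[OF assms]
  by (simp add: bochner_L2_norm_def L2_norm_eq_sqnorm ennreal_sqrt_power2)

text \<open>Approximants with squared errors at most 2^(-n) on the product have summable expected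
  squared distances. The sum of these distances is then almost surely finite and its terms tend to
  0, which turns approximation in the mean into the almost sure convergence in
  \<open>strongly_measurable_L2\<close>.\<close>

lemma bochner_L2I:
  assumes "finite_measure P" "finite_measure M"
    and X: "(\<lambda>z. X (fst z) (snd z)) \<in> L2 (P \<Otimes>\<^sub>M M)"
  shows "X \<in> bochner_L2 P M"
proof -
  interpret P: finite_measure P by fact
  interpret M: finite_measure M by fact
  have sf: "sigma_finite_measure M" ..
  let ?X = "\<lambda>z. X (fst z) (snd z)"
  have X_meas [measurable]: "?X \<in> borel_measurable (P \<Otimes>\<^sub>M M)" and fin: "sqnorm (P \<Otimes>\<^sub>M M) ?X < \<top>"
    using X by (auto simp: L2_iff_sqnorm)
  have "\<exists>S. simple_L2 P M S \<and> sqnorm (P \<Otimes>\<^sub>M M) (\<lambda>z. ?X z - S (fst z) (snd z)) \<le> ennreal ((1/2) ^ n)" for n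
    using L2_simple_approximable[OF assms] unfolding simple_approximable_def by simp
  then obtain S where S: "\<And>n. simple_L2 P M (S n)"
    "\<And>n. sqnorm (P \<Otimes>\<^sub>M M) (\<lambda>z. ?X z - S n (fst z) (snd z)) \<le> ennreal ((1/2) ^ n)"
    by metis
  have S_meas [measurable]: "(\<lambda>z. S n (fst z) (snd z)) \<in> borel_measurable (P \<Otimes>\<^sub>M M)" for n
    using S(1) by (simp add: simple_L2_def)
  define d where "d n \<omega> = sqnorm M (\<lambda>x. X \<omega> x - S n \<omega> x)" for n \<omega>
  have d_meas [measurable]: "d n \<in> borel_measurable P" for n
    unfolding d_def[abs_def] sqnorm_def by measurable
  have "(\<integral>\<^sup>+ \<omega>. (\<Sum>n. d n \<omega>) \<partial>P) = (\<Sum>n. sqnorm (P \<Otimes>\<^sub>M M) (\<lambda>z. ?X z - S n (fst z) (snd z)))"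
  proof -
    have "(\<integral>\<^sup>+ \<omega>. (\<Sum>n. d n \<omega>) \<partial>P) = (\<Sum>n. \<integral>\<^sup>+ \<omega>. d n \<omega> \<partial>P)"
      by (rule nn_integral_suminf) simp
    moreover have "(\<integral>\<^sup>+ \<omega>. d n \<omega> \<partial>P) = sqnorm (P \<Otimes>\<^sub>M M) (\<lambda>z. ?X z - S n (fst z) (snd z))" for n
      using sqnorm_pair_measure[OF sf, of "\<lambda>z. ?X z - S n (fst z) (snd z)" P] by (simp add: d_def)
    ultimately show ?thesis
      by simp
  qed
  also have "\<dots> \<le> (\<Sum>n. ennreal ((1/2) ^ n))"
    by (intro suminf_le S summableI)
  also have "\<dots> < \<top>"
    by (rule suminf_geometric_ennreal_less_top) auto
  finally have "AE \<omega> in P. (\<Sum>n. d n \<omega>) \<noteq> \<infinity>"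
    by (intro nn_integral_noteq_infinite) auto
  moreover have "AE \<omega> in P. sqnorm M (X \<omega>) \<noteq> \<infinity>"
  proof (rule nn_integral_noteq_infinite)
    show "(\<integral>\<^sup>+ \<omega>. sqnorm M (X \<omega>) \<partial>P) \<noteq> \<infinity>"
      using fin sqnorm_pair_measure[OF sf X_meas] by simp
  qed (unfold sqnorm_def, measurable)
  ultimately have "AE \<omega> in P. L2_tendsto M (\<lambda>n. S n \<omega>) (X \<omega>) sequentially"
    using AE_space
  proof eventually_elim
    case (elim \<omega>)
    have "d n \<omega> \<noteq> \<top>" for n
      using elim(1) ennreal_suminf_lessD[of "\<lambda>n. d n \<omega>" \<top> n] by (auto simp: less_top)
    then have eq: "ennreal (enn2real (d n \<omega>)) = d n \<omega>" for n
      by (simp add: less_top)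
    have "summable (\<lambda>n. enn2real (d n \<omega>))"
      using elim(1) by (intro summable_suminf_not_top) (auto simp: eq)
    then have "(\<lambda>n. ennreal (enn2real (d n \<omega>))) \<longlonglongrightarrow> ennreal 0"
      by (intro tendsto_ennrealI summable_LIMSEQ_zero)
    then have "(\<lambda>n. d n \<omega>) \<longlonglongrightarrow> 0"
      by (simp add: eq)
    moreover have "X \<omega> \<in> L2 M"
      using elim measurable_Pair2[OF X_meas, of \<omega>] by (simp add: L2_iff_sqnorm less_top)
    ultimately show ?case
      using S(1) elim(3) by (auto simp: L2_tendsto_iff_sqnorm simple_L2_def d_def sqnorm_minus_commute[of _ "X \<omega>"])
  qed
  then have "strongly_measurable_L2 P M X"
    unfolding strongly_measurable_L2_def using S(1) by (auto simp: simple_L2_def intro!: exI[of _ S])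
  moreover have "bochner_L2_norm P M X < \<top>"
    using fin by (simp add: bochner_L2_norm_eq_sqnorm[OF sf X_meas] ennreal_sqrt_less_top_iff)
  ultimately show ?thesis
    by (simp add: bochner_L2_def)
qed

lemma bochner_L2_tendstoI:
  assumes "finite_measure P" "finite_measure M"
    and X: "\<forall>\<^sub>F i in G. (\<lambda>z. X i (fst z) (snd z)) \<in> L2 (P \<Otimes>\<^sub>M M)"
    and Z: "(\<lambda>z. Z (fst z) (snd z)) \<in> L2 (P \<Otimes>\<^sub>M M)"
    and lim: "((\<lambda>i. sqnorm (P \<Otimes>\<^sub>M M) (\<lambda>z. X i (fst z) (snd z) - Z (fst z) (snd z))) \<longlongrightarrow> 0) G"
  shows "bochner_L2_tendsto P M X Z G"
  unfolding bochner_L2_tendsto_def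
proof (intro conjI)
  interpret M: finite_measure M by fact
  show "\<forall>\<^sub>F i in G. X i \<in> bochner_L2 P M"
    using X by eventually_elim (rule bochner_L2I[OF assms(1,2)])
  show "Z \<in> bochner_L2 P M"
    by (rule bochner_L2I) fact+
  have "\<forall>\<^sub>F i in G. ennreal_sqrt (sqnorm (P \<Otimes>\<^sub>M M) (\<lambda>z. X i (fst z) (snd z) - Z (fst z) (snd z)))
      = bochner_L2_norm P M (\<lambda>\<omega> x. X i \<omega> x - Z \<omega> x)"
    using X by eventually_elim
      (subst bochner_L2_norm_eq_sqnorm, unfold_locales, use Z in \<open>auto simp: L2_iff_sqnorm\<close>)
  then show "((\<lambda>i. bochner_L2_norm P M (\<lambda>\<omega> x. X i \<omega> x - Z \<omega> x)) \<longlongrightarrow> 0) G"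
    using lim by (subst (asm) ennreal_sqrt_tendsto_0_iff[symmetric]) (rule Lim_transform_eventually)
qed

section \<open>Pathwise representation of the Wiener integral\<close>

text \<open>
  Integration by parts: for a continuous path \<open>\<beta>\<close> with \<open>\<beta> 0 = 0\<close> and a kernel \<open>k\<close> with derivative
  \<open>k'\<close>, this is the integral of $k(t - r)$ against $d\beta(r)$ over $[0,t]$.
\<close>

definition path_integral :: "(real \<Rightarrow> real) \<Rightarrow> (real \<Rightarrow> real) \<Rightarrow> (real \<Rightarrow> real) \<Rightarrow> real \<Rightarrow> real" where
  "path_integral k k' \<beta> t = k 0 * \<beta> t + integral {0..t} (\<lambda>r. k' (t - r) * \<beta> r)"

text \<open>Left-endpoint sums on the uniform grid. They converge for every continuous path and are
  at the same time integrals of step functions; this links the pathwise description of the Wiener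
  integral with the one by mean-square approximation.\<close>

definition riemann_sum :: "(real \<Rightarrow> real) \<Rightarrow> (real \<Rightarrow> real) \<Rightarrow> real \<Rightarrow> nat \<Rightarrow> real" where
  "riemann_sum k \<beta> t n =
    (\<Sum>i<n. k (t - t * real i / real n) * (\<beta> (t * real (Suc i) / real n) - \<beta> (t * real i / real n)))"

lemma continuous_on_interval_bounded:
  fixes f :: "real \<Rightarrow> real"
  assumes "continuous_on {a..b} f"
  shows "\<exists>C>0. \<forall>r\<in>{a..b}. \<bar>f r\<bar> \<le> C"
proof -
  have "bounded (f ` {a..b})"
    using assms by (intro compact_imp_bounded compact_continuous_image) auto
  then show ?thesis
    by (simp add: bounded_pos)
qed

text \<open>Summation by parts, one cell at a time. On a cell from p to q the summand differs from
  the increment of the boundary term k(t - r) beta(r) by (k(t - p) - k(t - q)) beta(q), which is the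
  integral of k'(t - r) beta(q) over the cell. Replacing beta(q) by beta(r) there costs at most C
  epsilon (q - p). The ordering is carried along in the induction because the integrals over
  adjacent intervals have to be joined.\<close>

lemma riemann_sum_error:
  fixes \<beta> k k' :: "real \<Rightarrow> real"
  assumes k: "\<And>r. (k has_real_derivative k' r) (at r)" and k': "continuous_on UNIV k'"
    and \<beta>: "continuous_on UNIV \<beta>"
    and \<tau>: "\<And>i. i < n \<Longrightarrow> \<tau> i \<le> \<tau> (Suc i)"
    and C: "\<And>i r. i < n \<Longrightarrow> r \<in> {\<tau> i..\<tau> (Suc i)} \<Longrightarrow> \<bar>k' (t - r)\<bar> \<le> C"
    and \<epsilon>: "\<And>i r. i < n \<Longrightarrow> r \<in> {\<tau> i..\<tau> (Suc i)} \<Longrightarrow> \<bar>\<beta> r - \<beta> (\<tau> (Suc i))\<bar> \<le> \<epsilon>"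
    and "m \<le> n"
  shows "\<tau> 0 \<le> \<tau> m \<and> \<bar>(\<Sum>i<m. k (t - \<tau> i) * (\<beta> (\<tau> (Suc i)) - \<beta> (\<tau> i)))
    - (k (t - \<tau> m) * \<beta> (\<tau> m) - k (t - \<tau> 0) * \<beta> (\<tau> 0) + integral {\<tau> 0..\<tau> m} (\<lambda>r. k' (t - r) * \<beta> r))\<bar>
    \<le> C * \<epsilon> * (\<tau> m - \<tau> 0)"
  using \<open>m \<le> n\<close>
proof (induction m)
  case (Suc m)
  define p q where "p = \<tau> m" and "q = \<tau> (Suc m)"
  have pq: "p \<le> q" "\<tau> 0 \<le> p"
    using Suc \<tau>[of m] by (auto simp: p_def q_def)
  let ?g = "\<lambda>r. k' (t - r) * \<beta> r"
  have cont [continuous_intros]: "continuous_on S (\<lambda>r. k' (t - r))" "continuous_on S \<beta>" for S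
    by (auto intro!: continuous_on_compose2[OF k'] continuous_intros continuous_on_subset[OF \<beta>])
  have k_int: "((\<lambda>r. k' (t - r)) has_integral (k (t - p) - k (t - q))) {p..q}"
  proof -
    have "((\<lambda>r. k (t - r)) has_real_derivative (k' (t - r) * (- 1))) (at r within {p..q})" for r
      by (rule DERIV_chain2[OF k]) (auto intro!: derivative_eq_intros)
    then have "((\<lambda>r. - k (t - r)) has_vector_derivative k' (t - r)) (at r within {p..q})" for r
      using DERIV_minus[of "\<lambda>r. k (t - r)" "k' (t - r) * (- 1)" r "{p..q}"]
      by (simp add: has_real_derivative_iff_has_vector_derivative)
    then show ?thesis
      using fundamental_theorem_of_calculus[OF pq(1), of "\<lambda>r. - k (t - r)" "\<lambda>r. k' (t - r)"]
      by simp
  qed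
  then have *: "((\<lambda>r. k' (t - r) * \<beta> q) has_integral (k (t - p) - k (t - q)) * \<beta> q) {p..q}"
    by (rule has_integral_mult_left)
  have "?g integrable_on {p..q}"
    by (intro integrable_continuous_interval continuous_intros)
  then have "((\<lambda>r. ?g r - k' (t - r) * \<beta> q) has_integral (integral {p..q} ?g - (k (t - p) - k (t - q)) * \<beta> q)) {p..q}"
    by (intro has_integral_diff integrable_integral *)
  then have "norm (integral {p..q} ?g - (k (t - p) - k (t - q)) * \<beta> q) \<le> C * \<epsilon> * measure lborel {p..q}"
  proof (rule has_integral_bound_real[where S = "{}", rotated 2])
    have "0 \<le> C" "0 \<le> \<epsilon>"
      using C[of m p] \<epsilon>[of m p] Suc.prems pq(1) unfolding p_def q_def
      by (auto intro: order.trans[OF abs_ge_zero])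
    then show "0 \<le> C * \<epsilon>"
      by simp
    show "norm (?g r - k' (t - r) * \<beta> q) \<le> C * \<epsilon>" if "r \<in> {p..q} - {}" for r
    proof -
      have "\<bar>k' (t - r)\<bar> * \<bar>\<beta> r - \<beta> q\<bar> \<le> C * \<epsilon>"
        using that C[of m r] \<epsilon>[of m r] Suc.prems by (intro mult_mono) (auto simp: p_def q_def)
      then show ?thesis
        by (simp add: abs_mult right_diff_distrib[symmetric])
    qed
  qed simp
  then have "norm (integral {p..q} ?g - (k (t - p) - k (t - q)) * \<beta> q) \<le> C * \<epsilon> * (q - p)"
    using pq(1) by simp
  moreover have "integral {\<tau> 0..q} ?g = integral {\<tau> 0..p} ?g + integral {p..q} ?g"
    using pq by (intro Henstock_Kurzweil_Integration.integral_combine[symmetric] integrable_continuous_interval continuous_intros) auto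
  ultimately show ?case
    using Suc pq unfolding p_def[symmetric] q_def[symmetric] by (simp add: p_def[symmetric] q_def[symmetric] algebra_simps)
qed simp

lemma riemann_sum_LIMSEQ:
  fixes \<beta> k k' :: "real \<Rightarrow> real"
  assumes k: "\<And>r. (k has_real_derivative k' r) (at r)" and k': "continuous_on UNIV k'"
    and \<beta>: "continuous_on UNIV \<beta>" "\<beta> 0 = 0" and "0 \<le> t"
  shows "riemann_sum k \<beta> t \<longlonglongrightarrow> path_integral k k' \<beta> t"
proof -
  have "continuous_on {0..t} k'"
    using k' by (rule continuous_on_subset) simp
  then obtain C where C: "0 < C" "\<And>r. r \<in> {0..t} \<Longrightarrow> \<bar>k' r\<bar> \<le> C"
    using continuous_on_interval_bounded by metis
  have unif: "uniformly_continuous_on {0..t} \<beta>"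
    using \<beta>(1) by (intro compact_uniformly_continuous) (auto intro: continuous_on_subset)
  show ?thesis
  proof (rule metric_LIMSEQ_I)
    fix \<epsilon> :: real assume "0 < \<epsilon>"
    \<comment> \<open>The total error is at most C eta t, so this choice makes it at most epsilon /
      2; \<open>t + 1\<close> covers \<open>t = 0\<close>.\<close>
    define \<eta> where "\<eta> = \<epsilon> / (2 * C * (t + 1))"
    have "0 < \<eta>"
      using \<open>0 < \<epsilon>\<close> C \<open>0 \<le> t\<close> by (simp add: \<eta>_def)
    then obtain \<delta> where "0 < \<delta>"
      and \<delta>: "\<And>x y. x \<in> {0..t} \<Longrightarrow> y \<in> {0..t} \<Longrightarrow> \<bar>y - x\<bar> < \<delta> \<Longrightarrow> \<bar>\<beta> y - \<beta> x\<bar> < \<eta>"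
      using unif unfolding uniformly_continuous_on_def dist_real_def by metis
    obtain N :: nat where N: "t / \<delta> < real N"
      using reals_Archimedean2 by blast
    show "\<exists>n0. \<forall>n\<ge>n0. dist (riemann_sum k \<beta> t n) (path_integral k k' \<beta> t) < \<epsilon>"
    proof (intro exI allI impI)
      \<comment> \<open>Starting at \<open>Suc N\<close> also ensures that \<open>n\<close> is
        positive.\<close>
      fix n assume n: "Suc N \<le> n"
      define \<tau> where "\<tau> i = t * real i / real n" for i
      have step: "\<tau> (Suc i) - \<tau> i = t / real n" for i
        by (simp add: \<tau>_def diff_divide_distrib[symmetric] algebra_simps)
      have "t / real n < \<delta>"
      proof -
        have "t < real N * \<delta>"
          using N \<open>0 < \<delta>\<close> by (simp add: field_simps)
        also have "\<dots> \<le> real n * \<delta>"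
          using n \<open>0 < \<delta>\<close> by (intro mult_right_mono) auto
        finally show ?thesis
          using n by (simp add: field_simps)
      qed
      have \<tau>_mono: "\<tau> i \<le> \<tau> (Suc i)" for i
        using step[of i] \<open>0 \<le> t\<close> n by (smt (verit) divide_nonneg_nonneg of_nat_0_le_iff)
      have \<tau>_range: "\<tau> i \<in> {0..t}" if "i \<le> n" for i
        using that \<open>0 \<le> t\<close> n by (auto simp: \<tau>_def divide_le_eq intro!: mult_left_mono)
      have "\<tau> 0 \<le> \<tau> n \<and> \<bar>(\<Sum>i<n. k (t - \<tau> i) * (\<beta> (\<tau> (Suc i)) - \<beta> (\<tau> i)))
        - (k (t - \<tau> n) * \<beta> (\<tau> n) - k (t - \<tau> 0) * \<beta> (\<tau> 0) + integral {\<tau> 0..\<tau> n} (\<lambda>r. k' (t - r) * \<beta> r))\<bar>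
        \<le> C * \<eta> * (\<tau> n - \<tau> 0)"
      proof (rule riemann_sum_error[OF k k' \<beta>(1)])
        fix i r assume i: "i < n" and r: "r \<in> {\<tau> i..\<tau> (Suc i)}"
        have mem: "r \<in> {0..t}" "\<tau> (Suc i) \<in> {0..t}"
          using r \<tau>_range[of i] \<tau>_range[of "Suc i"] i by auto
        then show "\<bar>k' (t - r)\<bar> \<le> C"
          by (intro C) auto
        show "\<bar>\<beta> r - \<beta> (\<tau> (Suc i))\<bar> \<le> \<eta>"
          using \<delta>[OF mem(2,1)] r step[of i] \<open>t / real n < \<delta>\<close> by auto
      qed (use \<tau>_mono in auto)
      moreover have "\<tau> 0 = 0" "\<tau> n = t"
        using n by (auto simp: \<tau>_def)
      ultimately have "\<bar>riemann_sum k \<beta> t n - path_integral k k' \<beta> t\<bar> \<le> C * \<eta> * t"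
        using \<beta>(2) by (simp add: riemann_sum_def path_integral_def \<tau>_def)
      also have "\<dots> \<le> \<epsilon> / 2"
      proof -
        have "C * \<eta> * t = \<epsilon> / 2 * (t / (t + 1))"
          using C(1) by (simp add: \<eta>_def)
        also have "\<dots> \<le> \<epsilon> / 2 * 1"
          using \<open>0 \<le> t\<close> \<open>0 < \<epsilon>\<close> by (intro mult_left_mono) auto
        finally show ?thesis
          by simp
      qed
      also have "\<dots> < \<epsilon>"
        using \<open>0 < \<epsilon>\<close> by simp
      finally show "dist (riemann_sum k \<beta> t n) (path_integral k k' \<beta> t) < \<epsilon>"
        by (simp add: dist_real_def)
    qed
  qed
qed

section \<open>Brownian motion with continuous paths, described by its covariance\<close>

lemma L2_inner_diff_diff:
  assumes "f \<in> L2 M" "g \<in> L2 M" "h \<in> L2 M" "k \<in> L2 M"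
  shows "L2_inner M (\<lambda>x. f x - g x) (\<lambda>x. h x - k x) =
    L2_inner M f h - L2_inner M f k - L2_inner M g h + L2_inner M g k"
  using assms by (simp add: L2_inner_def left_diff_distrib right_diff_distrib L2_integrable_mult)

lemma L2_inner_sum_sum:
  assumes "\<And>i. i \<in> I \<Longrightarrow> f i \<in> L2 M" "\<And>j. j \<in> J \<Longrightarrow> g j \<in> L2 M"
  shows "L2_inner M (\<lambda>x. \<Sum>i\<in>I. c i * f i x) (\<lambda>x. \<Sum>j\<in>J. d j * g j x) =
    (\<Sum>i\<in>I. \<Sum>j\<in>J. c i * d j * L2_inner M (f i) (g j))"
proof -
  have "L2_inner M (\<lambda>x. \<Sum>i\<in>I. c i * f i x) (\<lambda>x. \<Sum>j\<in>J. d j * g j x)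
      = (\<integral>x. (\<Sum>i\<in>I. \<Sum>j\<in>J. c i * d j * (f i x * g j x)) \<partial>M)"
    by (simp add: L2_inner_def sum_product mult_ac)
  also have "\<dots> = (\<Sum>i\<in>I. \<Sum>j\<in>J. c i * d j * L2_inner M (f i) (g j))"
    using assms by (simp add: L2_inner_def L2_integrable_mult)
  finally show ?thesis .
qed

lemma sqnorm_diff_L2_inner:
  assumes "f \<in> L2 M" "g \<in> L2 M"
  shows "sqnorm M (\<lambda>x. f x - g x) = ennreal (L2_inner M f f - 2 * L2_inner M f g + L2_inner M g g)"
proof -
  have "(\<integral>x. (f x - g x)\<^sup>2 \<partial>M) = L2_inner M (\<lambda>x. f x - g x) (\<lambda>x. f x - g x)"
    by (simp add: L2_inner_def power2_eq_square)
  also have "\<dots> = L2_inner M f f - 2 * L2_inner M f g + L2_inner M g g"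
    using assms by (subst L2_inner_diff_diff) (auto simp: L2_inner_def mult.commute)
  finally show ?thesis
    using assms by (simp add: sqnorm_eq_integral L2_diff)
qed

text \<open>The interface for everything below: every path is continuous on the whole line and
  starts at 0, so that pathwise calculus meets no exceptional set, and the isometry is read off the
  covariance.\<close>

locale continuous_brownian = prob_space P for P :: "'w measure" +
  fixes b :: "real \<Rightarrow> 'w \<Rightarrow> real"
  assumes b_measurable [measurable]: "\<And>t. b t \<in> borel_measurable P"
    and b_continuous: "\<And>\<omega>. continuous_on UNIV (\<lambda>t. b t \<omega>)"
    and b_0: "\<And>\<omega>. b 0 \<omega> = 0"
    and b_L2: "\<And>t. 0 \<le> t \<Longrightarrow> b t \<in> L2 P"
    and b_covariance: "\<And>s t. 0 \<le> s \<Longrightarrow> 0 \<le> t \<Longrightarrow> L2_inner P (b s) (b t) = min s t"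

text \<open>
  The covariance is obtained by polarisation from the variances of the increments.
\<close>

lemma (in prob_space) standard_brownian_motion_continuous_version:
  assumes B: "standard_brownian_motion M B"
  obtains b where "continuous_brownian M b" "\<And>t. 0 \<le> t \<Longrightarrow> AE \<omega> in M. b t \<omega> = B t \<omega>"
proof -
  have B_meas [measurable]: "B t \<in> borel_measurable M" if "0 \<le> t" for t
    using B that by (simp add: standard_brownian_motion_def)
  have "AE \<omega> in M. B 0 \<omega> = 0 \<and> continuous_on {0..} (\<lambda>t. B t \<omega>)"
    using B by (simp add: standard_brownian_motion_def)
  then obtain N where N: "{\<omega>\<in>space M. \<not> (B 0 \<omega> = 0 \<and> continuous_on {0..} (\<lambda>t. B t \<omega>))} \<subseteq> N"
      "emeasure M N = 0" "N \<in> sets M"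
    by (rule AE_E)
  \<comment> \<open>Paths in the exceptional set are replaced by 0, and at negative times the value
    at time 0 is kept; this makes every path continuous on the whole line.\<close>
  define b where "b t \<omega> = (if \<omega> \<in> space M - N then B (max 0 t) \<omega> else 0)" for t \<omega>
  have meas [measurable]: "b t \<in> borel_measurable M" for t
    using N(3) unfolding b_def[abs_def] by (intro measurable_If_set) auto
  have "AE \<omega> in M. \<omega> \<notin> N"
    using N by (intro AE_not_in) auto
  then have ae: "AE \<omega> in M. b t \<omega> = B t \<omega>" if "0 \<le> t" for t
    using AE_space by eventually_elim (use that in \<open>auto simp: b_def\<close>)
  have inc: "(\<lambda>\<omega>. b t \<omega> - b s \<omega>) \<in> L2 M \<and> (\<integral>\<omega>. (b t \<omega> - b s \<omega>)\<^sup>2 \<partial>M) = t - s" if "0 \<le> s" "s \<le> t" for s t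
  \<comment> \<open>The law of an increment is given by a normal density, which is available only
    for a positive standard deviation; the empty increment is treated apart.\<close>
  proof (cases "s = t")
    case False
    then have st: "0 < sqrt (t - s)"
      using that by simp
    have D: "distributed M lborel (\<lambda>\<omega>. B t \<omega> - B s \<omega>) (normal_density 0 (sqrt (t - s)))"
      using B that False by (simp add: standard_brownian_motion_def)
    have "integrable M (\<lambda>\<omega>. (B t \<omega> - B s \<omega>)\<^sup>2)"
      using integrable_normal_moment[of "sqrt (t - s)" 0 2] st
        distributed_integrable[OF D, of "\<lambda>x. x\<^sup>2"] by simp
    moreover have "(\<integral>\<omega>. (B t \<omega> - B s \<omega>)\<^sup>2 \<partial>M) = t - s"
      using normal_distributed_variance[OF st D] normal_distributed_expectation[OF st D] that by simp
    moreover have eq: "AE \<omega> in M. (B t \<omega> - B s \<omega>)\<^sup>2 = (b t \<omega> - b s \<omega>)\<^sup>2"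
      using ae[of s] ae[of t] that by auto
    ultimately have "integrable M (\<lambda>\<omega>. (b t \<omega> - b s \<omega>)\<^sup>2)" "(\<integral>\<omega>. (b t \<omega> - b s \<omega>)\<^sup>2 \<partial>M) = t - s"
      using that integral_cong_AE[OF _ _ eq] integrable_cong_AE[OF _ _ eq] by auto
    then show ?thesis
      by (simp add: L2_iff_sqnorm sqnorm_def nn_integral_eq_integral)
  qed (simp add: L2_zero)
  have b0: "b 0 \<omega> = 0" for \<omega>
    using N(1) by (auto simp: b_def)
  have b_L2: "b t \<in> L2 M" if "0 \<le> t" for t
    using inc[of 0 t] that by (simp add: b0)
  have cov: "L2_inner M (b s) (b t) = s" if "0 \<le> s" "s \<le> t" for s t
  proof -
    have "L2_inner M (b s) (b s) = s" "L2_inner M (b t) (b t) = t"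
      using inc[of 0 s] inc[of 0 t] that by (auto simp: b0 L2_inner_def power2_eq_square)
    moreover have "t - s = L2_inner M (\<lambda>\<omega>. b t \<omega> - b s \<omega>) (\<lambda>\<omega>. b t \<omega> - b s \<omega>)"
      using inc[of s t] that by (simp add: L2_inner_def power2_eq_square)
    moreover have "L2_inner M (b t) (b s) = L2_inner M (b s) (b t)"
      by (simp add: L2_inner_def mult.commute)
    ultimately show ?thesis
      using L2_inner_diff_diff[of "b t" M "b s" "b t" "b s"] b_L2 that by simp
  qed
  have "continuous_brownian M b"
  proof
    show "continuous_on UNIV (\<lambda>t. b t \<omega>)" for \<omega>
    proof (cases "\<omega> \<in> space M - N")
      case True
      then have "continuous_on {0..} (\<lambda>t. B t \<omega>)"
        using N(1) by auto
      then have "continuous_on UNIV (\<lambda>t. B (max 0 t) \<omega>)"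
        by (rule continuous_on_compose2) (auto intro!: continuous_intros)
      then show ?thesis
        using True by (simp add: b_def)
    next
      case False
      then have eq: "(\<lambda>t. b t \<omega>) = (\<lambda>t. 0)"
        by (auto simp: b_def)
      show ?thesis
        unfolding eq by (rule continuous_on_const)
    qed
    show "L2_inner M (b s) (b t) = min s t" if "0 \<le> s" "0 \<le> t" for s t
    proof (cases "s \<le> t")
      case False
      have "L2_inner M (b s) (b t) = L2_inner M (b t) (b s)"
        by (simp add: L2_inner_def mult.commute)
      then show ?thesis
        using cov[of t s] False that by simp
    qed (use cov that in simp)
  qed (use b0 b_L2 in auto)
  then show thesis
    using ae that by blast
qed

section \<open>Step functions on partitions of [0,t] and the approximation of kernels by
  them\<close>

definition time_partition :: "real \<Rightarrow> nat \<Rightarrow> (nat \<Rightarrow> real) \<Rightarrow> bool" where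
  "time_partition t n \<tau> \<longleftrightarrow> \<tau> 0 = 0 \<and> \<tau> n = t \<and> (\<forall>i<n. \<tau> i \<le> \<tau> (Suc i))"

definition step_function :: "nat \<Rightarrow> (nat \<Rightarrow> real) \<Rightarrow> (nat \<Rightarrow> real) \<Rightarrow> real \<Rightarrow> real" where
  "step_function n \<tau> c r = (\<Sum>i<n. c i * indicator {\<tau> i<..\<tau> (Suc i)} r)"

definition step_integral :: "(real \<Rightarrow> 'w \<Rightarrow> real) \<Rightarrow> nat \<Rightarrow> (nat \<Rightarrow> real) \<Rightarrow> (nat \<Rightarrow> real) \<Rightarrow> 'w \<Rightarrow> real" where
  "step_integral b n \<tau> c \<omega> = (\<Sum>i<n. c i * (b (\<tau> (Suc i)) \<omega> - b (\<tau> i) \<omega>))"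

abbreviation uniform_partition :: "real \<Rightarrow> nat \<Rightarrow> nat \<Rightarrow> real" where
  "uniform_partition t n \<equiv> \<lambda>i. t * real i / real n"

lemma elementary_wiener_integral_iff:
  "elementary_wiener_integral B t f X \<longleftrightarrow>
    (\<exists>n \<tau> c. time_partition t n \<tau> \<and> f = step_function n \<tau> c \<and> X = step_integral B n \<tau> c)"
  unfolding elementary_wiener_integral_def time_partition_def step_function_def[abs_def] step_integral_def[abs_def]
  by (simp only: conj_assoc)

lemma riemann_sum_eq_step_integral:
  "riemann_sum k (\<lambda>t. b t \<omega>) t n =
    step_integral b n (uniform_partition t n) (\<lambda>i. k (t - uniform_partition t n i)) \<omega>"
  by (simp add: riemann_sum_def step_integral_def)

lemma partition_mono:
  assumes "time_partition t n \<tau>" "i \<le> j" "j \<le> n"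
  shows "\<tau> i \<le> \<tau> j"
  using assms(2,3)
proof (induction j rule: dec_induct)
  case (step j)
  then have "\<tau> i \<le> \<tau> j" "\<tau> j \<le> \<tau> (Suc j)"
    using assms(1) by (auto simp: time_partition_def)
  then show ?case
    by (rule order.trans)
qed simp

lemma partition_range:
  assumes "time_partition t n \<tau>" "i \<le> n"
  shows "0 \<le> \<tau> i" "\<tau> i \<le> t"
  using partition_mono[OF assms(1), of 0 i] partition_mono[OF assms(1), of i n] assms
  by (auto simp: time_partition_def)

lemma partition_uniform: "0 \<le> t \<Longrightarrow> 0 < n \<Longrightarrow> time_partition t n (uniform_partition t n)"
  by (auto simp: time_partition_def intro!: divide_right_mono mult_left_mono)

text \<open>The cells are half-open, so a point after \<open>\<tau> 0\<close> lies in exactly one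
  nonempty cell. The induction splits off the last cell, on which all earlier indicators
  vanish.\<close>

lemma step_function_eval:
  assumes "\<And>i. i < n \<Longrightarrow> \<tau> i \<le> \<tau> (Suc i)" "\<tau> 0 < r" "r \<le> \<tau> n"
  shows "\<exists>i<n. r \<in> {\<tau> i<..\<tau> (Suc i)} \<and> step_function n \<tau> c r = c i"
  using assms
proof (induction n)
  case (Suc n)
  have mono: "\<tau> i \<le> \<tau> n" if "i \<le> n" for i
    using that
  proof (induction rule: inc_induct)
    case (step i)
    then show ?case
      using Suc.prems(1)[of i] by simp
  qed simp
  show ?case
  proof (cases "r \<le> \<tau> n")
    case True
    then obtain i where "i < n" "r \<in> {\<tau> i<..\<tau> (Suc i)}" "step_function n \<tau> c r = c i"
      using Suc by auto
    then show ?thesis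
      using True by (intro exI[of _ i]) (simp add: step_function_def)
  next
    case False
    have "step_function n \<tau> c r = 0"
      unfolding step_function_def
    proof (intro sum.neutral ballI)
      fix i assume "i \<in> {..<n}"
      then have "\<tau> (Suc i) \<le> \<tau> n"
        by (intro mono) simp
      then show "c i * indicator {\<tau> i<..\<tau> (Suc i)} r = 0"
        using False by (simp add: indicator_def)
    qed
    then show ?thesis
      using False Suc.prems by (intro exI[of _ n]) (simp add: step_function_def)
  qed
qed simp

lemma L2_bounded:
  fixes f :: "'a \<Rightarrow> real"
  assumes "finite_measure M" and [measurable]: "f \<in> borel_measurable M"
    and bound: "AE x in M. \<bar>f x\<bar> \<le> C"
  shows "f \<in> L2 M"
proof -
  interpret finite_measure M by fact
  have "sqnorm M f \<le> (\<integral>\<^sup>+ x. ennreal (C\<^sup>2) \<partial>M)"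
    unfolding sqnorm_def
  proof (rule nn_integral_mono_AE)
    show "AE x in M. ennreal ((f x)\<^sup>2) \<le> ennreal (C\<^sup>2)"
      using bound
    proof eventually_elim
      case (elim x)
      then have "\<bar>f x\<bar>\<^sup>2 \<le> C\<^sup>2"
        by (intro power_mono) auto
      then show ?case
        by (simp add: ennreal_leI)
    qed
  qed
  also have "\<dots> < \<top>"
    by (simp add: less_top[symmetric] ennreal_mult_eq_top_iff)
  finally show ?thesis
    by (simp add: L2_iff_sqnorm)
qed

lemma finite_measure_interval: "finite_measure (restrict_space lborel {0..t::real})"
  by (rule finite_measureI) (simp add: emeasure_restrict_space space_restrict_space emeasure_lborel_Icc_eq)

lemma L2_indicator_interval: "indicator {a<..b} \<in> L2 (restrict_space lborel {0..t::real})"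
  by (rule L2_bounded[OF finite_measure_interval, where C = 1])
    (auto simp: indicator_def intro!: measurable_restrict_space1)

lemma L2_step_function: "step_function n \<tau> c \<in> L2 (restrict_space lborel {0..t})"
  unfolding step_function_def[abs_def] by (intro L2_sum L2_cmult L2_indicator_interval)

lemma L2_inner_indicator_interval:
  assumes "0 \<le> a" "a' \<le> t" "0 \<le> c" "c' \<le> t"
  shows "L2_inner (restrict_space lborel {0..t::real}) (indicator {a<..a'}) (indicator {c<..c'}) =
    max 0 (min a' c' - max a c)"
proof -
  have "L2_inner (restrict_space lborel {0..t}) (indicator {a<..a'}) (indicator {c<..c'})
      = (\<integral>r. indicator {max a c<..min a' c'} r \<partial>lborel)"
  proof -
    have "indicator {0..t} r *\<^sub>R (indicator {a<..a'} r * indicator {c<..c'} r :: real) =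
        indicator {max a c<..min a' c'} r" for r
      using assms by (auto simp: indicator_def)
    then show ?thesis
      unfolding L2_inner_def by (subst integral_restrict_space) (simp, simp only:)
  qed
  also have "\<dots> = max 0 (min a' c' - max a c)"
  proof -
    have "(\<integral>r. indicator {p<..q} r \<partial>lborel) = max 0 (q - p)" for p q :: real
      by (cases "p \<le> q") auto
    then show ?thesis .
  qed
  finally show ?thesis .
qed

text \<open>Dominated convergence: at \<open>r\<close> the step function takes the value of the
  kernel at a grid point within t / (n + 1) of \<open>r\<close>, and the kernel is continuous and
  bounded on [0,t]. The index \<open>Suc n\<close> avoids the partition without cells.\<close>

lemma riemann_step_function_tendsto:
  fixes k :: "real \<Rightarrow> real"
  assumes k: "continuous_on UNIV k" and "0 \<le> t"
  shows "(\<lambda>n. sqnorm (restrict_space lborel {0..t})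
    (\<lambda>r. step_function (Suc n) (uniform_partition t (Suc n)) (\<lambda>i. k (t - uniform_partition t (Suc n) i)) r - k (t - r)))
    \<longlonglongrightarrow> 0"
proof -
  let ?I = "restrict_space lborel {0..t}"
  let ?\<tau> = "\<lambda>n. uniform_partition t (Suc n)"
  let ?f = "\<lambda>n. step_function (Suc n) (?\<tau> n) (\<lambda>i. k (t - ?\<tau> n i))"
  have "continuous_on {0..t} k"
    using k by (rule continuous_on_subset) simp
  then obtain K where K: "\<And>r. r \<in> {0..t} \<Longrightarrow> \<bar>k r\<bar> \<le> K"
    using continuous_on_interval_bounded by metis
  have k_meas [measurable]: "k \<in> borel_measurable borel"
    using k by (rule borel_measurable_continuous_onI)
  have f_meas: "?f n \<in> borel_measurable ?I" for n
    using L2_step_function[of "Suc n" "?\<tau> n" _ t] by (simp add: L2_iff_sqnorm)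
  have eval: "\<exists>r'. ?f n r = k (t - r') \<and> r' \<in> {0..t} \<and> \<bar>r' - r\<bar> \<le> t / real (Suc n)"
    if r: "0 < r" "r \<le> t" for n r
  proof -
    have part: "time_partition t (Suc n) (?\<tau> n)"
      using \<open>0 \<le> t\<close> by (rule partition_uniform) simp
    obtain i where i: "i < Suc n" "r \<in> {?\<tau> n i<..?\<tau> n (Suc i)}" "?f n r = k (t - ?\<tau> n i)"
      using step_function_eval[of "Suc n" "?\<tau> n" r "\<lambda>i. k (t - ?\<tau> n i)"] part r
      unfolding time_partition_def by (metis (no_types, lifting))
    have "?\<tau> n (Suc i) - ?\<tau> n i = t / real (Suc n)"
      by (simp only: diff_divide_distrib[symmetric] right_diff_distrib[symmetric]) simp
    then show ?thesis
      using i partition_range[OF part, of i] by (intro exI[of _ "?\<tau> n i"]) auto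
  qed
  \<comment> \<open>The point 0 lies in no half-open cell, so nothing can be said about the step
    functions there.\<close>
  have pos: "AE r in ?I. 0 < r \<and> r \<le> t"
  proof -
    have "AE r in lborel. r \<noteq> (0::real)"
      by (rule AE_lborel_singleton)
    then show ?thesis
      by (subst AE_restrict_space_iff) auto
  qed
  show ?thesis
  proof (rule sqnorm_dominated_convergence[where w = "\<lambda>_. 2 * K"])
    show "(\<lambda>_. 2 * K) \<in> L2 ?I"
      by (rule L2_bounded[OF finite_measure_interval, where C = "\<bar>2 * K\<bar>"]) auto
    show "AE r in ?I. \<bar>?f n r - k (t - r)\<bar> \<le> 2 * K" for n
      using pos
    proof eventually_elim
      case (elim r)
      then obtain r' where "?f n r = k (t - r')" "r' \<in> {0..t}"
        using eval by blast
      then show ?case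
        using K[of "t - r'"] K[of "t - r"] elim by auto
    qed
    show "AE r in ?I. (\<lambda>n. ?f n r) \<longlonglongrightarrow> k (t - r)"
      using pos
    proof eventually_elim
      case (elim r)
      then obtain r' where r': "\<And>n. ?f n r = k (t - r' n)" "\<And>n. \<bar>r' n - r\<bar> \<le> t / real (Suc n)"
        using eval by metis
      have "(\<lambda>n. t / real (Suc n)) \<longlonglongrightarrow> 0"
        by (rule LIMSEQ_Suc[OF lim_const_over_n])
      then have "(\<lambda>n. r' n - r) \<longlonglongrightarrow> 0"
        by (rule Lim_null_comparison[rotated]) (use r'(2) in auto)
      then have "(\<lambda>n. t - r' n) \<longlonglongrightarrow> t - r"
        by (intro tendsto_intros) (simp add: LIM_zero_iff)
      moreover have "isCont k (t - r)"
        using k by (simp add: continuous_on_eq_continuous_at)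
      ultimately show ?case
        unfolding r'(1) by (rule isCont_tendsto_compose[rotated])
    qed
  qed (use f_meas in \<open>auto intro!: measurable_restrict_space1\<close>)
qed

text \<open>Rounds a time to a countable grid; this yields the joint measurability of a continuous
  process.\<close>

lemma floor_over_LIMSEQ: "(\<lambda>n. of_int \<lfloor>real n * x\<rfloor> / real n) \<longlonglongrightarrow> x"
proof -
  have "norm (of_int \<lfloor>real n * x\<rfloor> / real n - x) \<le> 1 / real n" if "0 < n" for n
  proof -
    have "of_int \<lfloor>real n * x\<rfloor> / real n - x = (of_int \<lfloor>real n * x\<rfloor> - real n * x) / real n"
      using that by (simp add: field_simps)
    moreover have "\<bar>of_int \<lfloor>real n * x\<rfloor> - real n * x\<bar> \<le> 1"
      by linarith
    ultimately show ?thesis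
      using that by (simp add: divide_right_mono)
  qed
  then have "\<forall>\<^sub>F n in sequentially. norm (of_int \<lfloor>real n * x\<rfloor> / real n - x) \<le> 1 / real n"
    by (rule eventually_sequentiallyI[of 1]) simp
  then have "(\<lambda>n. of_int \<lfloor>real n * x\<rfloor> / real n - x) \<longlonglongrightarrow> 0"
    by (rule Lim_null_comparison) (rule lim_1_over_n)
  then show ?thesis
    by (simp add: LIM_zero_iff)
qed

section \<open>The isometry for integrals of step functions\<close>

context continuous_brownian
begin

lemma L2_increment: "0 \<le> s \<Longrightarrow> 0 \<le> t \<Longrightarrow> (\<lambda>\<omega>. b t \<omega> - b s \<omega>) \<in> L2 P"
  by (intro L2_diff b_L2)

text \<open>The covariance \<open>min s t\<close> is the inner product of the indicators of (0,s]
  and (0,t]. By bilinearity both sides are an alternating sum of four minima, which is the length of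
  the overlap of the two cells.\<close>

lemma increment_inner:
  assumes "0 \<le> a" "a \<le> a'" "a' \<le> t" "0 \<le> c" "c \<le> c'" "c' \<le> t"
  shows "L2_inner P (\<lambda>\<omega>. b a' \<omega> - b a \<omega>) (\<lambda>\<omega>. b c' \<omega> - b c \<omega>) =
    L2_inner (restrict_space lborel {0..t}) (indicator {a<..a'}) (indicator {c<..c'})"
proof -
  have "L2_inner P (\<lambda>\<omega>. b a' \<omega> - b a \<omega>) (\<lambda>\<omega>. b c' \<omega> - b c \<omega>) =
      min a' c' - min a' c - min a c' + min a c"
    using assms by (simp add: L2_inner_diff_diff b_L2 b_covariance)
  moreover have "\<dots> = max 0 (min a' c' - max a c)"
    using assms(2,5) by linarith
  ultimately show ?thesis
    using assms by (simp add: L2_inner_indicator_interval)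
qed

lemma L2_step_integral: "time_partition t n \<tau> \<Longrightarrow> step_integral b n \<tau> c \<in> L2 P"
  unfolding step_integral_def[abs_def]
  by (intro L2_sum L2_cmult L2_increment partition_range(1)[of t n \<tau>]) auto

text \<open>Both sides are expanded over all pairs of cells, so two different partitions can be
  compared without passing to a common refinement.\<close>

lemma step_integral_inner:
  assumes "time_partition t n \<tau>" "time_partition t m \<sigma>"
  shows "L2_inner P (step_integral b n \<tau> c) (step_integral b m \<sigma> d) =
    L2_inner (restrict_space lborel {0..t}) (step_function n \<tau> c) (step_function m \<sigma> d)"
proof -
  have "L2_inner P (step_integral b n \<tau> c) (step_integral b m \<sigma> d) = (\<Sum>i<n. \<Sum>j<m. c i * d j *
      L2_inner P (\<lambda>\<omega>. b (\<tau> (Suc i)) \<omega> - b (\<tau> i) \<omega>) (\<lambda>\<omega>. b (\<sigma> (Suc j)) \<omega> - b (\<sigma> j) \<omega>))"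
    unfolding step_integral_def[abs_def] using assms
    by (intro L2_inner_sum_sum L2_increment partition_range(1)[of t n \<tau>] partition_range(1)[of t m \<sigma>]) auto
  also have "\<dots> = (\<Sum>i<n. \<Sum>j<m. c i * d j *
      L2_inner (restrict_space lborel {0..t}) (indicator {\<tau> i<..\<tau> (Suc i)}) (indicator {\<sigma> j<..\<sigma> (Suc j)}))"
    using partition_range[OF assms(1)] partition_range[OF assms(2)]
      partition_mono[OF assms(1)] partition_mono[OF assms(2)]
    by (intro sum.cong refl arg_cong2[where f = times] increment_inner) auto
  also have "\<dots> = L2_inner (restrict_space lborel {0..t}) (step_function n \<tau> c) (step_function m \<sigma> d)"
    unfolding step_function_def[abs_def] by (intro L2_inner_sum_sum[symmetric] L2_indicator_interval)
  finally show ?thesis .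
qed

lemma sqnorm_step_integral_diff:
  assumes "time_partition t n \<tau>" "time_partition t m \<sigma>"
  shows "sqnorm P (\<lambda>\<omega>. step_integral b n \<tau> c \<omega> - step_integral b m \<sigma> d \<omega>) =
    sqnorm (restrict_space lborel {0..t}) (\<lambda>r. step_function n \<tau> c r - step_function m \<sigma> d r)"
  using assms by (simp add: sqnorm_diff_L2_inner L2_step_integral L2_step_function step_integral_inner)

lemma sqnorm_step_integral:
  assumes "time_partition t n \<tau>"
  shows "sqnorm P (step_integral b n \<tau> c) = sqnorm (restrict_space lborel {0..t}) (step_function n \<tau> c)"
  using sqnorm_step_integral_diff[OF assms assms, of c "\<lambda>_. 0"]
  by (simp add: step_integral_def[abs_def] step_function_def[abs_def])

end

section \<open>Convolution of a smooth kernel with a Brownian path\<close>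

locale smooth_kernel =
  fixes k k' :: "real \<Rightarrow> real"
  assumes kernel_deriv: "\<And>r. (k has_real_derivative k' r) (at r)"
    and kernel_deriv_continuous: "continuous_on UNIV k'"
begin

lemma kernel_continuous: "continuous_on UNIV k"
  using kernel_deriv by (auto intro!: DERIV_continuous_on[where D = k'])

lemma kernel_measurable [measurable]: "k \<in> borel_measurable borel"
  using kernel_continuous by (rule borel_measurable_continuous_onI)

end

locale brownian_convolution = continuous_brownian P b + smooth_kernel k k'
  for P :: "'w measure" and b k k'
begin

abbreviation convolution :: "real \<Rightarrow> 'w \<Rightarrow> real" where
  "convolution t \<omega> \<equiv> path_integral k k' (\<lambda>r. b r \<omega>) t"

lemma riemann_sum_convolution_LIMSEQ:
  "0 \<le> t \<Longrightarrow> (\<lambda>n. riemann_sum k (\<lambda>r. b r \<omega>) t (Suc n)) \<longlonglongrightarrow> convolution t \<omega>"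
  by (intro LIMSEQ_Suc riemann_sum_LIMSEQ kernel_deriv kernel_deriv_continuous b_continuous b_0)

text \<open>Riemann sums converge at every outcome and time, so it suffices that \<open>b\<close> is
  jointly measurable. This follows in turn from the continuity of its paths, by rounding the time to
  a grid.\<close>

lemma convolution_jointly_measurable:
  "(\<lambda>z. convolution (snd z) (fst z)) \<in> borel_measurable (P \<Otimes>\<^sub>M restrict_space lborel {0..T})"
proof (rule borel_measurable_LIMSEQ_real)
  fix z assume "z \<in> space (P \<Otimes>\<^sub>M restrict_space lborel {0..T})"
  then have "0 \<le> snd z"
    by (auto simp: space_pair_measure space_restrict_space)
  then show "(\<lambda>n. riemann_sum k (\<lambda>r. b r (fst z)) (snd z) (Suc n)) \<longlonglongrightarrow> convolution (snd z) (fst z)"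
    by (rule riemann_sum_convolution_LIMSEQ)
next
  fix n
  \<comment> \<open>The rounded time takes only countably many values, so measurability at each
    fixed time is enough.\<close>
  have grid: "(\<lambda>z. b (of_int \<lfloor>real n * snd z\<rfloor> / real n) (fst z)) \<in> borel_measurable (P \<Otimes>\<^sub>M borel)" for n
    by (rule measurable_compose_countable[where f = "\<lambda>i z. b (of_int i / real n) (fst z)"]) measurable
  have b_joint [measurable]: "(\<lambda>z. b (snd z) (fst z)) \<in> borel_measurable (P \<Otimes>\<^sub>M borel)"
  proof (rule borel_measurable_LIMSEQ_real[OF _ grid])
    fix z :: "'w \<times> real"
    have "(\<lambda>n. of_int \<lfloor>real n * snd z\<rfloor> / real n) \<longlonglongrightarrow> snd z"
      by (rule floor_over_LIMSEQ)
    moreover have "isCont (\<lambda>t. b t (fst z)) (snd z)"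
      using b_continuous by (simp add: continuous_on_eq_continuous_at)
    ultimately show "(\<lambda>n. b (of_int \<lfloor>real n * snd z\<rfloor> / real n) (fst z)) \<longlonglongrightarrow> b (snd z) (fst z)"
      by (rule isCont_tendsto_compose[rotated])
  qed
  have b_comp [measurable]: "(\<lambda>z. b (g z) (fst z)) \<in> borel_measurable (P \<Otimes>\<^sub>M restrict_space lborel {0..T})"
    if [measurable]: "g \<in> borel_measurable (P \<Otimes>\<^sub>M restrict_space lborel {0..T})" for g
    using measurable_compose[OF _ b_joint, of "\<lambda>z. (fst z, g z)" "P \<Otimes>\<^sub>M restrict_space lborel {0..T}"] by simp
  have [measurable]: "snd \<in> borel_measurable (P \<Otimes>\<^sub>M restrict_space lborel {0..T})"
    by (intro measurable_compose[OF measurable_snd] measurable_restrict_space1) auto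
  show "(\<lambda>z. riemann_sum k (\<lambda>r. b r (fst z)) (snd z) (Suc n)) \<in> borel_measurable (P \<Otimes>\<^sub>M restrict_space lborel {0..T})"
    unfolding riemann_sum_def by measurable
qed

lemma riemann_sum_measurable [measurable]: "(\<lambda>\<omega>. riemann_sum k (\<lambda>r. b r \<omega>) t n) \<in> borel_measurable P"
  unfolding riemann_sum_def by measurable

lemma convolution_measurable: "0 \<le> t \<Longrightarrow> convolution t \<in> borel_measurable P"
  by (rule borel_measurable_LIMSEQ_real[OF riemann_sum_convolution_LIMSEQ riemann_sum_measurable])

lemma kernel_L2: "(\<lambda>r. k (t - r)) \<in> L2 (restrict_space lborel {0..t})"
proof -
  have "continuous_on {0..t} k"
    using kernel_continuous by (rule continuous_on_subset) simp
  then obtain K where K: "\<And>r. r \<in> {0..t} \<Longrightarrow> \<bar>k r\<bar> \<le> K"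
    using continuous_on_interval_bounded by metis
  show ?thesis
    by (rule L2_bounded[OF finite_measure_interval, where C = K])
      (auto intro!: measurable_restrict_space1 AE_I2 K simp: space_restrict_space)
qed

lemma sqnorm_convolution_le:
  assumes "0 \<le> t"
  shows "sqnorm P (convolution t) \<le> 2 * sqnorm (restrict_space lborel {0..t}) (\<lambda>r. k (t - r))"
    (is "_ \<le> 2 * sqnorm ?I ?k")
proof (rule ennreal_le_epsilon)
  fix \<epsilon> :: real assume "0 < \<epsilon>"
  let ?f = "\<lambda>n. step_function (Suc n) (uniform_partition t (Suc n)) (\<lambda>i. k (t - uniform_partition t (Suc n) i))"
  have "\<forall>\<^sub>F n in sequentially. sqnorm ?I (\<lambda>r. ?f n r - ?k r) < ennreal (\<epsilon> / 2)"
    using riemann_step_function_tendsto[OF kernel_continuous assms]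
    by (rule order_tendstoD) (use \<open>0 < \<epsilon>\<close> in simp)
  then have "\<forall>\<^sub>F n in sequentially. sqnorm P (\<lambda>\<omega>. riemann_sum k (\<lambda>r. b r \<omega>) t (Suc n)) \<le> 2 * sqnorm ?I ?k + ennreal \<epsilon>"
  proof eventually_elim
    case (elim n)
    have "sqnorm P (\<lambda>\<omega>. riemann_sum k (\<lambda>r. b r \<omega>) t (Suc n)) = sqnorm ?I (?f n)"
      unfolding riemann_sum_eq_step_integral by (intro sqnorm_step_integral partition_uniform assms) simp
    \<comment> \<open>The factor 2 of the final bound stems from this comparison of the step
      function with the kernel.\<close>
    also have "\<dots> \<le> 2 * sqnorm ?I (\<lambda>r. ?f n r - ?k r) + 2 * sqnorm ?I ?k"
      using L2_step_function kernel_L2 by (intro sqnorm_le_diff) (auto simp: L2_iff_sqnorm)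
    also have "\<dots> \<le> 2 * ennreal (\<epsilon> / 2) + 2 * sqnorm ?I ?k"
      using elim by (intro add_mono mult_left_mono) auto
    also have "2 * ennreal (\<epsilon> / 2) = ennreal \<epsilon>"
      using \<open>0 < \<epsilon>\<close> by (simp add: mult_2 ennreal_plus[symmetric] del: ennreal_plus)
    finally show ?case
      by (simp add: add.commute)
  qed
  then show "sqnorm P (convolution t) \<le> 2 * sqnorm ?I ?k + ennreal \<epsilon>"
    by (rule sqnorm_LIMSEQ_le[rotated 2]) (use riemann_sum_convolution_LIMSEQ[OF assms] in auto)
qed

text \<open>The given approximations of \<open>X\<close> and the Riemann sums are both integrals of
  step functions, up to null sets. The isometry equates their distance with that of the two step
  functions, and these tend to the same kernel; hence the Riemann sums converge to \<open>X\<close>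
  in mean square. They also converge for every path, and Fatou's lemma identifies the two
  limits.\<close>

lemma wiener_integral_eq_convolution:
  assumes "0 \<le> t" and B: "\<And>t. 0 \<le> t \<Longrightarrow> AE \<omega> in P. b t \<omega> = B t \<omega>"
    and X: "has_wiener_integral P B t (\<lambda>r. k (t - r)) X"
  shows "AE \<omega> in P. X \<omega> = convolution t \<omega>"
proof -
  let ?I = "restrict_space lborel {0..t}" and ?k = "\<lambda>r. k (t - r)"
  from X obtain f' X' where *: "(\<forall>n. elementary_wiener_integral B t (f' n) (X' n)) \<and>
      L2_tendsto ?I f' ?k sequentially \<and> L2_tendsto P X' X sequentially"
    unfolding has_wiener_integral_def by (elim exE)
  then have el: "elementary_wiener_integral B t (f' n) (X' n)" for n
    by simp
  from * have f': "L2_tendsto ?I f' ?k sequentially" and X': "L2_tendsto P X' X sequentially"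
    by simp_all
  have [measurable]: "X \<in> borel_measurable P"
    using X' by (simp add: L2_tendsto_def L2_def)
  obtain N \<tau> c where part: "\<And>n. time_partition t (N n) (\<tau> n)"
    and f'_eq: "\<And>n. f' n = step_function (N n) (\<tau> n) (c n)" and X'_eq: "\<And>n. X' n = step_integral B (N n) (\<tau> n) (c n)"
    using el unfolding elementary_wiener_integral_iff by metis
  let ?R = "\<lambda>n \<omega>. riemann_sum k (\<lambda>r. b r \<omega>) t (Suc n)"
  let ?f = "\<lambda>n. step_function (Suc n) (uniform_partition t (Suc n)) (\<lambda>i. k (t - uniform_partition t (Suc n) i))"
  let ?X = "\<lambda>n. step_integral b (N n) (\<tau> n) (c n)"
  \<comment> \<open>The given step integrals are driven by \<open>B\<close>; each involves only
    finitely many times, so replacing \<open>B\<close> by \<open>b\<close> costs a null set.\<close>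
  have X_eq: "AE \<omega> in P. X' n \<omega> = ?X n \<omega>" for n
  proof -
    have "AE \<omega> in P. \<forall>i\<in>{..N n}. b (\<tau> n i) \<omega> = B (\<tau> n i) \<omega>"
      by (intro AE_finite_allI B partition_range[OF part]) auto
    then show ?thesis
      by eventually_elim (simp add: X'_eq step_integral_def)
  qed
  have meas [measurable]: "?X n \<in> borel_measurable P" "f' n \<in> borel_measurable ?I" "?f n \<in> borel_measurable ?I"
    "?k \<in> borel_measurable ?I" for n
    using L2_step_integral[OF part] L2_step_function kernel_L2 by (auto simp: L2_iff_sqnorm f'_eq)
  \<comment> \<open>The nested factors 2 record two uses of the substitute triangle inequality: once
    among the random variables, once among the step functions after applying the isometry.\<close>
  define \<epsilon> where "\<epsilon> n = 2 * sqnorm P (\<lambda>\<omega>. X' n \<omega> - X \<omega>) +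
    2 * (2 * sqnorm ?I (\<lambda>r. f' n r - ?k r) + 2 * sqnorm ?I (\<lambda>r. ?f n r - ?k r))" for n
  have "\<epsilon> \<longlonglongrightarrow> 2 * 0 + 2 * (2 * 0 + 2 * 0)"
    unfolding \<epsilon>_def[abs_def] using X' f' riemann_step_function_tendsto[OF kernel_continuous assms(1)]
    by (intro tendsto_add ennreal_tendsto_cmult) (auto simp: L2_tendsto_iff_sqnorm)
  then have \<epsilon>: "\<epsilon> \<longlonglongrightarrow> 0"
    by simp
  have bound: "sqnorm P (\<lambda>\<omega>. X \<omega> - ?R n \<omega>) \<le> \<epsilon> n" for n
  proof -
    have "sqnorm P (\<lambda>\<omega>. X \<omega> - ?R n \<omega>) \<le> 2 * sqnorm P (\<lambda>\<omega>. X \<omega> - ?X n \<omega>) + 2 * sqnorm P (\<lambda>\<omega>. ?X n \<omega> - ?R n \<omega>)"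
      by (rule sqnorm_diff_triangle_le) measurable
    also have "sqnorm P (\<lambda>\<omega>. X \<omega> - ?X n \<omega>) = sqnorm P (\<lambda>\<omega>. X' n \<omega> - X \<omega>)"
      unfolding sqnorm_def using X_eq[of n]
      by (intro nn_integral_cong_AE) (auto simp: power2_commute)
    also have "sqnorm P (\<lambda>\<omega>. ?X n \<omega> - ?R n \<omega>) = sqnorm ?I (\<lambda>r. f' n r - ?f n r)"
      unfolding riemann_sum_eq_step_integral f'_eq
      by (intro sqnorm_step_integral_diff part partition_uniform assms(1)) simp
    also have "\<dots> \<le> 2 * sqnorm ?I (\<lambda>r. f' n r - ?k r) + 2 * sqnorm ?I (\<lambda>r. ?k r - ?f n r)"
      by (rule sqnorm_diff_triangle_le) measurable
    finally show ?thesis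
      by (simp add: \<epsilon>_def sqnorm_minus_commute[of _ ?k] add_left_mono mult_left_mono)
  qed
  have "sqnorm P (\<lambda>\<omega>. X \<omega> - convolution t \<omega>) \<le> 0"
  proof (rule ennreal_le_epsilon)
    fix \<delta> :: real assume "0 < \<delta>"
    then have "\<forall>\<^sub>F n in sequentially. \<epsilon> n < ennreal \<delta>"
      by (intro order_tendstoD[OF \<epsilon>]) simp
    then have "\<forall>\<^sub>F n in sequentially. sqnorm P (\<lambda>\<omega>. X \<omega> - ?R n \<omega>) \<le> ennreal \<delta>"
      by eventually_elim (use bound in \<open>auto intro: order.trans less_imp_le\<close>)
    then have "sqnorm P (\<lambda>\<omega>. X \<omega> - convolution t \<omega>) \<le> ennreal \<delta>"
      by (rule sqnorm_LIMSEQ_le[rotated 2])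
        (use riemann_sum_convolution_LIMSEQ[OF assms(1)] in \<open>auto intro!: tendsto_diff\<close>)
    then show "sqnorm P (\<lambda>\<omega>. X \<omega> - convolution t \<omega>) \<le> 0 + ennreal \<delta>"
      by simp
  qed
  moreover have [measurable]: "convolution t \<in> borel_measurable P"
    using assms(1) by (rule convolution_measurable)
  ultimately have "AE \<omega> in P. ennreal ((X \<omega> - convolution t \<omega>)\<^sup>2) = 0"
    by (simp add: sqnorm_def nn_integral_0_iff_AE)
  then show ?thesis
    by eventually_elim simp
qed

end

section \<open>Derivatives of the semigroup in the fractional parameter\<close>

text \<open>
  With \<open>l = ln \<lambda>\<close> and \<open>x = exp (s * l) * r\<close>, i.e. $x = \lambda^s r$, the $n$-th derivative of $e^{-x}$ in
  $s$ is $l^n p_n(x) e^{-x}$, where $p_{n+1}(x) = x (p_n'(x) - p_n(x))$ because $\partial_s x = l x$.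
\<close>

fun deriv_poly :: "nat \<Rightarrow> real poly" where
  "deriv_poly 0 = 1"
| "deriv_poly (Suc n) = [:0, 1:] * (pderiv (deriv_poly n) - deriv_poly n)"

definition kernel :: "nat \<Rightarrow> real \<Rightarrow> real \<Rightarrow> real \<Rightarrow> real" where
  "kernel n l s r = l ^ n * poly (deriv_poly n) (exp (s * l) * r) * exp (- (exp (s * l) * r))"

text \<open>The polynomial p_n' - p_n is the quotient of p_(n+1) by x. Differentiation in
  \<open>r\<close> brings down the inner derivative \<open>exp (s * l)\<close> where differentiation
  in \<open>s\<close> brings down \<open>l\<close> times x.\<close>

definition kernel_dr :: "nat \<Rightarrow> real \<Rightarrow> real \<Rightarrow> real \<Rightarrow> real" where
  "kernel_dr n l s r = l ^ n * exp (s * l) *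
    poly (pderiv (deriv_poly n) - deriv_poly n) (exp (s * l) * r) * exp (- (exp (s * l) * r))"

lemma kernel_0: "kernel 0 l s r = exp (- (exp (s * l) * r))"
  by (simp add: kernel_def)

lemma has_real_derivative_poly_exp:
  fixes g :: "real \<Rightarrow> real"
  assumes "(g has_real_derivative g') (at x within S)"
  shows "((\<lambda>x. poly p (g x) * exp (- g x)) has_real_derivative
    poly (pderiv p - p) (g x) * exp (- g x) * g') (at x within S)"
proof -
  have "((\<lambda>x. poly p (g x)) has_real_derivative poly (pderiv p) (g x) * g') (at x within S)"
    by (rule DERIV_chain2[OF poly_DERIV assms])
  moreover have "((\<lambda>x. exp (- g x)) has_real_derivative exp (- g x) * - g') (at x within S)"
    by (rule DERIV_chain2[OF DERIV_exp DERIV_minus[OF assms]])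
  ultimately show ?thesis
    by (rule DERIV_cong[OF DERIV_mult]) (simp add: algebra_simps)
qed

lemma kernel_deriv_r: "(kernel n l s has_real_derivative kernel_dr n l s r) (at r)"
proof -
  have "((\<lambda>r. exp (s * l) * r) has_real_derivative exp (s * l)) (at r)"
    by (auto intro!: derivative_eq_intros)
  from DERIV_cmult[OF has_real_derivative_poly_exp[OF this, of "deriv_poly n"], of "l ^ n"]
  show ?thesis
    unfolding kernel_def[abs_def] kernel_dr_def by (simp add: mult_ac)
qed

lemma exp_mult_has_derivative:
  "((\<lambda>s. exp (s * l) * r) has_real_derivative exp (s * l) * r * l) (at s within S)"
  by (auto intro!: derivative_eq_intros)

lemma kernel_deriv_s:
  "((\<lambda>s. kernel n l s r) has_real_derivative kernel (Suc n) l s r) (at s within S)"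
  using DERIV_cmult[OF has_real_derivative_poly_exp[OF exp_mult_has_derivative], of "l ^ n" "deriv_poly n" l r s S]
  unfolding kernel_def by (simp add: mult_ac)

text \<open>Mixed derivatives commute: with q = p_n' - p_n and p_(n+1) = x q, both orders produce
  the polynomial q + x q' - x q.\<close>

lemma kernel_dr_deriv_s:
  "((\<lambda>s. kernel_dr n l s r) has_real_derivative kernel_dr (Suc n) l s r) (at s within S)"
proof -
  let ?q = "pderiv (deriv_poly n) - deriv_poly n"
  have "((\<lambda>s. exp (s * l)) has_real_derivative exp (s * l) * l) (at s within S)"
    using exp_mult_has_derivative[of l 1] by simp
  from DERIV_mult[OF this has_real_derivative_poly_exp[OF exp_mult_has_derivative], of ?q l r]
  show ?thesis
    unfolding kernel_dr_def mult.assoc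
    by (rule DERIV_cong[OF DERIV_cmult]) (simp add: pderiv_mult pderiv_diff pderiv_pCons algebra_simps)
qed

lemma continuous_on_kernel_dr [continuous_intros]:
  assumes "continuous_on S f" "continuous_on S g"
  shows "continuous_on S (\<lambda>x. kernel_dr n l (f x) (g x))"
  unfolding kernel_dr_def using assms by (intro continuous_intros)

lemma smooth_kernel_kernel: "smooth_kernel (kernel n l s) (kernel_dr n l s)"
  by unfold_locales (auto intro!: kernel_deriv_r continuous_intros)

text \<open>For one fixed continuous path this is differentiation under the integral sign over a
  compact interval; it turns the n-th kernel into the next one.\<close>

lemma path_integral_kernel_deriv:
  fixes \<beta> :: "real \<Rightarrow> real"
  assumes \<beta>: "continuous_on UNIV \<beta>"
  shows "((\<lambda>s. path_integral (kernel n l s) (kernel_dr n l s) \<beta> t) has_real_derivative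
    path_integral (kernel (Suc n) l s) (kernel_dr (Suc n) l s) \<beta> t) (at s)"
proof -
  have cont [continuous_intros]: "continuous_on S (\<lambda>x. \<beta> (f x))" if "continuous_on S f" for S and f :: "'x::topological_space \<Rightarrow> real"
    by (rule continuous_on_compose2[OF \<beta> that]) simp
  have "((\<lambda>s. integral (cbox 0 t) (\<lambda>r. kernel_dr n l s (t - r) * \<beta> r)) has_real_derivative
      integral (cbox 0 t) (\<lambda>r. kernel_dr (Suc n) l s (t - r) * \<beta> r)) (at s)"
  proof (rule leibniz_rule_field_derivative[where U = UNIV])
    show "((\<lambda>s. kernel_dr n l s (t - r) * \<beta> r) has_real_derivative kernel_dr (Suc n) l s (t - r) * \<beta> r) (at s)" for s r
      by (rule DERIV_cmult_right[OF kernel_dr_deriv_s])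
    show "(\<lambda>r. kernel_dr n l s (t - r) * \<beta> r) integrable_on cbox 0 t" for s
      by (intro integrable_continuous continuous_intros)
    show "continuous_on (UNIV \<times> cbox 0 t) (\<lambda>(s, r). kernel_dr (Suc n) l s (t - r) * \<beta> r)"
      unfolding split_beta by (intro continuous_intros)
  qed auto
  then show ?thesis
    unfolding path_integral_def
    by (intro DERIV_add DERIV_cmult_right kernel_deriv_s) (simp add: cbox_interval)
qed

text \<open>Induction on the coefficients with \<open>c\<close> arbitrary: half of the exponential
  absorbs the new factor x, through x exp(-c x / 2) <= 2 / c, and the other half is left to the
  induction hypothesis.\<close>

lemma poly_times_exp_bounded:
  assumes "0 < c"
  shows "\<exists>C. \<forall>x\<ge>0. \<bar>poly p x\<bar> * exp (- (c * x)) \<le> (C::real)"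
  using assms
proof (induction p arbitrary: c)
  case (pCons a p)
  then obtain C where C: "\<And>x. 0 \<le> x \<Longrightarrow> \<bar>poly p x\<bar> * exp (- (c / 2 * x)) \<le> C"
    by (metis half_gt_zero)
  have "\<bar>poly (pCons a p) x\<bar> * exp (- (c * x)) \<le> \<bar>a\<bar> + 2 / c * C" if "0 \<le> x" for x
  proof -
    have "c / 2 * x \<le> exp (c / 2 * x)"
      using exp_ge_add_one_self[of "c / 2 * x"] by linarith
    then have "c / 2 * x * exp (- (c / 2 * x)) \<le> exp (c / 2 * x) * exp (- (c / 2 * x))"
      by (rule mult_right_mono) simp
    also have "\<dots> = 1"
      by (simp add: exp_minus)
    finally have "x * exp (- (c / 2 * x)) \<le> 2 / c"
      using pCons.prems by (simp add: pos_le_divide_eq mult_ac)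
    then have "x * exp (- (c / 2 * x)) * (\<bar>poly p x\<bar> * exp (- (c / 2 * x))) \<le> 2 / c * C"
      using that C[OF that] pCons.prems by (intro mult_mono) auto
    moreover have "exp (- (c * x)) = exp (- (c / 2 * x)) * exp (- (c / 2 * x))"
      by (simp add: exp_add[symmetric])
    ultimately have "x * \<bar>poly p x\<bar> * exp (- (c * x)) \<le> 2 / c * C"
      by (simp add: mult_ac)
    moreover have "\<bar>a\<bar> * exp (- (c * x)) \<le> \<bar>a\<bar> * 1"
      using that pCons.prems by (intro mult_left_mono) auto
    moreover have "\<bar>poly (pCons a p) x\<bar> \<le> \<bar>a\<bar> + x * \<bar>poly p x\<bar>"
      using that abs_triangle_ineq[of a "x * poly p x"] by (simp add: abs_mult)
    then have "\<bar>poly (pCons a p) x\<bar> * exp (- (c * x)) \<le> (\<bar>a\<bar> + x * \<bar>poly p x\<bar>) * exp (- (c * x))"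
      by (rule mult_right_mono) simp
    ultimately show ?thesis
      by (simp add: algebra_simps)
  qed
  then show ?case
    by blast
qed (auto intro: exI[of _ 0])

text \<open>
  Since $x^{1/2} p(x)^2 e^{-2x}$ is bounded, $(\partial_s^n e^{-\lambda^s r})^2 \le C (\ln \lambda)^{2n} \lambda^{-s/2} r^{-1/2}$,
  and the growth of the logarithm is absorbed by the negative power of \<open>\<lambda>\<close>.
\<close>

lemma kernel_bound:
  assumes "0 < s"
  shows "\<exists>M\<ge>0. \<forall>l\<ge>l0. \<forall>\<sigma>\<in>{s / 2..2 * s}. \<forall>r>0. (kernel n l \<sigma> r)\<^sup>2 \<le> M * r powr (- 1 / 2)"
proof -
  \<comment> \<open>The factor 1 + x dominates x^(1/2) and keeps the bounded expression
    polynomial.\<close>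
  obtain C where C: "\<And>x. 0 \<le> x \<Longrightarrow> \<bar>poly ([:1, 1:] * deriv_poly n ^ 2) x\<bar> * exp (- (2 * x)) \<le> C"
    using poly_times_exp_bounded[of 2] by (metis zero_less_numeral)
  \<comment> \<open>The rate s / 4 arises from lambda^(-sigma / 2) with sigma >= s / 2.\<close>
  obtain K where K: "\<And>l. 0 \<le> l \<Longrightarrow> \<bar>poly (monom 1 (2 * n)) l\<bar> * exp (- (s / 4 * l)) \<le> K"
    using poly_times_exp_bounded[of "s / 4"] assms by (metis divide_pos_pos zero_less_numeral)
  \<comment> \<open>The second summand covers negative logarithms: there |l| <= |l0| and sigma <= 2
    s, so lambda^(-sigma / 2) is at most exp(s |l0|).\<close>
  define K' where "K' = K + \<bar>l0\<bar> ^ (2 * n) * exp (s * \<bar>l0\<bar>)"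
  have C_nonneg: "0 \<le> C"
    using C[of 0] by (auto intro: order.trans[rotated])
  have K_nonneg: "0 \<le> K"
    using K[of 0] by (rule order.trans[rotated]) auto
  have x_bound: "(poly (deriv_poly n) x * exp (- x))\<^sup>2 \<le> C * x powr (- 1 / 2)" if "0 < x" for x
  proof -
    have "x powr (1 / 2) \<le> 1 + x"
      using that by (simp add: powr_half_sqrt real_le_lsqrt power2_eq_square algebra_simps)
    moreover have "(poly (deriv_poly n) x * exp (- x))\<^sup>2 = (poly (deriv_poly n) x)\<^sup>2 * exp (- (2 * x))"
      by (simp add: power_mult_distrib exp_double[symmetric])
    ultimately have "x powr (1 / 2) * (poly (deriv_poly n) x * exp (- x))\<^sup>2
        \<le> (1 + x) * ((poly (deriv_poly n) x)\<^sup>2 * exp (- (2 * x)))"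
      by (simp add: mult_right_mono)
    also have "\<dots> \<le> C"
      using C[of x] that by (simp add: abs_mult mult_ac power2_eq_square algebra_simps)
    finally show ?thesis
      using that by (simp add: powr_minus_divide field_simps)
  qed
  have l_bound: "l ^ (2 * n) * exp (\<sigma> * l) powr (- 1 / 2) \<le> K'" if "l0 \<le> l" "\<sigma> \<in> {s / 2..2 * s}" for l \<sigma>
  proof (cases "0 \<le> l")
    case True
    have "s / 2 * l \<le> \<sigma> * l"
      using that True by (intro mult_right_mono) auto
    then have "exp (\<sigma> * l) powr (- 1 / 2) \<le> exp (- (s / 4 * l))"
      by (simp add: powr_def mult.commute mult.left_commute)
    then have "l ^ (2 * n) * exp (\<sigma> * l) powr (- 1 / 2) \<le> l ^ (2 * n) * exp (- (s / 4 * l))"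
      using True by (intro mult_left_mono) auto
    also have "\<dots> \<le> K"
      using K[OF True] True by (simp add: poly_monom)
    also have "\<dots> \<le> K'"
      by (simp add: K'_def)
    finally show ?thesis .
  next
    case False
    have "\<sigma> * (- l) \<le> (2 * s) * \<bar>l0\<bar>"
      using that False assms by (intro mult_mono) auto
    then have "exp (\<sigma> * l) powr (- 1 / 2) \<le> exp (s * \<bar>l0\<bar>)"
      by (simp add: powr_def)
    moreover have "\<bar>l\<bar> ^ (2 * n) \<le> \<bar>l0\<bar> ^ (2 * n)"
      using that False by (intro power_mono) auto
    ultimately have "l ^ (2 * n) * exp (\<sigma> * l) powr (- 1 / 2) \<le> \<bar>l0\<bar> ^ (2 * n) * exp (s * \<bar>l0\<bar>)"
      by (intro mult_mono) (auto simp: power_even_abs)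
    then show ?thesis
      using K_nonneg by (simp add: K'_def)
  qed
  have "(kernel n l \<sigma> r)\<^sup>2 \<le> K' * C * r powr (- 1 / 2)" if "l0 \<le> l" "\<sigma> \<in> {s / 2..2 * s}" "0 < r" for l \<sigma> r
  proof -
    have "(kernel n l \<sigma> r)\<^sup>2 = l ^ (2 * n) * (poly (deriv_poly n) (exp (\<sigma> * l) * r) * exp (- (exp (\<sigma> * l) * r)))\<^sup>2"
      by (simp add: kernel_def power_mult_distrib power_mult[symmetric] mult_ac)
    also have "\<dots> \<le> l ^ (2 * n) * (C * (exp (\<sigma> * l) * r) powr (- 1 / 2))"
      using that by (intro mult_left_mono x_bound) auto
    also have "\<dots> = (l ^ (2 * n) * exp (\<sigma> * l) powr (- 1 / 2)) * (C * r powr (- 1 / 2))"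
      using that by (simp add: powr_mult mult_ac)
    also have "\<dots> \<le> K' * (C * r powr (- 1 / 2))"
      using that C_nonneg by (intro mult_right_mono l_bound) auto
    finally show ?thesis
      by (simp add: mult_ac)
  qed
  moreover have "0 \<le> K' * C"
    using K_nonneg C_nonneg by (simp add: K'_def)
  ultimately show ?thesis
    by blast
qed

text \<open>Two mean value theorems: the quotient equals f'(z) for some z between s and s + h, and
  f'(z) - f'(s) = (z - s) f''(w) with |z - s| <= |h|.\<close>

lemma difference_quotient_error:
  fixes f f' f'' :: "real \<Rightarrow> real"
  assumes f: "\<And>x. (f has_real_derivative f' x) (at x)" and f': "\<And>x. (f' has_real_derivative f'' x) (at x)"
    and bound: "\<And>x. x \<in> {min s (s + h)..max s (s + h)} \<Longrightarrow> (f'' x)\<^sup>2 \<le> K"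
    and "h \<noteq> 0"
  shows "((f (s + h) - f s) / h - f' s)\<^sup>2 \<le> h\<^sup>2 * K"
proof -
  \<comment> \<open>The increment \<open>h\<close> may have either sign, so the theorem is put into
    a form symmetric in the end points.\<close>
  have mvt: "\<exists>z. z \<in> {min a b..max a b} \<and> g b - g a = (b - a) * g' z"
    if "\<And>x. (g has_real_derivative g' x) (at x)" "a \<noteq> b" for g g' :: "real \<Rightarrow> real" and a b
  proof (cases "a < b")
    case True
    then have "\<exists>z>a. z < b \<and> g b - g a = (b - a) * g' z"
      by (rule MVT2) (rule that(1))
    then obtain z where "a < z" "z < b" "g b - g a = (b - a) * g' z"
      by (elim exE conjE)
    then show ?thesis
      by (intro exI[of _ z]) auto
  next
    case False
    then have "b < a"
      using that(2) by simp
    then have "\<exists>z>b. z < a \<and> g a - g b = (a - b) * g' z"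
      by (rule MVT2) (rule that(1))
    then obtain z where "b < z" "z < a" "g a - g b = (a - b) * g' z"
      by (elim exE conjE)
    then show ?thesis
      by (intro exI[of _ z]) (auto simp: algebra_simps)
  qed
  obtain z where z: "z \<in> {min s (s + h)..max s (s + h)}" "f (s + h) - f s = h * f' z"
    using mvt[OF f, of s "s + h"] \<open>h \<noteq> 0\<close> by auto
  then have eq: "(f (s + h) - f s) / h - f' s = f' z - f' s"
    using \<open>h \<noteq> 0\<close> by simp
  show ?thesis
  proof (cases "z = s")
    case True
    have "0 \<le> K"
      using bound[of s] by (rule order.trans[OF zero_le_power2]) auto
    then show ?thesis
      by (simp add: eq True)
  next
    case False
    obtain w where w: "w \<in> {min s z..max s z}" "f' z - f' s = (z - s) * f'' w"
      using mvt[OF f', of s z] False by auto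
    have "((z - s) * f'' w)\<^sup>2 \<le> h\<^sup>2 * K"
      unfolding power_mult_distrib using z(1) w(1)
      by (intro mult_mono bound) (auto simp: abs_le_square_iff[symmetric])
    then show ?thesis
      by (simp add: eq w(2))
  qed
qed

lemma nn_integral_powr_minus_half_less_top:
  assumes "0 < T"
  shows "(\<integral>\<^sup>+ r. ennreal (r powr (- 1 / 2)) \<partial>restrict_space lborel {0..T}) < \<top>"
proof -
  have "((\<lambda>r. r powr (- 1 / 2)) has_integral T powr (- 1 / 2 + 1) / (- 1 / 2 + 1)) {0..T}"
    using assms by (intro has_integral_powr_from_0) auto
  then have "(\<integral>\<^sup>+ r. ennreal (r powr (- 1 / 2)) * indicator {0..T} r \<partial>lborel) = ennreal (T powr (- 1 / 2 + 1) / (- 1 / 2 + 1))"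
    by (intro nn_integral_has_integral_lebesgue') auto
  then show ?thesis
    by (simp add: nn_integral_restrict_space)
qed

section \<open>Orthogonal series with random time-dependent coefficients\<close>

locale orthonormal_system =
  fixes P :: "'w measure" and M :: "'a measure" and R :: "'t measure" and e :: "nat \<Rightarrow> 'a \<Rightarrow> real"
  assumes finite_P: "finite_measure P" and finite_M: "finite_measure M" and finite_R: "finite_measure R"
    and e_L2: "\<And>j. e j \<in> L2 M"
    and e_inner: "\<And>i j. L2_inner M (e i) (e j) = (if i = j then 1 else 0)"
begin

sublocale P: finite_measure P by (rule finite_P)
sublocale M: finite_measure M by (rule finite_M)
sublocale R: finite_measure R by (rule finite_R)
sublocale MR: pair_sigma_finite M R ..
sublocale PR: pair_sigma_finite P R ..

lemma finite_MR: "finite_measure (M \<Otimes>\<^sub>M R)"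
  by (rule finite_measure_pair_measure) (rule finite_M finite_R)+

abbreviation "N \<equiv> P \<Otimes>\<^sub>M (M \<Otimes>\<^sub>M R)"

lemma e_measurable [measurable]: "e j \<in> borel_measurable M"
  using e_L2 by (simp add: L2_iff_sqnorm)

lemma sqnorm_orthonormal_sum:
  assumes "finite J"
  shows "sqnorm M (\<lambda>x. \<Sum>j\<in>J. a j * e j x) = ennreal (\<Sum>j\<in>J. (a j)\<^sup>2)"
proof -
  have "sqnorm M (\<lambda>x. \<Sum>j\<in>J. a j * e j x) = ennreal (L2_inner M (\<lambda>x. \<Sum>j\<in>J. a j * e j x) (\<lambda>x. \<Sum>j\<in>J. a j * e j x))"
    by (subst sqnorm_eq_integral) (auto simp: L2_inner_def power2_eq_square intro!: L2_sum L2_cmult e_L2)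
  also have "L2_inner M (\<lambda>x. \<Sum>j\<in>J. a j * e j x) (\<lambda>x. \<Sum>j\<in>J. a j * e j x)
      = (\<Sum>i\<in>J. \<Sum>j\<in>J. a i * a j * L2_inner M (e i) (e j))"
    by (intro L2_inner_sum_sum e_L2)
  also have "\<dots> = (\<Sum>i\<in>J. \<Sum>j\<in>J. if i = j then a i * a j else 0)"
    by (intro sum.cong) (simp_all add: e_inner)
  also have "\<dots> = (\<Sum>j\<in>J. (a j)\<^sup>2)"
    using assms by (simp add: power2_eq_square)
  finally show ?thesis .
qed

text \<open>The order of integration matters later. Space is innermost, so that orthonormality
  applies at a fixed outcome and time; time is outermost, so that null sets of outcomes may depend
  on the time.\<close>

lemma sqnorm_slices:
  assumes [measurable]: "f \<in> borel_measurable N"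
  shows "sqnorm N f = (\<integral>\<^sup>+ t. \<integral>\<^sup>+ \<omega>. sqnorm M (\<lambda>x. f (\<omega>, (x, t))) \<partial>P \<partial>R)"
proof -
  have "sigma_finite_measure (M \<Otimes>\<^sub>M R)"
    using finite_MR by (rule finite_measure.axioms(1))
  then have "sqnorm N f = (\<integral>\<^sup>+ \<omega>. \<integral>\<^sup>+ z. ennreal ((f (\<omega>, z))\<^sup>2) \<partial>(M \<Otimes>\<^sub>M R) \<partial>P)"
    by (subst sqnorm_pair_measure[symmetric]) (simp_all add: sqnorm_def)
  also have "\<dots> = (\<integral>\<^sup>+ \<omega>. \<integral>\<^sup>+ t. \<integral>\<^sup>+ x. ennreal ((f (\<omega>, (x, t)))\<^sup>2) \<partial>M \<partial>R \<partial>P)"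
    by (intro nn_integral_cong MR.nn_integral_snd[symmetric]) measurable
  also have "\<dots> = (\<integral>\<^sup>+ t. \<integral>\<^sup>+ \<omega>. \<integral>\<^sup>+ x. ennreal ((f (\<omega>, (x, t)))\<^sup>2) \<partial>M \<partial>P \<partial>R)"
    by (intro PR.Fubini'[symmetric]) measurable
  finally show ?thesis
    by (simp add: sqnorm_def)
qed

lemma sqnorm_coefficient:
  assumes [measurable]: "g \<in> borel_measurable (P \<Otimes>\<^sub>M R)"
  shows "sqnorm (P \<Otimes>\<^sub>M R) g = (\<integral>\<^sup>+ t. \<integral>\<^sup>+ \<omega>. ennreal ((g (\<omega>, t))\<^sup>2) \<partial>P \<partial>R)"
  unfolding sqnorm_def by (subst PR.nn_integral_snd[symmetric]) measurable

definition series_sum :: "nat set \<Rightarrow> (nat \<Rightarrow> 'w \<times> 't \<Rightarrow> real) \<Rightarrow> 'w \<times> 'a \<times> 't \<Rightarrow> real" where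
  "series_sum J g z = (\<Sum>j\<in>J. g j (fst z, snd (snd z)) * e j (fst (snd z)))"

lemma series_sum_measurable [measurable]:
  assumes [measurable]: "\<And>j. g j \<in> borel_measurable (P \<Otimes>\<^sub>M R)"
  shows "series_sum J g \<in> borel_measurable N"
  unfolding series_sum_def[abs_def] by measurable

lemma sqnorm_series_sum:
  assumes [measurable]: "\<And>j. g j \<in> borel_measurable (P \<Otimes>\<^sub>M R)" and "finite J"
  shows "sqnorm N (series_sum J g) = (\<Sum>j\<in>J. sqnorm (P \<Otimes>\<^sub>M R) (g j))"
proof -
  have "sqnorm N (series_sum J g) = (\<integral>\<^sup>+ t. \<integral>\<^sup>+ \<omega>. (\<Sum>j\<in>J. ennreal ((g j (\<omega>, t))\<^sup>2)) \<partial>P \<partial>R)"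
    by (subst sqnorm_slices) (simp_all add: series_sum_def sqnorm_orthonormal_sum[OF \<open>finite J\<close>] sum_ennreal)
  also have "\<dots> = (\<integral>\<^sup>+ t. (\<Sum>j\<in>J. \<integral>\<^sup>+ \<omega>. ennreal ((g j (\<omega>, t))\<^sup>2) \<partial>P) \<partial>R)"
    by (intro nn_integral_cong nn_integral_sum) measurable
  also have "\<dots> = (\<Sum>j\<in>J. sqnorm (P \<Otimes>\<^sub>M R) (g j))"
    by (subst nn_integral_sum) (measurable, simp add: sqnorm_coefficient)
  finally show ?thesis .
qed

lemma sqnorm_series_sum_le:
  assumes "\<And>j. g j \<in> borel_measurable (P \<Otimes>\<^sub>M R)" "finite J"
    and "\<And>j. sqnorm (P \<Otimes>\<^sub>M R) (g j) \<le> ennreal (w j)" "\<And>j. 0 \<le> w j"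
  shows "sqnorm N (series_sum J g) \<le> ennreal (\<Sum>j\<in>J. w j)"
proof -
  have "sqnorm N (series_sum J g) \<le> (\<Sum>j\<in>J. ennreal (w j))"
    unfolding sqnorm_series_sum[OF assms(1,2)] by (intro sum_mono assms(3))
  then show ?thesis
    using assms(4) by (simp add: sum_ennreal)
qed

lemma series_sum_diff:
  assumes "finite J" "I \<subseteq> J"
  shows "series_sum J g z - series_sum I g z = series_sum (J - I) g z"
  using assms by (simp add: series_sum_def sum_diff)

text \<open>Mean-square convergence on the full product. Square integrability of \<open>X\<close> is
  obtained separately in \<open>series_limit_L2\<close> from summable weights.\<close>

definition series_limit :: "('w \<times> 'a \<times> 't \<Rightarrow> real) \<Rightarrow> (nat \<Rightarrow> 'w \<times> 't \<Rightarrow> real) \<Rightarrow> bool" where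
  "series_limit X g \<longleftrightarrow> X \<in> borel_measurable N \<and> (\<forall>j. g j \<in> borel_measurable (P \<Otimes>\<^sub>M R)) \<and>
     (\<lambda>n. sqnorm N (\<lambda>z. X z - series_sum {..<n} g z)) \<longlonglongrightarrow> 0"

lemma series_limit_add:
  assumes "series_limit X g" "series_limit Y h"
  shows "series_limit (\<lambda>z. X z + Y z) (\<lambda>j z. g j z + h j z)"
proof -
  have [measurable]: "X \<in> borel_measurable N" "Y \<in> borel_measurable N"
    "g j \<in> borel_measurable (P \<Otimes>\<^sub>M R)" "h j \<in> borel_measurable (P \<Otimes>\<^sub>M R)" for j
    using assms by (auto simp: series_limit_def)
  have "(\<lambda>n. 2 * sqnorm N (\<lambda>z. X z - series_sum {..<n} g z) + 2 * sqnorm N (\<lambda>z. Y z - series_sum {..<n} h z))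
      \<longlonglongrightarrow> 2 * 0 + 2 * 0"
    using assms by (intro tendsto_add ennreal_tendsto_cmult) (auto simp: series_limit_def)
  then have lim: "(\<lambda>n. 2 * sqnorm N (\<lambda>z. X z - series_sum {..<n} g z) + 2 * sqnorm N (\<lambda>z. Y z - series_sum {..<n} h z))
      \<longlonglongrightarrow> 0"
    by simp
  have eq: "X z + Y z - series_sum J (\<lambda>j z. g j z + h j z) z = (X z - series_sum J g z) + (Y z - series_sum J h z)" for J z
    by (simp add: series_sum_def distrib_right sum.distrib)
  have "(\<lambda>n. sqnorm N (\<lambda>z. X z + Y z - series_sum {..<n} (\<lambda>j z. g j z + h j z) z)) \<longlonglongrightarrow> 0"
    unfolding eq by (rule tendsto_sandwich[OF _ always_eventually tendsto_const lim]) (auto intro!: sqnorm_add_le)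
  then show ?thesis
    by (simp add: series_limit_def)
qed

lemma series_limit_cmult:
  assumes "series_limit X g"
  shows "series_limit (\<lambda>z. c * X z) (\<lambda>j z. c * g j z)"
proof -
  have [measurable]: "X \<in> borel_measurable N" "g j \<in> borel_measurable (P \<Otimes>\<^sub>M R)" for j
    using assms by (auto simp: series_limit_def)
  have eq: "c * X z - series_sum J (\<lambda>j z. c * g j z) z = c * (X z - series_sum J g z)" for J z
    by (simp add: series_sum_def sum_distrib_left right_diff_distrib mult.assoc)
  have "(\<lambda>n. ennreal (c\<^sup>2) * sqnorm N (\<lambda>z. X z - series_sum {..<n} g z)) \<longlonglongrightarrow> ennreal (c\<^sup>2) * 0"
    using assms by (intro ennreal_tendsto_cmult) (auto simp: series_limit_def)
  then have "(\<lambda>n. sqnorm N (\<lambda>z. c * X z - series_sum {..<n} (\<lambda>j z. c * g j z) z)) \<longlonglongrightarrow> 0"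
    unfolding eq by (subst sqnorm_cmult) auto
  then show ?thesis
    by (simp add: series_limit_def)
qed

text \<open>By orthogonality every partial sum is bounded by the sum of the weights. Comparing
  \<open>X\<close> with the partial sums doubles this bound and adds an error that tends to
  0.\<close>

lemma series_limit_sqnorm_le:
  assumes X: "series_limit X g"
    and w: "\<And>j. sqnorm (P \<Otimes>\<^sub>M R) (g j) \<le> ennreal (w j)" "\<And>j. 0 \<le> w j" "summable w"
  shows "sqnorm N X \<le> 2 * ennreal (\<Sum>j. w j)"
proof (rule tendsto_lowerbound)
  have [measurable]: "X \<in> borel_measurable N" "g j \<in> borel_measurable (P \<Otimes>\<^sub>M R)" for j
    using X by (auto simp: series_limit_def)
  have "(\<lambda>n. 2 * sqnorm N (\<lambda>z. X z - series_sum {..<n} g z) + 2 * ennreal (\<Sum>j. w j)) \<longlonglongrightarrow> 2 * 0 + 2 * ennreal (\<Sum>j. w j)"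
    using X by (intro tendsto_add ennreal_tendsto_cmult tendsto_const) (auto simp: series_limit_def)
  then show "(\<lambda>n. 2 * sqnorm N (\<lambda>z. X z - series_sum {..<n} g z) + 2 * ennreal (\<Sum>j. w j)) \<longlonglongrightarrow> 2 * ennreal (\<Sum>j. w j)"
    by simp
  have "sqnorm N X \<le> 2 * sqnorm N (\<lambda>z. X z - series_sum {..<n} g z) + 2 * ennreal (\<Sum>j. w j)" for n
  proof -
    have "sqnorm N (series_sum {..<n} g) \<le> ennreal (\<Sum>j<n. w j)"
      using w by (intro sqnorm_series_sum_le) auto
    also have "\<dots> \<le> ennreal (\<Sum>j. w j)"
      using w by (intro ennreal_leI sum_le_suminf) auto
    finally have "2 * sqnorm N (series_sum {..<n} g) \<le> 2 * ennreal (\<Sum>j. w j)"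
      by (rule mult_left_mono) simp
    moreover have "sqnorm N X \<le> 2 * sqnorm N (\<lambda>z. X z - series_sum {..<n} g z) + 2 * sqnorm N (series_sum {..<n} g)"
      by (rule sqnorm_le_diff) measurable
    ultimately show ?thesis
      by (meson add_left_mono order.trans)
  qed
  then show "\<forall>\<^sub>F n in sequentially. sqnorm N X \<le> 2 * sqnorm N (\<lambda>z. X z - series_sum {..<n} g z) + 2 * ennreal (\<Sum>j. w j)"
    by simp
qed simp

text \<open>Orthogonality bounds the distance of two partial sums by a section of the summable
  series of weights, so the partial sums are Cauchy.\<close>

lemma series_limit_exists:
  assumes g [measurable]: "\<And>j. g j \<in> borel_measurable (P \<Otimes>\<^sub>M R)"
    and w: "\<And>j. sqnorm (P \<Otimes>\<^sub>M R) (g j) \<le> ennreal (w j)" "\<And>j. 0 \<le> w j" "summable w"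
  shows "\<exists>X. series_limit X g"
proof -
  have cauchy: "\<exists>n0. \<forall>m\<ge>n0. \<forall>n\<ge>n0. sqnorm N (\<lambda>z. series_sum {..<m} g z - series_sum {..<n} g z) \<le> ennreal \<epsilon>"
    if "0 < \<epsilon>" for \<epsilon>
  proof -
    obtain n0 where n0: "\<forall>m\<ge>n0. \<forall>n. \<bar>\<Sum>j\<in>{m..<n}. w j\<bar> < \<epsilon>"
      using w(3) \<open>0 < \<epsilon>\<close> unfolding summable_Cauchy real_norm_def by blast
    have le: "sqnorm N (\<lambda>z. series_sum {..<n} g z - series_sum {..<m} g z) \<le> ennreal \<epsilon>" if "n0 \<le> m" "m \<le> n" for m n
    proof -
      have "sqnorm N (\<lambda>z. series_sum {..<n} g z - series_sum {..<m} g z) = sqnorm N (series_sum {m..<n} g)"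
      proof -
        have "{..<n} - {..<m} = {m..<n}"
          by auto
        then show ?thesis
          using that by (subst series_sum_diff) auto
      qed
      also have "\<dots> \<le> ennreal (\<Sum>j\<in>{m..<n}. w j)"
        using w by (intro sqnorm_series_sum_le) auto
      also have "\<dots> \<le> ennreal \<epsilon>"
        using n0[rule_format, OF that(1), of n] by (intro ennreal_leI) linarith
      finally show ?thesis .
    qed
    show ?thesis
    proof (intro exI allI impI)
      fix m n assume "n0 \<le> m" "n0 \<le> n"
      then show "sqnorm N (\<lambda>z. series_sum {..<m} g z - series_sum {..<n} g z) \<le> ennreal \<epsilon>"
        using le[of n m] le[of m n] sqnorm_minus_commute[of N "series_sum {..<m} g" "series_sum {..<n} g"]
        by (cases "n \<le> m") auto
    qed
  qed
  obtain X where "X \<in> borel_measurable N" "(\<lambda>n. sqnorm N (\<lambda>z. series_sum {..<n} g z - X z)) \<longlonglongrightarrow> 0"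
    by (rule sqnorm_complete[where u = "\<lambda>n. series_sum {..<n} g", OF _ cauchy]) measurable
  then show ?thesis
    by (auto simp: series_limit_def sqnorm_minus_commute[of _ X])
qed

text \<open>Applied at a fixed outcome and time. The tail is taken in [0,\<infinity>], so it can be
  integrated before anything is known about its finiteness.\<close>

lemma orthonormal_limit_tail:
  assumes lim: "L2_tendsto M (\<lambda>n x. \<Sum>j<n. a j * e j x) f sequentially"
  shows "sqnorm M (\<lambda>x. f x - (\<Sum>j<n. a j * e j x)) \<le> 2 * (\<Sum>j. ennreal ((a (j + n))\<^sup>2))"
proof (rule tendsto_lowerbound)
  have [measurable]: "f \<in> borel_measurable M"
    using lim by (simp add: L2_tendsto_def L2_def)
  let ?S = "\<lambda>n x. \<Sum>j<n. a j * e j x"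
  let ?tail = "\<Sum>j. ennreal ((a (j + n))\<^sup>2)"
  have "(\<lambda>m. 2 * sqnorm M (\<lambda>x. ?S m x - f x) + 2 * ?tail) \<longlonglongrightarrow> 2 * 0 + 2 * ?tail"
    using lim by (intro tendsto_add ennreal_tendsto_cmult tendsto_const) (auto simp: L2_tendsto_iff_sqnorm)
  then show "(\<lambda>m. 2 * sqnorm M (\<lambda>x. ?S m x - f x) + 2 * ?tail) \<longlonglongrightarrow> 2 * ?tail"
    by simp
  show "\<forall>\<^sub>F m in sequentially. sqnorm M (\<lambda>x. f x - ?S n x) \<le> 2 * sqnorm M (\<lambda>x. ?S m x - f x) + 2 * ?tail"
    using eventually_ge_at_top[of n]
  proof eventually_elim
    case (elim m)
    have "sqnorm M (\<lambda>x. ?S m x - ?S n x) = sqnorm M (\<lambda>x. \<Sum>j\<in>{n..<m}. a j * e j x)"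
    proof -
      have "?S m x - ?S n x = (\<Sum>j\<in>{n..<m}. a j * e j x)" for x
        using sum_diff[of "{..<m}" "{..<n}" "\<lambda>j. a j * e j x"] elim
        by (simp add: lessThan_minus_lessThan)
      then show ?thesis
        by simp
    qed
    also have "\<dots> = (\<Sum>j\<in>{n..<m}. ennreal ((a j)\<^sup>2))"
      by (simp add: sqnorm_orthonormal_sum sum_ennreal)
    also have "\<dots> = (\<Sum>j<m - n. ennreal ((a (j + n))\<^sup>2))"
      using sum.shift_bounds_nat_ivl[of "\<lambda>j. ennreal ((a j)\<^sup>2)" 0 n "m - n"] elim
      by (simp add: atLeast0LessThan)
    also have "\<dots> \<le> ?tail"
      by (rule sum_le_suminf) (auto intro: summableI)
    finally have "2 * sqnorm M (\<lambda>x. ?S m x - ?S n x) \<le> 2 * ?tail"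
      by (rule mult_left_mono) simp
    moreover have "sqnorm M (\<lambda>x. f x - ?S n x) \<le> 2 * sqnorm M (\<lambda>x. f x - ?S m x) + 2 * sqnorm M (\<lambda>x. ?S m x - ?S n x)"
      by (rule sqnorm_diff_triangle_le) measurable
    ultimately show ?case
      unfolding sqnorm_minus_commute[of M f] by (meson add_left_mono order.trans)
  qed
qed simp

text \<open>The bridge from the slicewise description of the solution to mean-square convergence.
  For each fixed time the tail estimate holds almost surely; integrating it first over outcomes and
  then over time bounds the distance to the partial sums by twice the tail of the weights.\<close>

lemma series_limitI_pointwise:
  assumes X [measurable]: "X \<in> borel_measurable N"
    and g [measurable]: "\<And>j. g j \<in> borel_measurable (P \<Otimes>\<^sub>M R)"
    and w: "\<And>j. sqnorm (P \<Otimes>\<^sub>M R) (g j) \<le> ennreal (w j)" "\<And>j. 0 \<le> w j" "summable w"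
    and lim: "\<And>t. t \<in> space R \<Longrightarrow> AE \<omega> in P.
      L2_tendsto M (\<lambda>n x. \<Sum>j<n. g j (\<omega>, t) * e j x) (\<lambda>x. X (\<omega>, (x, t))) sequentially"
  shows "series_limit X g"
proof -
  have bound: "sqnorm N (\<lambda>z. X z - series_sum {..<n} g z) \<le> 2 * ennreal (\<Sum>j. w (j + n))" for n
  proof -
    have "sqnorm N (\<lambda>z. X z - series_sum {..<n} g z) =
        (\<integral>\<^sup>+ t. \<integral>\<^sup>+ \<omega>. sqnorm M (\<lambda>x. X (\<omega>, (x, t)) - (\<Sum>j<n. g j (\<omega>, t) * e j x)) \<partial>P \<partial>R)"
      by (subst sqnorm_slices) (simp_all add: series_sum_def)
    also have "\<dots> \<le> (\<integral>\<^sup>+ t. \<integral>\<^sup>+ \<omega>. 2 * (\<Sum>j. ennreal ((g (j + n) (\<omega>, t))\<^sup>2)) \<partial>P \<partial>R)"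
    proof (rule nn_integral_mono)
      fix t assume "t \<in> space R"
      from lim[OF this]
      show "(\<integral>\<^sup>+ \<omega>. sqnorm M (\<lambda>x. X (\<omega>, (x, t)) - (\<Sum>j<n. g j (\<omega>, t) * e j x)) \<partial>P)
          \<le> (\<integral>\<^sup>+ \<omega>. 2 * (\<Sum>j. ennreal ((g (j + n) (\<omega>, t))\<^sup>2)) \<partial>P)"
        by (intro nn_integral_mono_AE) (auto elim!: eventually_mono intro: orthonormal_limit_tail)
    qed
    also have "\<dots> = 2 * (\<integral>\<^sup>+ t. \<integral>\<^sup>+ \<omega>. (\<Sum>j. ennreal ((g (j + n) (\<omega>, t))\<^sup>2)) \<partial>P \<partial>R)"
    proof -
      have "(\<integral>\<^sup>+ \<omega>. 2 * (\<Sum>j. ennreal ((g (j + n) (\<omega>, t))\<^sup>2)) \<partial>P) =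
          2 * (\<integral>\<^sup>+ \<omega>. (\<Sum>j. ennreal ((g (j + n) (\<omega>, t))\<^sup>2)) \<partial>P)" if [measurable]: "t \<in> space R" for t
        by (rule nn_integral_cmult) measurable
      then have "(\<integral>\<^sup>+ t. \<integral>\<^sup>+ \<omega>. 2 * (\<Sum>j. ennreal ((g (j + n) (\<omega>, t))\<^sup>2)) \<partial>P \<partial>R) =
          (\<integral>\<^sup>+ t. 2 * (\<integral>\<^sup>+ \<omega>. (\<Sum>j. ennreal ((g (j + n) (\<omega>, t))\<^sup>2)) \<partial>P) \<partial>R)"
        by (rule nn_integral_cong)
      also have "\<dots> = 2 * (\<integral>\<^sup>+ t. \<integral>\<^sup>+ \<omega>. (\<Sum>j. ennreal ((g (j + n) (\<omega>, t))\<^sup>2)) \<partial>P \<partial>R)"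
        by (rule nn_integral_cmult) measurable
      finally show ?thesis .
    qed
    also have "(\<integral>\<^sup>+ t. \<integral>\<^sup>+ \<omega>. (\<Sum>j. ennreal ((g (j + n) (\<omega>, t))\<^sup>2)) \<partial>P \<partial>R)
        = (\<integral>\<^sup>+ t. (\<Sum>j. \<integral>\<^sup>+ \<omega>. ennreal ((g (j + n) (\<omega>, t))\<^sup>2) \<partial>P) \<partial>R)"
      by (intro nn_integral_cong nn_integral_suminf) measurable
    also have "\<dots> = (\<Sum>j. sqnorm (P \<Otimes>\<^sub>M R) (g (j + n)))"
      by (subst nn_integral_suminf) (measurable, simp add: sqnorm_coefficient)
    also have "\<dots> \<le> (\<Sum>j. ennreal (w (j + n)))"
      by (intro suminf_le w summableI)
    also have "\<dots> = ennreal (\<Sum>j. w (j + n))"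
      using w by (intro suminf_ennreal2) (auto simp: summable_iff_shift)
    finally show ?thesis
      by (simp add: mult_left_mono)
  qed
  have "(\<lambda>n. (\<Sum>j. w j) - (\<Sum>j<n. w j)) \<longlonglongrightarrow> (\<Sum>j. w j) - (\<Sum>j. w j)"
    by (intro tendsto_diff tendsto_const summable_LIMSEQ w)
  then have "(\<lambda>n. \<Sum>j. w (j + n)) \<longlonglongrightarrow> 0"
    using suminf_minus_initial_segment[OF w(3)] by simp
  then have "(\<lambda>n. 2 * ennreal (\<Sum>j. w (j + n))) \<longlonglongrightarrow> 2 * ennreal 0"
    by (intro ennreal_tendsto_cmult tendsto_ennrealI) auto
  then have "(\<lambda>n. 2 * ennreal (\<Sum>j. w (j + n))) \<longlonglongrightarrow> 0"
    by simp
  then have "(\<lambda>n. sqnorm N (\<lambda>z. X z - series_sum {..<n} g z)) \<longlonglongrightarrow> 0"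
    by (rule tendsto_sandwich[OF _ _ tendsto_const, rotated 2]) (auto intro!: always_eventually bound)
  then show ?thesis
    by (simp add: series_limit_def)
qed

lemma series_limit_L2:
  assumes "series_limit X g"
    and "\<And>j. sqnorm (P \<Otimes>\<^sub>M R) (g j) \<le> ennreal (w j)" "\<And>j. 0 \<le> w j" "summable w"
  shows "X \<in> L2 N"
proof -
  have "2 * ennreal (\<Sum>j. w j) < \<top>"
    by (rule two_mult_less_top) simp
  then have "sqnorm N X < \<top>"
    by (rule order.strict_trans1[OF series_limit_sqnorm_le[OF assms]])
  then show ?thesis
    using assms(1) by (simp add: L2_iff_sqnorm series_limit_def)
qed

text \<open>Differentiation term by term: the error of the quotient is itself the limit of a series,
  with weights \<open>h\<^sup>2 * w j\<close>, so its squared norm is at most twice their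
  sum.\<close>

lemma series_limit_difference_quotient:
  assumes X: "\<forall>\<^sub>F h in at 0. series_limit (X (s + h)) (g (s + h))"
    and X0: "series_limit (X s) (g s)" and Y: "series_limit Y g'"
    and w: "\<forall>\<^sub>F h in at 0. \<forall>j. sqnorm (P \<Otimes>\<^sub>M R) (\<lambda>z. (g (s + h) j z - g s j z) / h - g' j z) \<le> ennreal (h\<^sup>2 * w j)"
      "\<And>j. 0 \<le> w j" "summable w"
  shows "((\<lambda>h. sqnorm N (\<lambda>z. (X (s + h) z - X s z) / h - Y z)) \<longlongrightarrow> 0) (at (0::real))"
proof -
  have "((\<lambda>h. 2 * ennreal (h\<^sup>2 * (\<Sum>j. w j))) \<longlongrightarrow> 2 * ennreal (0\<^sup>2 * (\<Sum>j. w j))) (at (0::real))"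
    by (intro ennreal_tendsto_cmult tendsto_ennrealI tendsto_intros) auto
  then have lim: "((\<lambda>h. 2 * ennreal (h\<^sup>2 * (\<Sum>j. w j))) \<longlongrightarrow> 0) (at (0::real))"
    by simp
  have "\<forall>\<^sub>F h in at 0. sqnorm N (\<lambda>z. (X (s + h) z - X s z) / h - Y z) \<le> 2 * ennreal (h\<^sup>2 * (\<Sum>j. w j))"
    using X w(1)
  proof eventually_elim
    case (elim h)
    \<comment> \<open>Spelled as a linear combination, to fit the closure of
      \<open>series_limit\<close> under sums and multiples.\<close>
    have "series_limit (\<lambda>z. 1 / h * (X (s + h) z + (- 1) * X s z) + (- 1) * Y z)
        (\<lambda>j z. 1 / h * (g (s + h) j z + (- 1) * g s j z) + (- 1) * g' j z)"
      by (intro series_limit_add series_limit_cmult elim X0 Y)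
    then have "series_limit (\<lambda>z. (X (s + h) z - X s z) / h - Y z) (\<lambda>j z. (g (s + h) j z - g s j z) / h - g' j z)"
      by simp
    then have "sqnorm N (\<lambda>z. (X (s + h) z - X s z) / h - Y z) \<le> 2 * ennreal (\<Sum>j. h\<^sup>2 * w j)"
      using elim(2) w by (intro series_limit_sqnorm_le) (auto intro: summable_mult)
    then show ?case
      using w by (simp add: suminf_mult)
  qed
  then show ?thesis
    by (rule tendsto_sandwich[OF always_eventually _ tendsto_const lim, rotated]) simp
qed

end

section \<open>The coefficient processes\<close>

lemma emeasure_interval_space: "0 \<le> T \<Longrightarrow> emeasure (restrict_space lborel {0..T}) (space (restrict_space lborel {0..T})) = ennreal T"
  by (simp add: emeasure_restrict_space space_restrict_space)

lemma sqnorm_reflect: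
  assumes [measurable]: "k \<in> borel_measurable borel"
  shows "sqnorm (restrict_space lborel {0..t}) (\<lambda>r. k (t - r)) = sqnorm (restrict_space lborel {0..t::real}) k"
proof -
  have "sqnorm (restrict_space lborel {0..t}) k = (\<integral>\<^sup>+ r. ennreal ((k r)\<^sup>2) * indicator {0..t} r \<partial>lborel)"
    by (simp add: sqnorm_def nn_integral_restrict_space)
  also have "\<dots> = (\<integral>\<^sup>+ r. ennreal ((k (t + (- 1) * r))\<^sup>2) * indicator {0..t} (t + (- 1) * r) \<partial>lborel)"
    by (subst nn_integral_real_affine[where c = "- 1" and t = t]) auto
  also have "\<dots> = (\<integral>\<^sup>+ r. ennreal ((k (t - r))\<^sup>2) * indicator {0..t} r \<partial>lborel)"
    by (intro nn_integral_cong) (auto simp: indicator_def)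
  also have "\<dots> = sqnorm (restrict_space lborel {0..t}) (\<lambda>r. k (t - r))"
    by (simp add: sqnorm_def nn_integral_restrict_space)
  finally show ?thesis
    by simp
qed

lemma sqnorm_interval_mono:
  "t \<le> T \<Longrightarrow> sqnorm (restrict_space lborel {0..t}) k \<le> sqnorm (restrict_space lborel {0..T::real}) k"
  unfolding sqnorm_def
  by (simp add: nn_integral_restrict_space) (intro nn_integral_mono, auto simp: indicator_def)

lemma sqnorm_interval_le_powr:
  assumes "\<And>r. 0 < r \<Longrightarrow> (k r)\<^sup>2 \<le> K * r powr (- 1 / 2)" and "0 \<le> K"
  shows "sqnorm (restrict_space lborel {0..T}) k \<le>
    ennreal K * (\<integral>\<^sup>+ r. ennreal (r powr (- 1 / 2)) \<partial>restrict_space lborel {0..T})"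
proof -
  have "AE r in lborel. r \<noteq> (0::real)"
    by (rule AE_lborel_singleton)
  then have "AE r in restrict_space lborel {0..T}. 0 < r"
    by (subst AE_restrict_space_iff) auto
  then have "AE r in restrict_space lborel {0..T}. ennreal ((k r)\<^sup>2) \<le> ennreal K * ennreal (r powr (- 1 / 2))"
  proof eventually_elim
    case (elim r)
    show ?case
      unfolding ennreal_mult[OF \<open>0 \<le> K\<close> powr_ge_zero, symmetric]
      by (rule ennreal_leI[OF assms(1)[OF elim]])
  qed
  then have "sqnorm (restrict_space lborel {0..T}) k \<le>
      (\<integral>\<^sup>+ r. ennreal K * ennreal (r powr (- 1 / 2)) \<partial>restrict_space lborel {0..T})"
    unfolding sqnorm_def by (rule nn_integral_mono_AE)
  also have "\<dots> = ennreal K * (\<integral>\<^sup>+ r. ennreal (r powr (- 1 / 2)) \<partial>restrict_space lborel {0..T})"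
    by (intro nn_integral_cmult) (auto intro!: measurable_restrict_space1)
  finally show ?thesis .
qed

text \<open>One mode of the solution, at \<open>z\<close> the pair of outcome and time, for an
  arbitrary kernel: a deterministic part plus a stochastic convolution. Being linear in the kernel,
  it also represents derivatives and difference quotients of modes.\<close>

definition coefficient ::
    "real \<Rightarrow> real \<Rightarrow> (real \<Rightarrow> 'w \<Rightarrow> real) \<Rightarrow> (real \<Rightarrow> real) \<Rightarrow> (real \<Rightarrow> real) \<Rightarrow> 'w \<times> real \<Rightarrow> real" where
  "coefficient c m b k k' z = c * k (snd z) + m * path_integral k k' (\<lambda>r. b r (fst z)) (snd z)"

lemma coefficient_difference_quotient:
  assumes "smooth_kernel k1 k1'" "smooth_kernel k2 k2'" "smooth_kernel k3 k3'"
    and b: "\<And>\<omega>. continuous_on UNIV (\<lambda>t. b t \<omega>)"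
  shows "(coefficient c m b k1 k1' z - coefficient c m b k2 k2' z) / h - coefficient c m b k3 k3' z =
    coefficient c m b (\<lambda>r. (k1 r - k2 r) / h - k3 r) (\<lambda>r. (k1' r - k2' r) / h - k3' r) z"
proof -
  let ?b = "\<lambda>r. b r (fst z)" and ?t = "snd z"
  have int: "(\<lambda>r. k' (?t - r) * ?b r) integrable_on {0..?t}" if "smooth_kernel k k'" for k k'
  proof -
    interpret smooth_kernel k k' by fact
    show ?thesis
      by (intro integrable_continuous_interval continuous_on_mult continuous_on_compose2[OF kernel_deriv_continuous]
          continuous_on_subset[OF b] continuous_intros) auto
  qed
  note I = int[OF assms(1)] int[OF assms(2)] int[OF assms(3)]
  have "((\<lambda>r. (k1' (?t - r) * ?b r - k2' (?t - r) * ?b r) / h - k3' (?t - r) * ?b r) has_integral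
      (integral {0..?t} (\<lambda>r. k1' (?t - r) * ?b r) - integral {0..?t} (\<lambda>r. k2' (?t - r) * ?b r)) / h
      - integral {0..?t} (\<lambda>r. k3' (?t - r) * ?b r)) {0..?t}"
    by (intro has_integral_diff has_integral_divide integrable_integral I)
  then have eq: "integral {0..?t} (\<lambda>r. ((k1' (?t - r) - k2' (?t - r)) / h - k3' (?t - r)) * ?b r) =
      (integral {0..?t} (\<lambda>r. k1' (?t - r) * ?b r) - integral {0..?t} (\<lambda>r. k2' (?t - r) * ?b r)) / h
      - integral {0..?t} (\<lambda>r. k3' (?t - r) * ?b r)"
    by (intro integral_unique) (simp add: left_diff_distrib)
  show ?thesis
    unfolding coefficient_def path_integral_def eq
    by (simp add: algebra_simps diff_divide_distrib add_divide_distrib)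
qed

context brownian_convolution
begin

lemma coefficient_measurable:
  "coefficient c m b k k' \<in> borel_measurable (P \<Otimes>\<^sub>M restrict_space lborel {0..T})"
proof -
  have [measurable]: "(\<lambda>z. k (snd z)) \<in> borel_measurable (P \<Otimes>\<^sub>M restrict_space lborel {0..T})"
    by (intro measurable_compose[OF measurable_snd] measurable_restrict_space1) auto
  note convolution_jointly_measurable[of T, measurable]
  show ?thesis
    unfolding coefficient_def[abs_def] by measurable
qed

text \<open>Splitting off the deterministic part gives a factor 2 for each part; the convolution
  bound contributes another 2, whence 4. That bound is made uniform in \<open>t\<close> by enlarging
  the interval to [0,T], and integrating it over time produces the factor \<open>T\<close>.\<close>

lemma sqnorm_coefficient_le:
  assumes "0 \<le> T"
  shows "sqnorm (P \<Otimes>\<^sub>M restrict_space lborel {0..T}) (coefficient c m b k k') \<le>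
    ennreal (2 * c\<^sup>2 + 4 * m\<^sup>2 * T) * sqnorm (restrict_space lborel {0..T}) k"
proof -
  let ?I = "restrict_space lborel {0..T}"
  interpret I: finite_measure ?I by (rule finite_measure_interval)
  interpret PI: pair_sigma_finite P ?I ..
  have [measurable]: "coefficient c m b k k' \<in> borel_measurable (P \<Otimes>\<^sub>M ?I)"
    by (rule coefficient_measurable)
  have [measurable]: "k \<in> borel_measurable ?I"
    by (intro measurable_restrict_space1) auto
  have slice: "sqnorm P (\<lambda>\<omega>. coefficient c m b k k' (\<omega>, t)) \<le>
      ennreal (2 * c\<^sup>2) * ennreal ((k t)\<^sup>2) + ennreal (4 * m\<^sup>2) * sqnorm ?I k" if t: "0 \<le> t" "t \<le> T" for t
  proof -
    have [measurable]: "convolution t \<in> borel_measurable P"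
      using t(1) by (rule convolution_measurable)
    have "sqnorm P (convolution t) \<le> 2 * sqnorm ?I k"
    proof -
      have "sqnorm (restrict_space lborel {0..t}) (\<lambda>r. k (t - r)) \<le> sqnorm ?I k"
        using sqnorm_interval_mono[OF t(2)] by (simp add: sqnorm_reflect)
      then show ?thesis
        using sqnorm_convolution_le[OF t(1)] by (meson mult_left_mono order.trans zero_le)
    qed
    then have conv: "ennreal (m\<^sup>2) * sqnorm P (convolution t) \<le> ennreal (m\<^sup>2) * (2 * sqnorm ?I k)"
      by (rule mult_left_mono) simp
    have "sqnorm P (\<lambda>\<omega>. coefficient c m b k k' (\<omega>, t)) \<le>
        2 * sqnorm P (\<lambda>\<omega>. c * k t) + 2 * sqnorm P (\<lambda>\<omega>. m * convolution t \<omega>)"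
      unfolding coefficient_def fst_conv snd_conv by (intro sqnorm_add_le) measurable
    also have "sqnorm P (\<lambda>\<omega>. m * convolution t \<omega>) = ennreal (m\<^sup>2) * sqnorm P (convolution t)"
      by (rule sqnorm_cmult) measurable
    also have "sqnorm P (\<lambda>\<omega>. c * k t) = ennreal (c\<^sup>2) * ennreal ((k t)\<^sup>2)"
      by (simp add: sqnorm_def emeasure_space_1 power_mult_distrib ennreal_mult)
    also have "2 * (ennreal (c\<^sup>2) * ennreal ((k t)\<^sup>2)) + 2 * (ennreal (m\<^sup>2) * sqnorm P (convolution t))
        \<le> 2 * (ennreal (c\<^sup>2) * ennreal ((k t)\<^sup>2)) + 2 * (ennreal (m\<^sup>2) * (2 * sqnorm ?I k))"
      by (intro add_left_mono mult_left_mono conv) simp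
    also have "\<dots> = ennreal (2 * c\<^sup>2) * ennreal ((k t)\<^sup>2) + ennreal (4 * m\<^sup>2) * sqnorm ?I k"
    proof -
      have "ennreal (2 * c\<^sup>2) = 2 * ennreal (c\<^sup>2)" "ennreal (4 * m\<^sup>2) = 2 * ennreal (m\<^sup>2) * 2"
        by (simp_all add: ennreal_mult mult_ac flip: ennreal_numeral)
           (simp add: ennreal_mult[symmetric])
      then show ?thesis
        by (simp add: mult_ac)
    qed
    finally show ?thesis .
  qed
  have "sqnorm (P \<Otimes>\<^sub>M ?I) (coefficient c m b k k') = (\<integral>\<^sup>+ t. sqnorm P (\<lambda>\<omega>. coefficient c m b k k' (\<omega>, t)) \<partial>?I)"
    unfolding sqnorm_def by (subst PI.nn_integral_snd[symmetric]) measurable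
  also have "\<dots> \<le> (\<integral>\<^sup>+ t. ennreal (2 * c\<^sup>2) * ennreal ((k t)\<^sup>2) + ennreal (4 * m\<^sup>2) * sqnorm ?I k \<partial>?I)"
    by (intro nn_integral_mono slice) (auto simp: space_restrict_space)
  also have "\<dots> = ennreal (2 * c\<^sup>2) * sqnorm ?I k + ennreal (4 * m\<^sup>2) * sqnorm ?I k * ennreal T"
    using emeasure_interval_space[OF assms] by (simp add: nn_integral_add nn_integral_cmult sqnorm_def)
  also have "\<dots> = (ennreal (2 * c\<^sup>2) + ennreal (4 * m\<^sup>2 * T)) * sqnorm ?I k"
  proof -
    have "ennreal (4 * m\<^sup>2 * T) = ennreal (4 * m\<^sup>2) * ennreal T"
      using assms by (intro ennreal_mult) auto
    then show ?thesis
      by (simp only: distrib_left mult_ac)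
  qed
  also have "ennreal (2 * c\<^sup>2) + ennreal (4 * m\<^sup>2 * T) = ennreal (2 * c\<^sup>2 + 4 * m\<^sup>2 * T)"
    using assms by (simp add: ennreal_plus)
  finally show ?thesis .
qed

lemma sqnorm_coefficient_le_powr:
  assumes "0 \<le> T" "0 \<le> K" and bound: "\<And>r. 0 < r \<Longrightarrow> (k r)\<^sup>2 \<le> K * r powr (- 1 / 2)"
    and E: "(\<integral>\<^sup>+ r. ennreal (r powr (- 1 / 2)) \<partial>restrict_space lborel {0..T}) = ennreal E" "0 \<le> E"
  shows "sqnorm (P \<Otimes>\<^sub>M restrict_space lborel {0..T}) (coefficient c m b k k') \<le>
    ennreal ((2 * c\<^sup>2 + 4 * m\<^sup>2 * T) * (K * E))"
proof -
  have "sqnorm (P \<Otimes>\<^sub>M restrict_space lborel {0..T}) (coefficient c m b k k')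
      \<le> ennreal (2 * c\<^sup>2 + 4 * m\<^sup>2 * T) * (ennreal K * ennreal E)"
    using sqnorm_coefficient_le[OF assms(1)] sqnorm_interval_le_powr[OF bound assms(2), of T]
    unfolding E(1) by (meson mult_left_mono order.trans zero_le)
  also have "\<dots> = ennreal ((2 * c\<^sup>2 + 4 * m\<^sup>2 * T) * (K * E))"
    using assms by (simp add: ennreal_mult)
  finally show ?thesis .
qed

end

section \<open>Bessel's inequality and the sign of the eigenvalues of the noise covariance\<close>

lemma bessel_inequality:
  assumes e: "\<And>j. e j \<in> L2 M" "\<And>i j. L2_inner M (e i) (e j) = (if i = j then 1 else 0)" and v: "v \<in> L2 M"
  shows "summable (\<lambda>j. (L2_inner M v (e j))\<^sup>2)"
proof (rule summableI_nonneg_bounded)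
  fix n
  let ?c = "\<lambda>j. L2_inner M v (e j)"
  let ?S = "\<lambda>x. \<Sum>j<n. ?c j * e j x"
  have S: "?S \<in> L2 M"
    by (intro L2_sum L2_cmult e)
  have "L2_inner M ?S ?S = (\<Sum>i<n. \<Sum>j<n. ?c i * ?c j * L2_inner M (e i) (e j))"
    by (intro L2_inner_sum_sum e)
  also have "\<dots> = (\<Sum>i<n. \<Sum>j<n. if i = j then ?c i * ?c j else 0)"
    by (intro sum.cong) (simp_all add: e)
  finally have SS: "L2_inner M ?S ?S = (\<Sum>j<n. (?c j)\<^sup>2)"
    by (simp add: power2_eq_square)
  have "L2_inner M v ?S = (\<Sum>j<n. ?c j * ?c j)"
    \<comment> \<open>Here \<open>v\<close> is treated as a sum with a single term.\<close>
    using L2_inner_sum_sum[of "{0::nat}" "\<lambda>_. v" M "{..<n}" e "\<lambda>_. 1" ?c] v e by simp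
  then have vS: "L2_inner M v ?S = (\<Sum>j<n. (?c j)\<^sup>2)"
    by (simp add: power2_eq_square)
  have "0 \<le> L2_inner M (\<lambda>x. v x - ?S x) (\<lambda>x. v x - ?S x)"
    by (simp add: L2_inner_def)
  also have "\<dots> = L2_inner M v v - (\<Sum>j<n. (?c j)\<^sup>2)"
    using L2_inner_diff_diff[OF v S v S] SS vS by (simp add: L2_inner_def mult.commute)
  finally show "(\<Sum>j<n. (?c j)\<^sup>2) \<le> L2_inner M v v"
    by simp
qed simp

text \<open>The eigenvalue equals the inner product of \<open>Q (e j)\<close> with
  \<open>e j\<close>. The sign makes the square of \<open>sqrt (mu j)\<close> equal to
  \<open>mu j\<close>, so that summability of \<open>mu\<close> bounds the noise terms.\<close>

lemma (in stochastic_setting) mu_nonneg: "0 \<le> mu j"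
proof -
  have e: "e j \<in> L2 (space_measure D)" "L2_inner (space_measure D) (e j) (e j) = 1"
    using e_basis by (auto simp: orthonormal_basis_L2_def)
  then have [measurable]: "e j \<in> borel_measurable (space_measure D)" "Q (e j) \<in> borel_measurable (space_measure D)"
    using Q_bounded by (auto simp: bounded_operator_L2_def linear_operator_L2_def L2_def)
  have "L2_inner (space_measure D) (Q (e j)) (e j) = (\<integral>x. mu j * (e j x * e j x) \<partial>space_measure D)"
    unfolding L2_inner_def using Q_diagonal[of j] by (intro integral_cong_AE) auto
  also have "\<dots> = mu j"
    using e(2) by (simp add: L2_inner_def)
  finally show ?thesis
    using Q_positive e(1) by (auto simp: positive_semidefinite_L2_def)
qed

text \<open>
  Used with \<open>c j\<close> the Fourier coefficients of $y_0$, \<open>m j\<close> $= \sqrt{\mu_j}$ and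
  \<open>l j\<close> $= \ln \lambda_j$.
\<close>

definition solution_coefficient ::
    "(nat \<Rightarrow> real) \<Rightarrow> (nat \<Rightarrow> real) \<Rightarrow> (nat \<Rightarrow> real) \<Rightarrow> (nat \<Rightarrow> real \<Rightarrow> 'w \<Rightarrow> real) \<Rightarrow>
     nat \<Rightarrow> real \<Rightarrow> nat \<Rightarrow> 'w \<times> real \<Rightarrow> real" where
  "solution_coefficient c m l b n s j =
     coefficient (c j) (m j) (b j) (kernel n (l j) s) (kernel_dr n (l j) s)"

lemma solution_coefficient_deriv:
  assumes "\<And>\<omega>. continuous_on UNIV (\<lambda>t. b j t \<omega>)"
  shows "((\<lambda>s. solution_coefficient c m l b n s j z) has_real_derivative
    solution_coefficient c m l b (Suc n) s j z) (at s)"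
  unfolding solution_coefficient_def coefficient_def
  by (intro DERIV_add DERIV_cmult kernel_deriv_s path_integral_kernel_deriv assms)

section \<open>Estimates and series for the modes and their derivatives of every order\<close>

locale solution_family = orthonormal_system P M "restrict_space lborel {0..T}" e + prob_space P
  for P :: "'w measure" and M :: "'a measure" and T :: real and e :: "nat \<Rightarrow> 'a \<Rightarrow> real" +
  fixes c m l :: "nat \<Rightarrow> real" and b :: "nat \<Rightarrow> real \<Rightarrow> 'w \<Rightarrow> real" and l0 :: real
  assumes T_pos: "0 < T"
    and brownian: "\<And>j. continuous_brownian P (b j)"
    and c_summable: "summable (\<lambda>j. (c j)\<^sup>2)" and m_summable: "summable (\<lambda>j. (m j)\<^sup>2)"
    and l0: "\<And>j. l0 \<le> l j"
begin

abbreviation "Y \<equiv> solution_coefficient c m l b"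
abbreviation "I \<equiv> restrict_space lborel {0..T}"

lemma brownian_convolution_kernel:
  "smooth_kernel k k' \<Longrightarrow> brownian_convolution P (b j) k k'"
  using brownian by (simp add: brownian_convolution_def)

lemma Y_measurable: "Y n s j \<in> borel_measurable (P \<Otimes>\<^sub>M I)"
proof -
  interpret brownian_convolution P "b j" "kernel n (l j) s" "kernel_dr n (l j) s"
    by (intro brownian_convolution_kernel smooth_kernel_kernel)
  show ?thesis
    unfolding solution_coefficient_def by (rule coefficient_measurable)
qed

lemma weights_summable: "summable (\<lambda>j. (2 * (c j)\<^sup>2 + 4 * (m j)\<^sup>2 * T) * K)"
  by (intro summable_mult2 summable_add summable_mult c_summable m_summable)

lemma powr_integral: obtains E where "0 \<le> E" "(\<integral>\<^sup>+ r. ennreal (r powr (- 1 / 2)) \<partial>I) = ennreal E"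
  using nn_integral_powr_minus_half_less_top[OF T_pos] that by (metis ennreal_cases less_top)

lemma Y_bound:
  assumes "0 < s"
  obtains w where "\<And>j. 0 \<le> w j" "summable w"
    "\<And>\<sigma> j. \<sigma> \<in> {s / 2..2 * s} \<Longrightarrow> sqnorm (P \<Otimes>\<^sub>M I) (Y n \<sigma> j) \<le> ennreal (w j)"
proof -
  obtain K where K: "0 \<le> K"
    "\<And>l \<sigma> r. l0 \<le> l \<Longrightarrow> \<sigma> \<in> {s / 2..2 * s} \<Longrightarrow> 0 < r \<Longrightarrow> (kernel n l \<sigma> r)\<^sup>2 \<le> K * r powr (- 1 / 2)"
    using kernel_bound[OF assms, of l0 n] by blast
  obtain E where E: "0 \<le> E" "(\<integral>\<^sup>+ r. ennreal (r powr (- 1 / 2)) \<partial>I) = ennreal E"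
    by (rule powr_integral)
  show thesis
  proof (rule that)
    show "0 \<le> (2 * (c j)\<^sup>2 + 4 * (m j)\<^sup>2 * T) * (K * E)" for j
      using T_pos K(1) E(1) by simp
    show "summable (\<lambda>j. (2 * (c j)\<^sup>2 + 4 * (m j)\<^sup>2 * T) * (K * E))"
      by (rule weights_summable)
    fix \<sigma> j assume \<sigma>: "\<sigma> \<in> {s / 2..2 * s}"
    interpret brownian_convolution P "b j" "kernel n (l j) \<sigma>" "kernel_dr n (l j) \<sigma>"
      by (intro brownian_convolution_kernel smooth_kernel_kernel)
    show "sqnorm (P \<Otimes>\<^sub>M I) (Y n \<sigma> j) \<le> ennreal ((2 * (c j)\<^sup>2 + 4 * (m j)\<^sup>2 * T) * (K * E))"
      unfolding solution_coefficient_def using T_pos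
      by (intro sqnorm_coefficient_le_powr K E l0 \<sigma>) auto
  qed
qed

text \<open>With |h| < s / 2 the shifted parameter stays in the range of
  \<open>kernel_bound\<close>.\<close>

lemma eventually_shift_in_range:
  assumes "0 < s"
  shows "\<forall>\<^sub>F h in at (0::real). h \<noteq> 0 \<and> \<bar>h\<bar> < s / 2"
  unfolding eventually_at using assms by (intro exI[of _ "s / 2"]) (auto simp: dist_real_def)

text \<open>By linearity the error of the quotient is again a \<open>coefficient\<close>, whose
  kernel is the error for the deterministic kernels. A pointwise bound on that kernel therefore
  replaces any new stochastic estimate.\<close>

lemma Y_difference_quotient_bound:
  assumes "0 < s"
  obtains w where "\<And>j. 0 \<le> w j" "summable w"
    "\<And>h j. h \<noteq> 0 \<Longrightarrow> \<bar>h\<bar> < s / 2 \<Longrightarrow>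
      sqnorm (P \<Otimes>\<^sub>M I) (\<lambda>z. (Y n (s + h) j z - Y n s j z) / h - Y (Suc n) s j z) \<le> ennreal (h\<^sup>2 * w j)"
proof -
  obtain K where K: "0 \<le> K" "\<And>l \<sigma> r. l0 \<le> l \<Longrightarrow> \<sigma> \<in> {s / 2..2 * s} \<Longrightarrow> 0 < r \<Longrightarrow>
      (kernel (Suc (Suc n)) l \<sigma> r)\<^sup>2 \<le> K * r powr (- 1 / 2)"
    using kernel_bound[OF assms, of l0 "Suc (Suc n)"] by blast
  obtain E where E: "0 \<le> E" "(\<integral>\<^sup>+ r. ennreal (r powr (- 1 / 2)) \<partial>I) = ennreal E"
    by (rule powr_integral)
  show thesis
  proof (rule that)
    show "0 \<le> (2 * (c j)\<^sup>2 + 4 * (m j)\<^sup>2 * T) * (K * E)" for j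
      using T_pos K(1) E(1) by simp
    show "summable (\<lambda>j. (2 * (c j)\<^sup>2 + 4 * (m j)\<^sup>2 * T) * (K * E))"
      by (rule weights_summable)
    fix h :: real and j
    assume h: "h \<noteq> 0" "\<bar>h\<bar> < s / 2"
    let ?k = "\<lambda>r. (kernel n (l j) (s + h) r - kernel n (l j) s r) / h - kernel (Suc n) (l j) s r"
    let ?k' = "\<lambda>r. (kernel_dr n (l j) (s + h) r - kernel_dr n (l j) s r) / h - kernel_dr (Suc n) (l j) s r"
    have "smooth_kernel ?k ?k'"
      by unfold_locales (intro DERIV_diff DERIV_cdivide kernel_deriv_r, intro continuous_intros h(1) ballI)
    then interpret brownian_convolution P "b j" ?k ?k'
      by (rule brownian_convolution_kernel)
    have eq: "(\<lambda>z. (Y n (s + h) j z - Y n s j z) / h - Y (Suc n) s j z) = coefficient (c j) (m j) (b j) ?k ?k'"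
      unfolding solution_coefficient_def
      by (intro ext coefficient_difference_quotient smooth_kernel_kernel b_continuous)
    have "(?k r)\<^sup>2 \<le> (h\<^sup>2 * K) * r powr (- 1 / 2)" if "0 < r" for r
    proof -
      have "(?k r)\<^sup>2 \<le> h\<^sup>2 * (K * r powr (- 1 / 2))"
      proof (rule difference_quotient_error[OF kernel_deriv_s kernel_deriv_s _ h(1)])
        fix \<sigma> assume "\<sigma> \<in> {min s (s + h)..max s (s + h)}"
        then have "\<sigma> \<in> {s / 2..2 * s}"
          using h(2) by (auto simp: min_def max_def abs_if split: if_splits)
        then show "(kernel (Suc (Suc n)) (l j) \<sigma> r)\<^sup>2 \<le> K * r powr (- 1 / 2)"
          using that by (intro K l0)
      qed
      then show ?thesis
        by (simp add: mult.assoc)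
    qed
    then have "sqnorm (P \<Otimes>\<^sub>M I) (coefficient (c j) (m j) (b j) ?k ?k') \<le>
        ennreal ((2 * (c j)\<^sup>2 + 4 * (m j)\<^sup>2 * T) * (h\<^sup>2 * K * E))"
      using T_pos K(1) by (intro sqnorm_coefficient_le_powr E) auto
    then show "sqnorm (P \<Otimes>\<^sub>M I) (\<lambda>z. (Y n (s + h) j z - Y n s j z) / h - Y (Suc n) s j z)
        \<le> ennreal (h\<^sup>2 * ((2 * (c j)\<^sup>2 + 4 * (m j)\<^sup>2 * T) * (K * E)))"
      unfolding eq by (simp add: mult_ac)
  qed
qed

lemma Y_series_limit_exists:
  assumes "0 < s"
  shows "\<exists>X. series_limit X (Y n s)"
proof -
  obtain w where "\<And>j. 0 \<le> w j" "summable w"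
    "\<And>\<sigma> j. \<sigma> \<in> {s / 2..2 * s} \<Longrightarrow> sqnorm (P \<Otimes>\<^sub>M I) (Y n \<sigma> j) \<le> ennreal (w j)"
    using Y_bound[OF assms] by metis
  then show ?thesis
    using assms by (intro series_limit_exists[where w = w] Y_measurable) auto
qed

lemma Y_series_limitI_pointwise:
  assumes "0 < s" "X \<in> borel_measurable N"
    and "\<And>t. t \<in> {0..T} \<Longrightarrow> AE \<omega> in P.
      L2_tendsto M (\<lambda>n x. \<Sum>j<n. Y 0 s j (\<omega>, t) * e j x) (\<lambda>x. X (\<omega>, (x, t))) sequentially"
  shows "series_limit X (Y 0 s)"
proof -
  obtain w where "\<And>j. 0 \<le> w j" "summable w"
    "\<And>\<sigma> j. \<sigma> \<in> {s / 2..2 * s} \<Longrightarrow> sqnorm (P \<Otimes>\<^sub>M I) (Y 0 \<sigma> j) \<le> ennreal (w j)"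
    using Y_bound[OF assms(1)] by metis
  then show ?thesis
    using assms by (intro series_limitI_pointwise[where w = w] Y_measurable) (auto simp: space_restrict_space)
qed

lemma Y_series_limit_L2:
  assumes "0 < s" "series_limit X (Y n s)"
  shows "X \<in> L2 N"
proof -
  obtain w where "\<And>j. 0 \<le> w j" "summable w"
    "\<And>\<sigma> j. \<sigma> \<in> {s / 2..2 * s} \<Longrightarrow> sqnorm (P \<Otimes>\<^sub>M I) (Y n \<sigma> j) \<le> ennreal (w j)"
    using Y_bound[OF assms(1)] by metis
  then show ?thesis
    using assms by (intro series_limit_L2[where w = w]) auto
qed

lemma Y_series_sum_L2:
  assumes "0 < s"
  shows "series_sum {..<i} (Y n s) \<in> L2 N"
proof -
  obtain w where w: "\<And>j. 0 \<le> w j" "summable w"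
    "\<And>\<sigma> j. \<sigma> \<in> {s / 2..2 * s} \<Longrightarrow> sqnorm (P \<Otimes>\<^sub>M I) (Y n \<sigma> j) \<le> ennreal (w j)"
    using Y_bound[OF assms] by metis
  have "sqnorm N (series_sum {..<i} (Y n s)) \<le> ennreal (\<Sum>j<i. w j)"
    using assms w by (intro sqnorm_series_sum_le Y_measurable) auto
  also have "\<dots> < \<top>"
    by simp
  finally show ?thesis
    by (simp add: L2_iff_sqnorm series_sum_measurable Y_measurable)
qed

text \<open>Left general in \<open>n\<close> and \<open>X\<close>, so that it serves both the given
  solution (order 0) and the chosen first derivative (order 1).\<close>

lemma has_bochner_L2_derivativeI:
  assumes "0 < s"
    and X: "\<And>\<sigma>. 0 < \<sigma> \<Longrightarrow> series_limit (\<lambda>z. X \<sigma> (fst z) (snd z)) (Y n \<sigma>)"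
    and X': "series_limit (\<lambda>z. X' (fst z) (snd z)) (Y (Suc n) s)"
  shows "has_bochner_L2_derivative P (M \<Otimes>\<^sub>M I) X X' s"
  unfolding has_bochner_L2_derivative_def
proof (rule bochner_L2_tendstoI)
  show "finite_measure P" "finite_measure (M \<Otimes>\<^sub>M I)"
    by (rule finite_P finite_MR)+
  show "(\<lambda>z. X' (fst z) (snd z)) \<in> L2 N"
    using assms by (intro Y_series_limit_L2)
  have pos: "\<forall>\<^sub>F h in at 0. 0 < s + h"
    using eventually_shift_in_range[OF \<open>0 < s\<close>] by eventually_elim auto
  then show "\<forall>\<^sub>F h in at 0. (\<lambda>z. (X (s + h) (fst z) (snd z) - X s (fst z) (snd z)) / h) \<in> L2 N"
  proof eventually_elim
    case (elim h)
    have "(\<lambda>z. 1 / h * (X (s + h) (fst z) (snd z) - X s (fst z) (snd z))) \<in> L2 N"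
      using elim \<open>0 < s\<close> by (intro L2_cmult L2_diff Y_series_limit_L2[OF _ X])
    then show ?case
      by simp
  qed
  obtain w where w: "\<And>j. 0 \<le> w j" "summable w"
    "\<And>h j. h \<noteq> 0 \<Longrightarrow> \<bar>h\<bar> < s / 2 \<Longrightarrow>
      sqnorm (P \<Otimes>\<^sub>M I) (\<lambda>z. (Y n (s + h) j z - Y n s j z) / h - Y (Suc n) s j z) \<le> ennreal (h\<^sup>2 * w j)"
    using Y_difference_quotient_bound[OF \<open>0 < s\<close>, of n] by blast
  show "((\<lambda>h. sqnorm N (\<lambda>z. (X (s + h) (fst z) (snd z) - X s (fst z) (snd z)) / h - X' (fst z) (snd z))) \<longlongrightarrow> 0) (at 0)"
  proof (rule series_limit_difference_quotient[where g = "Y n"])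
    show "\<forall>\<^sub>F h in at 0. series_limit (\<lambda>z. X (s + h) (fst z) (snd z)) (Y n (s + h))"
      using pos by eventually_elim (rule X)
    show "\<forall>\<^sub>F h in at 0. \<forall>j. sqnorm (P \<Otimes>\<^sub>M I)
        (\<lambda>z. (Y n (s + h) j z - Y n s j z) / h - Y (Suc n) s j z) \<le> ennreal (h\<^sup>2 * w j)"
      using eventually_shift_in_range[OF \<open>0 < s\<close>] by eventually_elim (use w(3) in blast)
  qed (use X[OF \<open>0 < s\<close>] X' w in auto)
qed

lemma bochner_L2_tendsto_series:
  assumes "0 < s" and X: "series_limit (\<lambda>z. X (fst z) (snd z)) (Y n s)"
  shows "bochner_L2_tendsto P (M \<Otimes>\<^sub>M I) (\<lambda>i \<omega> (x, t). \<Sum>j<i. Y n s j (\<omega>, t) * e j x) X sequentially"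
proof (rule bochner_L2_tendstoI)
  show "finite_measure P" "finite_measure (M \<Otimes>\<^sub>M I)"
    by (rule finite_P finite_MR)+
  show "(\<lambda>z. X (fst z) (snd z)) \<in> L2 N"
    using assms by (intro Y_series_limit_L2)
  have eq: "(\<lambda>z. (case snd z of (x, t) \<Rightarrow> \<Sum>j<i. Y n s j (fst z, t) * e j x)) = series_sum {..<i} (Y n s)" for i
    by (simp add: series_sum_def[abs_def] split_beta)
  have eq': "(case snd z of (x, t) \<Rightarrow> \<Sum>j<i. Y n s j (fst z, t) * e j x) = series_sum {..<i} (Y n s) z" for i z
    by (simp add: series_sum_def split_beta)
  show "\<forall>\<^sub>F i in sequentially. (\<lambda>z. (case snd z of (x, t) \<Rightarrow> \<Sum>j<i. Y n s j (fst z, t) * e j x)) \<in> L2 N"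
    unfolding eq using Y_series_sum_L2[OF \<open>0 < s\<close>] by simp
  show "(\<lambda>i. sqnorm N (\<lambda>z. (case snd z of (x, t) \<Rightarrow> \<Sum>j<i. Y n s j (fst z, t) * e j x) - X (fst z) (snd z))) \<longlonglongrightarrow> 0"
    unfolding eq' using X by (subst sqnorm_minus_commute) (simp add: series_limit_def)
qed

lemma series_limit_bochner_L2:
  assumes "0 < s" and X: "series_limit (\<lambda>z. X (fst z) (snd z)) (Y n s)"
  shows "X \<in> bochner_L2 P (M \<Otimes>\<^sub>M I)"
    and "(\<lambda>\<omega>. L2_norm (M \<Otimes>\<^sub>M I) (X \<omega>)) \<in> borel_measurable P"
    and "AE \<omega> in P. L2_norm (M \<Otimes>\<^sub>M I) (X \<omega>) < \<top>"
proof -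
  have fin: "finite_measure P" "finite_measure (M \<Otimes>\<^sub>M I)" and sf: "sigma_finite_measure (M \<Otimes>\<^sub>M I)"
    by (rule finite_P finite_MR finite_measure.axioms(1))+
  have L2: "(\<lambda>z. X (fst z) (snd z)) \<in> L2 N"
    using assms by (intro Y_series_limit_L2)
  then have meas [measurable]: "(\<lambda>z. X (fst z) (snd z)) \<in> borel_measurable N"
    by (simp add: L2_iff_sqnorm)
  show "X \<in> bochner_L2 P (M \<Otimes>\<^sub>M I)"
    using fin L2 by (rule bochner_L2I)
  have [measurable]: "(\<lambda>\<omega>. sqnorm (M \<Otimes>\<^sub>M I) (X \<omega>)) \<in> borel_measurable P"
    unfolding sqnorm_def by measurable
  then show "(\<lambda>\<omega>. L2_norm (M \<Otimes>\<^sub>M I) (X \<omega>)) \<in> borel_measurable P"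
    unfolding L2_norm_eq_sqnorm by measurable
  have "(\<integral>\<^sup>+ \<omega>. sqnorm (M \<Otimes>\<^sub>M I) (X \<omega>) \<partial>P) < \<top>"
    using sqnorm_pair_measure[OF sf meas] L2 by (simp add: L2_iff_sqnorm)
  then have "AE \<omega> in P. sqnorm (M \<Otimes>\<^sub>M I) (X \<omega>) \<noteq> \<infinity>"
    by (intro nn_integral_noteq_infinite) auto
  then show "AE \<omega> in P. L2_norm (M \<Otimes>\<^sub>M I) (X \<omega>) < \<top>"
    by eventually_elim (simp add: L2_norm_eq_sqnorm ennreal_sqrt_less_top_iff less_top)
qed

end

section \<open>The given solution as the series of pathwise modes, and its two derivatives\<close>

theorem proposition4p3:
  fixes P :: "'w measure" and D :: "real set" and T \<alpha> :: real
    and A :: "(real \<Rightarrow> real) set" and L Q :: "(real \<Rightarrow> real) \<Rightarrow> (real \<Rightarrow> real)"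
    and e :: "nat \<Rightarrow> real \<Rightarrow> real" and lam mu :: "nat \<Rightarrow> real"
    and F :: "real \<Rightarrow> 'w measure" and B :: "nat \<Rightarrow> real \<Rightarrow> 'w \<Rightarrow> real"
    and W :: "real \<Rightarrow> 'w \<Rightarrow> real \<Rightarrow> real"
    and y0 :: "real \<Rightarrow> real"
    and Yj :: "nat \<Rightarrow> real \<Rightarrow> real \<Rightarrow> 'w \<Rightarrow> real"
    and y :: "real \<Rightarrow> 'w \<Rightarrow> real \<times> real \<Rightarrow> real"
  assumes "stochastic_setting P D T A L e lam Q mu F B W"
    and "0 < \<alpha>" and "\<alpha> < lam 0" and "mono lam" and "filterlim lam at_top sequentially"
    and "summable mu"
    and "y0 \<in> L2 (space_measure D)"
    and "solution_coefficients P D T e lam mu B y0 Yj"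
    and "solution_series P D T e Yj y"
  shows "\<exists>dYj ddYj dy ddy.
    coefficient_derivatives P T Yj dYj ddYj \<and>
    (\<forall>s>0.
       has_bochner_L2_derivative P (space_time_measure D T) y (dy s) s \<and>
       has_bochner_L2_derivative P (space_time_measure D T) dy (ddy s) s \<and>
       bochner_L2_tendsto P (space_time_measure D T)
         (\<lambda>n \<omega> (x, t). \<Sum>j<n. dYj j t s \<omega> * e j x) (dy s) sequentially \<and>
       bochner_L2_tendsto P (space_time_measure D T)
         (\<lambda>n \<omega> (x, t). \<Sum>j<n. ddYj j t s \<omega> * e j x) (ddy s) sequentially \<and>
       dy s \<in> bochner_L2 P (space_time_measure D T) \<and>
       ddy s \<in> bochner_L2 P (space_time_measure D T) \<and>
       (\<lambda>\<omega>. L2_norm (space_time_measure D T) (dy s \<omega>)) \<in> borel_measurable P \<and>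
       (AE \<omega> in P. L2_norm (space_time_measure D T) (dy s \<omega>) < \<top>) \<and>
       (\<lambda>\<omega>. L2_norm (space_time_measure D T) (ddy s \<omega>)) \<in> borel_measurable P \<and>
       (AE \<omega> in P. L2_norm (space_time_measure D T) (ddy s \<omega>) < \<top>))"
proof -
  interpret stochastic_setting P D T A L e lam Q mu F B W by fact
  let ?M = "space_measure D" and ?I = "restrict_space lborel {0..T}"
  have e: "\<And>j. e j \<in> L2 ?M" "\<And>i j. L2_inner ?M (e i) (e j) = (if i = j then 1 else 0)"
    using e_basis by (auto simp: orthonormal_basis_L2_def)
  have lam: "\<alpha> < lam j" for j
    using monoD[OF \<open>mono lam\<close>, of 0 j] \<open>\<alpha> < lam 0\<close> by simp
  define c where "c j = L2_inner ?M y0 (e j)" for j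
  define m where "m j = sqrt (mu j)" for j
  define l where "l j = ln (lam j)" for j
  \<comment> \<open>Each driving motion is exchanged for a version with all paths continuous; the
    modes built from these versions are smooth in \<open>s\<close> at every outcome.\<close>
  have "\<forall>j. \<exists>b. continuous_brownian P b \<and> (\<forall>t\<ge>0. AE \<omega> in P. b t \<omega> = B j t \<omega>)"
    using W_wiener standard_brownian_motion_continuous_version unfolding Q_wiener_process_def by metis
  then obtain b where b: "\<And>j. continuous_brownian P (b j)"
    and b_eq: "\<And>j t. 0 \<le> t \<Longrightarrow> AE \<omega> in P. b j t \<omega> = B j t \<omega>"
    by metis
  interpret S: solution_family P ?M T e c m l b "ln \<alpha>"
  proof (intro solution_family.intro orthonormal_system.intro solution_family_axioms.intro)
    show "finite_measure P" "prob_space P"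
      by (rule finite_measure_axioms prob_space_axioms)+
    show "finite_measure ?M"
    proof (rule finite_measureI)
      have "emeasure ?M (space ?M) = emeasure lborel D"
        using D(1) by (subst emeasure_restrict_space) (auto simp: space_restrict_space)
      then show "emeasure ?M (space ?M) \<noteq> \<infinity>"
        using emeasure_bounded_finite[OF D(2)] by auto
    qed
    show "finite_measure ?I"
      by (rule finite_measure_interval)
    show "summable (\<lambda>j. (c j)\<^sup>2)"
      unfolding c_def by (intro bessel_inequality e \<open>y0 \<in> L2 ?M\<close>)
    show "summable (\<lambda>j. (m j)\<^sup>2)"
      using \<open>summable mu\<close> by (simp add: m_def mu_nonneg)
    show "ln \<alpha> \<le> l j" for j
      using lam[of j] \<open>0 < \<alpha>\<close> by (simp add: l_def)
  qed (use e T b in auto)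
  have b_cont: "continuous_on UNIV (\<lambda>t. b j t \<omega>)" for j \<omega>
    by (rule continuous_brownian.b_continuous[OF b])
  \<comment> \<open>For each \<open>s\<close>, \<open>t\<close> and \<open>j\<close> separately, any
    version of the Wiener integral agrees almost surely with the pathwise convolution.\<close>
  have version: "AE \<omega> in P. S.Y 0 s j (\<omega>, t) = Yj j t s \<omega>" if st: "0 < s" "t \<in> {0..T}" for s t j
  proof -
    interpret brownian_convolution P "b j" "kernel 0 (l j) s" "kernel_dr 0 (l j) s"
      by (intro S.brownian_convolution_kernel smooth_kernel_kernel)
    have powr: "lam j powr s = exp (s * l j)"
      using lam[of j] \<open>0 < \<alpha>\<close> by (simp add: powr_def l_def)
    obtain X where X: "has_wiener_integral P (B j) t (\<lambda>r. exp (- (lam j powr s) * (t - r))) X"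
      and Y: "Yj j t s = (\<lambda>\<omega>. L2_inner ?M y0 (e j) * exp (- (lam j powr s) * t) + sqrt (mu j) * X \<omega>)"
      using \<open>solution_coefficients P D T e lam mu B y0 Yj\<close> st unfolding solution_coefficients_def by blast
    have "has_wiener_integral P (B j) t (\<lambda>r. kernel 0 (l j) s (t - r)) X"
      using X by (simp add: kernel_0 powr)
    from wiener_integral_eq_convolution[OF _ b_eq this] have "AE \<omega> in P. X \<omega> = convolution t \<omega>"
      using st by auto
    then show ?thesis
      by eventually_elim
        (simp add: Y solution_coefficient_def coefficient_def kernel_0 powr c_def m_def)
  qed
  have y_limit: "S.series_limit (\<lambda>z. y s (fst z) (snd z)) (S.Y 0 s)" if "0 < s" for s
  proof (rule S.Y_series_limitI_pointwise[OF that])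
    have "(\<lambda>(\<omega>, z). y s \<omega> z) \<in> borel_measurable S.N"
      using \<open>solution_series P D T e Yj y\<close> that by (simp add: solution_series_def)
    then show "(\<lambda>z. y s (fst z) (snd z)) \<in> borel_measurable S.N"
      by (simp add: case_prod_beta')
    fix t assume t: "t \<in> {0..T}"
    \<comment> \<open>Only countably many modes occur, so at fixed \<open>s\<close> and
      \<open>t\<close> one null set suffices for the whole series.\<close>
    have "AE \<omega> in P. \<forall>j. S.Y 0 s j (\<omega>, t) = Yj j t s \<omega>"
      using version[OF that t] by (simp add: AE_all_countable)
    moreover have "AE \<omega> in P. L2_tendsto ?M (\<lambda>n x. \<Sum>j<n. Yj j t s \<omega> * e j x) (\<lambda>x. y s \<omega> (x, t)) sequentially"
      using \<open>solution_series P D T e Yj y\<close> that t by (simp add: solution_series_def)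
    ultimately show "AE \<omega> in P. L2_tendsto ?M (\<lambda>n x. \<Sum>j<n. S.Y 0 s j (\<omega>, t) * e j x)
        (\<lambda>x. y s (fst (\<omega>, (x, t))) (snd (\<omega>, (x, t)))) sequentially"
      by eventually_elim simp
  qed
  have ex: "\<exists>X. S.series_limit (\<lambda>z. X (fst z) (snd z)) (S.Y n s)" if "0 < s" for n s
  proof -
    obtain X where "S.series_limit X (S.Y n s)"
      using S.Y_series_limit_exists[OF \<open>0 < s\<close>] by blast
    then show ?thesis
      by (intro exI[of _ "\<lambda>\<omega> z. X (\<omega>, z)"]) simp
  qed
  \<comment> \<open>A representative is chosen for every \<open>s\<close> at once, since the second
    derivative is a limit of difference quotients of \<open>u 1\<close>. The choice is immaterial,
    as only mean-square distances enter.\<close>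
  define u where "u n s = (SOME X. S.series_limit (\<lambda>z. X (fst z) (snd z)) (S.Y n s))" for n s
  have u: "S.series_limit (\<lambda>z. u n s (fst z) (snd z)) (S.Y n s)" if "0 < s" for n s
    unfolding u_def using ex[OF that] by (rule someI_ex)
  have coeff: "coefficient_derivatives P T Yj (\<lambda>j t s \<omega>. S.Y 1 s j (\<omega>, t)) (\<lambda>j t s \<omega>. S.Y 2 s j (\<omega>, t))"
    unfolding coefficient_derivatives_def
  \<comment> \<open>The modification required is the pathwise mode of order 0; its derivatives in
    \<open>s\<close> are the modes of orders 1 and 2.\<close>
  proof (intro exI[of _ "\<lambda>j t s \<omega>. S.Y 0 s j (\<omega>, t)"] allI ballI impI conjI)
    fix j t s assume "t \<in> {0..T}" "0 < (s::real)"
    then show "AE \<omega> in P. S.Y 0 s j (\<omega>, t) = Yj j t s \<omega>"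
      by (intro version)
    show "((\<lambda>r. S.Y 0 r j (\<omega>, t)) has_real_derivative S.Y 1 s j (\<omega>, t)) (at s)" for \<omega>
      using solution_coefficient_deriv[of b j, OF b_cont, of c m l 0] by simp
    show "((\<lambda>r. S.Y 1 r j (\<omega>, t)) has_real_derivative S.Y 2 s j (\<omega>, t)) (at s)" for \<omega>
      using solution_coefficient_deriv[of b j, OF b_cont, of c m l 1] by (simp add: numeral_2_eq_2)
  qed
  have "has_bochner_L2_derivative P (space_time_measure D T) y (u 1 s) s" if "0 < s" for s
    using S.has_bochner_L2_derivativeI[OF that y_limit, of "u 1 s"] u[OF that, of 1] by simp
  moreover have "has_bochner_L2_derivative P (space_time_measure D T) (u 1) (u 2 s) s" if "0 < s" for s
    using S.has_bochner_L2_derivativeI[OF that u, of "u 2 s" 1] u[OF that, of 2] by (simp add: numeral_2_eq_2)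
  ultimately show ?thesis
    using coeff S.bochner_L2_tendsto_series[OF _ u] S.series_limit_bochner_L2[OF _ u]
    by (intro exI[of _ "\<lambda>j t s \<omega>. S.Y 1 s j (\<omega>, t)"] exI[of _ "\<lambda>j t s \<omega>. S.Y 2 s j (\<omega>, t)"]
        exI[of _ "u 1"] exI[of _ "u 2"]) simp
qed

end
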